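(* Let $M$ be a $\sigma$-compact smooth manifold of dimension $k\ge 1$ with a locally Lebesgue measure $\mu$, let $G\subseteq \mathrm{U}_n(\mathbb{C})$ be a closed subgroup, let $E\to M$ be a complex vector bundle with typical fibre $\mathbb{C}^n$ which is a $G$-bundle, and let $L^2(E)$ be its Hilbert space of $L^2$-sections. Consider the action $\alpha:\mathrm{U}(L^\infty_{\mathbb{C}}(M))\to\mathrm{Aut}\,\mathrm{CAR}(L^2(E))$ determined by $\alpha_u(a(c))=a(u\cdot c)$ for $c\in L^2(E)$. Then for each relatively compact Borel set $W\subset M$, with complement $W^c=M\setminus W$, the subalgebra $\mathcal{A}(W)\subseteq \mathrm{CAR}(L^2(E))$ is the fixed point algebra of the subgroup $\mathrm{U}(L^\infty_{\mathbb{C}}(W^c))$ of $\mathrm{U}(L^\infty_{\mathbb{C}}(M))$, i.e. $$\mathcal{A}(W)=\{A\in\mathrm{CAR}(L^2(E)) : \alpha_u(A)=A \text{ for all } u\in \mathrm{U}(L^\infty_{\mathbb{C}}(W^c))\}.$$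
   Context: For a complex Hilbert space $\mathcal{H}$ (inner product antilinear in the first variable), $\mathrm{CAR}(\mathcal{H})$ is the unital $C^*$-algebra, unique up to natural isomorphism, generated by the image of a continuous antilinear map $a:\mathcal{H}\to\mathrm{CAR}(\mathcal{H})$ with $a(f)a(g)^*+a(g)^*a(f)=\langle f,g\rangle\mathbf{1}$ and $a(f)a(g)+a(g)a(f)=0$ for all $f,g\in\mathcal{H}$ (with $\mathrm{CAR}(\{0\})=\mathbb{C}\mathbf{1}$). The unitary group $\mathrm{U}(\mathcal{H})$ acts on it by automorphisms $\alpha_U$ determined by $\alpha_U(a(f))=a(Uf)$. A $G$-bundle is a vector bundle with typical fibre $\mathbb{C}^n$ having an atlas of local trivializations whose transition functions take values in $G$; equivalently $E=(P\times\mathbb{C}^n)/G$ for a $G$-principal bundle $P\to M$, with $G$ acting by $g.(p,\mathbf{v})=(pg^{-1},g\mathbf{v})$. Since $G$ is unitary, $|[p,\mathbf{v}]|:=|\mathbf{v}|$ (Euclidean norm) is a well-defined fibrewise norm on $E$. A locally Lebesgue measure $\mu$ on $M$ is a Borel measure, finite on compact sets, which in each local chart is equivalent (mutually absolutely continuous) to Lebesgue measure on $\mathbb{R}^k$ (e.g. one given by a nowhere vanishing smooth $k$-form). $L^2(E)$ is the Hilbert space completion of the space of smooth sections $c$ of $E$ with $\|c\|^2=\int_M|c(x)|^2\,d\mu(x)<\infty$. The algebra $L^\infty_{\mathbb{C}}(M)=L^\infty(M,\mu;\mathbb{C})$ acts on $L^2(E)$ by pointwise multiplication, and $\mathrm{U}(L^\infty_{\mathbb{C}}(M))$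 is its unitary group, viewed as a subgroup of $\mathrm{U}(L^2(E))$. For a Borel set $W\subseteq M$, $L^2(E|_W):=\chi_W L^2(E)$, and $\mathcal{A}(W)$ is the unital $C^*$-subalgebra of $\mathrm{CAR}(L^2(E))$ generated by $\{a(c): c\in L^2(E|_W)\}$ (isomorphic to $\mathrm{CAR}(L^2(E|_W))$). The group $\mathrm{U}(L^\infty_{\mathbb{C}}(W^c))$ is identified with the group of those $u\in\mathrm{U}(L^\infty_{\mathbb{C}}(M))$ that are equal to $1$ ($\mu$-a.e.) on $W$. *)

theory Defs
  imports "HOL-Analysis.Analysis"
begin

section \<open>Smooth manifolds\<close>

text \<open>
  Smoothness on an open set: all iterated directional derivatives along the standard basis exist
  and are continuous.  Only used for open \<open>S\<close>, so that \<open>at x\<close> sees only values of \<open>f\<close> inside \<open>S\<close>.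
\<close>

primrec Ck_on :: "nat \<Rightarrow> 'a::euclidean_space set \<Rightarrow> ('a \<Rightarrow> 'b::real_normed_vector) \<Rightarrow> bool" where
  "Ck_on 0 S f \<longleftrightarrow> continuous_on S f"
| "Ck_on (Suc r) S f \<longleftrightarrow>
     (\<forall>x\<in>S. f differentiable (at x)) \<and>
     (\<forall>b\<in>Basis. Ck_on r S (\<lambda>x. frechet_derivative f (at x) b))"

definition smooth_on :: "'a::euclidean_space set \<Rightarrow> ('a \<Rightarrow> 'b::real_normed_vector) \<Rightarrow> bool" where
  "smooth_on S f \<longleftrightarrow> (\<forall>r. Ck_on r S f)"

text \<open>
  The manifold is the whole Hausdorff type \<open>'m\<close>; a chart \<open>(U, \<phi>)\<close> is a homeomorphism from the open
  set \<open>U\<close> onto an open subset of \<open>\<real>\<^sup>k\<close>, where \<open>k = CARD('k) \<ge> 1\<close>.  Atlases are not required to be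
  maximal.
\<close>

type_synonym ('m, 'k) chart = "'m set \<times> ('m \<Rightarrow> real^'k)"

definition smooth_atlas :: "('m::t2_space, 'k::finite) chart set \<Rightarrow> bool" where
  "smooth_atlas \<A> \<longleftrightarrow>
     (\<Union>(U, \<phi>)\<in>\<A>. U) = UNIV \<and>
     (\<forall>(U, \<phi>)\<in>\<A>. open U \<and> open (\<phi> ` U) \<and> homeomorphism U (\<phi> ` U) \<phi> (inv_into U \<phi>)) \<and>
     (\<forall>(U, \<phi>)\<in>\<A>. \<forall>(V, \<psi>)\<in>\<A>. smooth_on (\<phi> ` (U \<inter> V)) (\<psi> \<circ> inv_into U \<phi>))"

definition smooth_on_mfd ::
    "('m::t2_space, 'k::finite) chart set \<Rightarrow> 'm set \<Rightarrow> ('m \<Rightarrow> 'b::real_normed_vector) \<Rightarrow> bool" where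
  "smooth_on_mfd \<A> V f \<longleftrightarrow>
     (\<forall>(U, \<phi>)\<in>\<A>. smooth_on (\<phi> ` (U \<inter> V)) (f \<circ> inv_into U \<phi>))"

definition sigma_compact :: "'m::topological_space set \<Rightarrow> bool" where
  "sigma_compact S \<longleftrightarrow> (\<exists>K :: nat \<Rightarrow> 'm set. (\<forall>i. compact (K i)) \<and> (\<Union>i. K i) = S)"

definition equivalent_measures :: "'a measure \<Rightarrow> 'a measure \<Rightarrow> bool" where
  "equivalent_measures M N \<longleftrightarrow>
     sets M = sets N \<and> absolutely_continuous M N \<and> absolutely_continuous N M"

definition locally_lebesgue ::
    "('m::t2_space, 'k::finite) chart set \<Rightarrow> 'm measure \<Rightarrow> bool" where
  "locally_lebesgue \<A> \<mu> \<longleftrightarrow>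
     sets \<mu> = sets borel \<and>
     (\<forall>K. compact K \<longrightarrow> emeasure \<mu> K < \<infinity>) \<and>
     (\<forall>(U, \<phi>)\<in>\<A>.
        equivalent_measures
          (distr (restrict_space \<mu> U) (restrict_space borel (\<phi> ` U)) \<phi>)
          (restrict_space lborel (\<phi> ` U)))"


section \<open>Hermitian bundles with structure group\<close>

definition conj_transpose :: "complex^'n^'n \<Rightarrow> complex^'n^'n" where
  "conj_transpose A = (\<chi> i j. cnj (A $ j $ i))"

definition unitary_matrices :: "(complex^'n^'n) set" where
  "unitary_matrices = {A. conj_transpose A ** A = mat 1 \<and> A ** conj_transpose A = mat 1}"

definition closed_unitary_subgroup :: "(complex^'n^'n) set \<Rightarrow> bool" where
  "closed_unitary_subgroup G \<longleftrightarrow>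
     G \<subseteq> unitary_matrices \<and> closed G \<and> mat 1 \<in> G \<and>
     (\<forall>A\<in>G. \<forall>B\<in>G. A ** B \<in> G) \<and> (\<forall>A\<in>G. matrix_inv A \<in> G)"

text \<open>
  The total space is the whole type \<open>'e\<close>; the last field holds the pairs \<open>(V, \<psi>)\<close> for which
  \<open>e \<mapsto> (proj e, \<psi> e)\<close> is a local trivialization over \<open>V\<close>.  The smooth structure of the
  total space is the one for which these are diffeomorphisms, so smoothness enters only through the
  transition functions.
\<close>

record ('e, 'm, 'n) vector_bundle =
  proj :: "'e \<Rightarrow> 'm"
  fibre_add :: "'e \<Rightarrow> 'e \<Rightarrow> 'e"
  fibre_scale :: "complex \<Rightarrow> 'e \<Rightarrow> 'e"
  trivs :: "('m set \<times> ('e \<Rightarrow> complex^'n)) set"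

definition G_bundle ::
    "('m::t2_space, 'k::finite) chart set \<Rightarrow> (complex^'n::finite^'n) set \<Rightarrow>
     ('e::topological_space, 'm, 'n) vector_bundle \<Rightarrow> bool" where
  "G_bundle \<A> G E \<longleftrightarrow>
     (\<Union>(V, \<psi>)\<in>trivs E. V) = UNIV \<and>
     continuous_on UNIV (proj E) \<and>
     (\<forall>e e'. proj E e = proj E e' \<longrightarrow> proj E (fibre_add E e e') = proj E e) \<and>
     (\<forall>z e. proj E (fibre_scale E z e) = proj E e) \<and>
     (\<forall>(V, \<psi>)\<in>trivs E.
        open V \<and>
        (\<exists>g. homeomorphism (proj E -` V) (V \<times> UNIV) (\<lambda>e. (proj E e, \<psi> e)) g) \<and>
        (\<forall>e e'. proj E e \<in> V \<longrightarrow> proj E e = proj E e' \<longrightarrow>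
           \<psi> (fibre_add E e e') = \<psi> e + \<psi> e') \<and>
        (\<forall>z e. proj E e \<in> V \<longrightarrow> \<psi> (fibre_scale E z e) = z *s \<psi> e)) \<and>
     (\<forall>(V, \<psi>)\<in>trivs E. \<forall>(V', \<psi>')\<in>trivs E.
        \<exists>g. smooth_on_mfd \<A> (V \<inter> V') g \<and> (\<forall>x\<in>V \<inter> V'. g x \<in> G) \<and>
            (\<forall>e. proj E e \<in> V \<inter> V' \<longrightarrow> \<psi>' e = g (proj E e) *v \<psi> e))"

text \<open>
  The fibre norm and inner product are read off in an arbitrary trivialization; they do not depend on
  the choice because the structure group is unitary.
\<close>

definition triv_at :: "('e, 'm, 'n::finite) vector_bundle \<Rightarrow> 'm \<Rightarrow> 'e \<Rightarrow> complex^'n" where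
  "triv_at E x = (SOME \<psi>. \<exists>V. (V, \<psi>) \<in> trivs E \<and> x \<in> V)"

definition fibre_norm :: "('e, 'm, 'n::finite) vector_bundle \<Rightarrow> 'e \<Rightarrow> real" where
  "fibre_norm E e = norm (triv_at E (proj E e) e)"

definition fibre_inner :: "('e, 'm, 'n::finite) vector_bundle \<Rightarrow> 'e \<Rightarrow> 'e \<Rightarrow> complex" where
  "fibre_inner E e e' =
     (\<Sum>i\<in>UNIV. cnj (triv_at E (proj E e) e $ i) * triv_at E (proj E e) e' $ i)"

definition sections :: "('e, 'm, 'n::finite) vector_bundle \<Rightarrow> ('m \<Rightarrow> 'e) set" where
  "sections E = {c. \<forall>x. proj E (c x) = x}"

definition smooth_sections ::
    "('m::t2_space, 'k::finite) chart set \<Rightarrow> ('e, 'm, 'n::finite) vector_bundle \<Rightarrow> ('m \<Rightarrow> 'e) set" where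
  "smooth_sections \<A> E =
     {c \<in> sections E. \<forall>(V, \<psi>)\<in>trivs E. smooth_on_mfd \<A> V (\<psi> \<circ> c)}"

definition sec_add ::
    "('e, 'm, 'n::finite) vector_bundle \<Rightarrow> ('m \<Rightarrow> 'e) \<Rightarrow> ('m \<Rightarrow> 'e) \<Rightarrow> 'm \<Rightarrow> 'e" where
  "sec_add E c d = (\<lambda>x. fibre_add E (c x) (d x))"

definition sec_mult ::
    "('e, 'm, 'n::finite) vector_bundle \<Rightarrow> ('m \<Rightarrow> complex) \<Rightarrow> ('m \<Rightarrow> 'e) \<Rightarrow> 'm \<Rightarrow> 'e" where
  "sec_mult E u c = (\<lambda>x. fibre_scale E (u x) (c x))"


section \<open>The Hilbert space of square-integrable sections\<close>

record 'h hilbert_structure =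
  vecs :: "'h set"
  vadd :: "'h \<Rightarrow> 'h \<Rightarrow> 'h"
  vscale :: "complex \<Rightarrow> 'h \<Rightarrow> 'h"
  vinner :: "'h \<Rightarrow> 'h \<Rightarrow> complex"

definition norm2_sq :: "'m measure \<Rightarrow> ('e, 'm, 'n::finite) vector_bundle \<Rightarrow> ('m \<Rightarrow> 'e) \<Rightarrow> ennreal" where
  "norm2_sq \<mu> E c = (\<integral>\<^sup>+ x. ennreal ((fibre_norm E (c x))\<^sup>2) \<partial>\<mu>)"

text \<open>
  The completion of the space of smooth square-integrable sections is realized as its closure in the
  (complete) space of all measurable square-integrable sections modulo equality almost everywhere.
\<close>

definition L2_sections ::
    "('m::t2_space, 'k::finite) chart set \<Rightarrow> 'm measure \<Rightarrow>
     ('e::topological_space, 'm, 'n::finite) vector_bundle \<Rightarrow> ('m \<Rightarrow> 'e) set" where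
  "L2_sections \<A> \<mu> E =
     {c \<in> sections E. c \<in> borel_measurable \<mu> \<and> norm2_sq \<mu> E c < \<infinity> \<and>
        (\<forall>\<epsilon>>0. \<exists>s\<in>smooth_sections \<A> E.
           norm2_sq \<mu> E s < \<infinity> \<and> norm2_sq \<mu> E (sec_add E c (sec_mult E (\<lambda>_. - 1) s)) < \<epsilon>)}"

definition ae_rel ::
    "('m::t2_space, 'k::finite) chart set \<Rightarrow> 'm measure \<Rightarrow>
     ('e::topological_space, 'm, 'n::finite) vector_bundle \<Rightarrow> (('m \<Rightarrow> 'e) \<times> ('m \<Rightarrow> 'e)) set" where
  "ae_rel \<A> \<mu> E =
     {(c, d). c \<in> L2_sections \<A> \<mu> E \<and> d \<in> L2_sections \<A> \<mu> E \<and> (AE x in \<mu>. c x = d x)}"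

definition rep :: "'a set \<Rightarrow> 'a" where
  "rep X = (SOME c. c \<in> X)"

definition L2 ::
    "('m::t2_space, 'k::finite) chart set \<Rightarrow> 'm measure \<Rightarrow>
     ('e::topological_space, 'm, 'n::finite) vector_bundle \<Rightarrow> ('m \<Rightarrow> 'e) set hilbert_structure" where
  "L2 \<A> \<mu> E =
     \<lparr>vecs = L2_sections \<A> \<mu> E // ae_rel \<A> \<mu> E,
      vadd = (\<lambda>X Y. ae_rel \<A> \<mu> E `` {sec_add E (rep X) (rep Y)}),
      vscale = (\<lambda>z X. ae_rel \<A> \<mu> E `` {sec_mult E (\<lambda>_. z) (rep X)}),
      vinner = (\<lambda>X Y. \<integral>x. fibre_inner E (rep X x) (rep Y x) \<partial>\<mu>)\<rparr>"

definition mult_op ::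
    "('m::t2_space, 'k::finite) chart set \<Rightarrow> 'm measure \<Rightarrow>
     ('e::topological_space, 'm, 'n::finite) vector_bundle \<Rightarrow> ('m \<Rightarrow> complex) \<Rightarrow>
     ('m \<Rightarrow> 'e) set \<Rightarrow> ('m \<Rightarrow> 'e) set" where
  "mult_op \<A> \<mu> E u = (\<lambda>X\<in>vecs (L2 \<A> \<mu> E). ae_rel \<A> \<mu> E `` {sec_mult E u (rep X)})"

definition Linf :: "'m measure \<Rightarrow> ('m \<Rightarrow> complex) set" where
  "Linf \<mu> = {u \<in> borel_measurable \<mu>. \<exists>C. AE x in \<mu>. cmod (u x) \<le> C}"

definition U_Linf_functions :: "'m measure \<Rightarrow> ('m \<Rightarrow> complex) set" where
  "U_Linf_functions \<mu> = {u \<in> Linf \<mu>. AE x in \<mu>. cnj (u x) * u x = 1}"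

text \<open>
  \<open>U(L\<^sup>\<infinity>(M))\<close> as a group of unitary operators on \<open>L\<^sup>2(E)\<close>, and its subgroup
  \<open>U(L\<^sup>\<infinity>(V))\<close> of those \<open>u\<close> that are \<open>1\<close> almost everywhere off \<open>V\<close>.
\<close>

definition U_Linf ::
    "('m::t2_space, 'k::finite) chart set \<Rightarrow> 'm measure \<Rightarrow>
     ('e::topological_space, 'm, 'n::finite) vector_bundle \<Rightarrow> (('m \<Rightarrow> 'e) set \<Rightarrow> ('m \<Rightarrow> 'e) set) set" where
  "U_Linf \<A> \<mu> E = mult_op \<A> \<mu> E ` U_Linf_functions \<mu>"

definition U_Linf_on ::
    "('m::t2_space, 'k::finite) chart set \<Rightarrow> 'm measure \<Rightarrow>
     ('e::topological_space, 'm, 'n::finite) vector_bundle \<Rightarrow> 'm set \<Rightarrow>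
     (('m \<Rightarrow> 'e) set \<Rightarrow> ('m \<Rightarrow> 'e) set) set" where
  "U_Linf_on \<A> \<mu> E V =
     mult_op \<A> \<mu> E ` {u \<in> U_Linf_functions \<mu>. AE x in \<mu>. x \<in> - V \<longrightarrow> u x = 1}"

definition L2_on ::
    "('m::t2_space, 'k::finite) chart set \<Rightarrow> 'm measure \<Rightarrow>
     ('e::topological_space, 'm, 'n::finite) vector_bundle \<Rightarrow> 'm set \<Rightarrow> ('m \<Rightarrow> 'e) set set" where
  "L2_on \<A> \<mu> E W = mult_op \<A> \<mu> E (indicator W) ` vecs (L2 \<A> \<mu> E)"


section \<open>Unital C*-algebras and the CAR algebra\<close>

class unital_cstar_algebra = real_normed_algebra_1 + banach +
  fixes cscale :: "complex \<Rightarrow> 'a \<Rightarrow> 'a"  (infixr "*\<^sub>\<complex>" 75)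
    and star :: "'a \<Rightarrow> 'a"
  assumes cscale_of_real: "complex_of_real r *\<^sub>\<complex> x = r *\<^sub>R x"
    and cscale_add_right: "z *\<^sub>\<complex> (x + y) = z *\<^sub>\<complex> x + z *\<^sub>\<complex> y"
    and cscale_add_left: "(z + w) *\<^sub>\<complex> x = z *\<^sub>\<complex> x + w *\<^sub>\<complex> x"
    and cscale_cscale: "z *\<^sub>\<complex> (w *\<^sub>\<complex> x) = (z * w) *\<^sub>\<complex> x"
    and cscale_mult_left: "(z *\<^sub>\<complex> x) * y = z *\<^sub>\<complex> (x * y)"
    and cscale_mult_right: "x * (z *\<^sub>\<complex> y) = z *\<^sub>\<complex> (x * y)"
    and norm_cscale: "norm (z *\<^sub>\<complex> x) = cmod z * norm x"
    and star_star: "star (star x) = x"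
    and star_add: "star (x + y) = star x + star y"
    and star_cscale: "star (z *\<^sub>\<complex> x) = cnj z *\<^sub>\<complex> star x"
    and star_mult: "star (x * y) = star y * star x"
    and cstar_identity: "norm (star x * x) = (norm x)\<^sup>2"

definition unital_cstar_subalgebra :: "'a::unital_cstar_algebra set \<Rightarrow> bool" where
  "unital_cstar_subalgebra B \<longleftrightarrow>
     closed B \<and> 1 \<in> B \<and>
     (\<forall>x\<in>B. \<forall>y\<in>B. x + y \<in> B \<and> x * y \<in> B) \<and>
     (\<forall>z. \<forall>x\<in>B. z *\<^sub>\<complex> x \<in> B) \<and> (\<forall>x\<in>B. star x \<in> B)"

definition star_automorphism :: "('a::unital_cstar_algebra \<Rightarrow> 'a) \<Rightarrow> bool" where
  "star_automorphism f \<longleftrightarrow>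
     bij f \<and> (\<forall>x y. f (x + y) = f x + f y) \<and> (\<forall>z x. f (z *\<^sub>\<complex> x) = z *\<^sub>\<complex> f x) \<and>
     (\<forall>x y. f (x * y) = f x * f y) \<and> (\<forall>x. f (star x) = star (f x)) \<and> f 1 = 1"

text \<open>
  \<open>CAR(H)\<close> is only determined up to natural isomorphism: \<open>is_CAR H a\<close> says that the C*-algebra
  \<open>'a\<close> together with the map \<open>a\<close> is a realization of it.
\<close>

definition is_CAR :: "'h hilbert_structure \<Rightarrow> ('h \<Rightarrow> 'a::unital_cstar_algebra) \<Rightarrow> bool" where
  "is_CAR H a \<longleftrightarrow>
     (\<forall>f\<in>vecs H. \<forall>g\<in>vecs H. a (vadd H f g) = a f + a g) \<and>
     (\<forall>z. \<forall>f\<in>vecs H. a (vscale H z f) = cnj z *\<^sub>\<complex> a f) \<and>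
     (\<exists>C. \<forall>f\<in>vecs H. norm (a f) \<le> C * sqrt (Re (vinner H f f))) \<and>
     (\<forall>f\<in>vecs H. \<forall>g\<in>vecs H. a f * star (a g) + star (a g) * a f = vinner H f g *\<^sub>\<complex> 1) \<and>
     (\<forall>f\<in>vecs H. \<forall>g\<in>vecs H. a f * a g + a g * a f = 0) \<and>
     unital_cstar_subalgebra hull (a ` vecs H) = UNIV"

text \<open>
  The action by automorphisms of a group \<open>\<U>\<close> of unitary operators on \<open>H\<close>, determined by its
  values on the generators.
\<close>

definition CAR_action ::
    "'h hilbert_structure \<Rightarrow> ('h \<Rightarrow> 'a::unital_cstar_algebra) \<Rightarrow> ('h \<Rightarrow> 'h) set \<Rightarrow>
     (('h \<Rightarrow> 'h) \<Rightarrow> 'a \<Rightarrow> 'a) \<Rightarrow> bool" where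
  "CAR_action H a \<U> \<alpha> \<longleftrightarrow>
     (\<forall>U\<in>\<U>. star_automorphism (\<alpha> U)) \<and>
     (\<forall>U\<in>\<U>. \<forall>V\<in>\<U>. \<alpha> (compose (vecs H) U V) = \<alpha> U \<circ> \<alpha> V) \<and>
     (\<forall>U\<in>\<U>. \<forall>f\<in>vecs H. \<alpha> U (a f) = a (U f))"

definition local_algebra ::
    "('m::t2_space, 'k::finite) chart set \<Rightarrow> 'm measure \<Rightarrow>
     ('e::topological_space, 'm, 'n::finite) vector_bundle \<Rightarrow>
     (('m \<Rightarrow> 'e) set \<Rightarrow> 'a::unital_cstar_algebra) \<Rightarrow> 'm set \<Rightarrow> 'a set" where
  "local_algebra \<A> \<mu> E a W = unital_cstar_subalgebra hull (a ` L2_on \<A> \<mu> E W)"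

end

theory Submission
  imports Defs "HOL-Probability.Probability"
begin

text \<open>
  Let \<open>\<gamma>\<close> be the parity automorphism, the action of the constant function \<open>-1\<close>, and call
  \<open>v = z a(f) + (z a(f))\<^sup>*\<close> a Majorana operator of \<open>f\<close>.  If \<open>f\<^sub>k\<close> is an orthogonal sequence of
  vectors of constant norm with Majorana operators \<open>v\<^sub>k\<close>, then by Bessel's inequality
  \<open>v\<^sub>k \<gamma>(X) - X v\<^sub>k\<close> tends to 0 for every \<open>X\<close> in the CAR algebra.  Since \<open>\<mu>\<close> has no atoms, each
  \<open>f\<close> vanishing on \<open>W\<close> admits unimodular functions \<open>u\<^sub>k\<close>, equal to 1 on \<open>W\<close>, for which the
  \<open>u\<^sub>k f\<close> are orthogonal.  If \<open>A\<close> is a fixed point, \<open>\<alpha>\<close> maps \<open>v \<gamma>(A) - A v\<close> to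
  \<open>v\<^sub>k \<gamma>(A) - A v\<^sub>k\<close> isometrically, so \<open>v \<gamma>(A) = A v\<close>.  Averaging over the reflections
  \<open>X \<mapsto> v \<gamma>(X) v\<close>, which fix \<open>A\<close> and remove Majorana operators of vectors vanishing on \<open>W\<close> from a
  polynomial that approximates \<open>A\<close>, brings that polynomial into \<open>\<A>(W)\<close> without increasing its
  distance to \<open>A\<close>.

  For the unitary \<open>u\<close> to act on \<open>L\<^sup>2(E)\<close>, realized as a closure of smooth sections, one needs that this closure
  is stable under bounded Borel functions: the sets whose indicators preserve it form a
  \<open>\<sigma>\<close>-algebra, which contains the coordinate balls because of smooth bump functions.
\<close>

section \<open>C*-algebras and their automorphisms\<close>

text \<open>The grading lets one relation serve every fixed point: an even element of \<A>(W)
  commutes with the Majorana operators of vectors vanishing on W, an odd one anticommutes with them.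
  The constant -1 is in general outside the subgroup, so a fixed point cannot be assumed to be even.
  Majorana operators are preferred to \<open>a f\<close> because they are self-adjoint with scalar
  square. A reflection built from one therefore preserves the norm, and its average with the
  identity is a contraction. This is decisive, since \<open>A\<close> is known only as a norm limit
  of polynomials. Each polynomial involves finitely many vectors, so finitely many averages suffice
  and no invariant state or conditional expectation has to be constructed. The phases come from the
  probability integral transform: under the normalized weight |f|^2 an atomless function becomes a
  variable \<open>q\<close> uniform on [0,1], and the functions exp(2 \<pi> i k q) are then
  orthogonal for that weight.\<close>

lemma cscale_zero_right [simp]: "z *\<^sub>\<complex> (0::'a::unital_cstar_algebra) = 0"
  using cscale_add_right[of z "0::'a" 0] by simp

lemma cscale_zero_left [simp]: "0 *\<^sub>\<complex> (x::'a::unital_cstar_algebra) = 0"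
  using cscale_add_left[of 0 0 x] by simp

lemma cscale_one [simp]: "1 *\<^sub>\<complex> (x::'a::unital_cstar_algebra) = x"
  using cscale_of_real[of 1 x] by simp

lemma cscale_minus_right [simp]: "z *\<^sub>\<complex> (- x::'a::unital_cstar_algebra) = - (z *\<^sub>\<complex> x)"
  using cscale_add_right[of z x "- x"] by (simp add: eq_neg_iff_add_eq_0 add.commute)

lemma cscale_minus_left [simp]: "(- z) *\<^sub>\<complex> (x::'a::unital_cstar_algebra) = - (z *\<^sub>\<complex> x)"
  using cscale_add_left[of z "- z" x] by (simp add: eq_neg_iff_add_eq_0 add.commute)

lemma cscale_diff_right: "z *\<^sub>\<complex> (x - y::'a::unital_cstar_algebra) = z *\<^sub>\<complex> x - z *\<^sub>\<complex> y"
  using cscale_add_right[of z x "- y"] by simp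

lemma cscale_scaleR: "z *\<^sub>\<complex> (r *\<^sub>R x::'a::unital_cstar_algebra) = r *\<^sub>R (z *\<^sub>\<complex> x)"
  by (simp add: cscale_of_real[symmetric] cscale_cscale mult.commute)

lemma bounded_linear_cscale: "bounded_linear (\<lambda>x::'a::unital_cstar_algebra. z *\<^sub>\<complex> x)"
  by (rule bounded_linear_intro[where K="cmod z"])
     (simp_all add: cscale_add_right cscale_scaleR norm_cscale mult.commute)

lemma star_zero [simp]: "star (0::'a::unital_cstar_algebra) = 0"
  using star_add[of "0::'a" 0] by simp

lemma star_minus [simp]: "star (- x::'a::unital_cstar_algebra) = - star x"
  using star_add[of x "- x"] by (simp add: eq_neg_iff_add_eq_0 add.commute)

lemma star_diff: "star (x - y::'a::unital_cstar_algebra) = star x - star y"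
  using star_add[of x "- y"] by simp

lemma star_one [simp]: "star (1::'a::unital_cstar_algebra) = 1"
  by (metis mult_1 mult.right_neutral star_mult star_star)

lemma star_scaleR: "star (r *\<^sub>R x::'a::unital_cstar_algebra) = r *\<^sub>R star x"
  by (simp add: cscale_of_real[symmetric] star_cscale)

lemma norm_star [simp]: "norm (star x) = norm (x::'a::unital_cstar_algebra)"
proof -
  have le: "norm y \<le> norm (star y)" for y :: 'a
  proof (cases "y = 0")
    case False
    have "norm y * norm y \<le> norm (star y) * norm y"
      using norm_mult_ineq[of "star y" y] cstar_identity[of y] by (simp add: power2_eq_square)
    then show ?thesis using False by simp
  qed simp
  show ?thesis using le[of x] le[of "star x"] by (simp add: star_star)
qed

lemma bounded_linear_star: "bounded_linear (star :: 'a::unital_cstar_algebra \<Rightarrow> 'a)"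
  by (rule bounded_linear_intro[where K=1]) (simp_all add: star_add star_scaleR)

section \<open>Square roots from the binomial series\<close>

text \<open>Consecutive coefficients have ratio \<open>(1/2 - n) / (n + 1)\<close>, of absolute
  value at most 1. The binomial series is thus dominated by a geometric one.\<close>

lemma abs_gbinomial_half_le_1: "\<bar>(1/2::real) gchoose n\<bar> \<le> 1"
proof (induction n)
  case (Suc n)
  have eq: "(1/2::real) gchoose Suc n = ((1/2) gchoose n) * ((1/2 - real n) / real (Suc n))"
    by (simp add: gbinomial_Suc_rec gbinomial_prod_rev)
  have "\<bar>(1/2 - real n) / real (Suc n)\<bar> \<le> 1" by (simp add: abs_if field_simps)
  then show ?case using Suc unfolding eq abs_mult by (intro mult_le_one) auto
qed simp

text \<open>The root is the binomial series for \<open>(1 - y)\<close> to the power \<open>1/2\<close>.\<close>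

lemma exists_sqrt_one_minus:
  fixes y :: "'a::unital_cstar_algebra"
  assumes y: "norm y < 1" "star y = y"
  obtains k where "k * k = 1 - y" "star k = k" "\<And>h. h * y = y * h \<Longrightarrow> h * k = k * h"
proof -
  define b where "b n = (-1)^n * ((1/2::real) gchoose n)" for n
  define f where "f n = b n *\<^sub>R y ^ n" for n
  have b1: "\<bar>b n\<bar> \<le> 1" for n
    using abs_gbinomial_half_le_1[of n] by (simp add: b_def abs_mult power_abs)
  have sn: "summable (\<lambda>n. norm (f n))"
  proof (rule summable_comparison_test')
    show "summable (\<lambda>n. norm y ^ n)" using y by (intro summable_geometric) auto
    show "norm (norm (f n)) \<le> norm y ^ n" if "n \<ge> 0" for n
    proof -
      have "\<bar>b n\<bar> * norm (y ^ n) \<le> 1 * norm y ^ n"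
        using b1 by (intro mult_mono norm_power_ineq) auto
      then show ?thesis by (simp add: f_def)
    qed
  qed
  have s: "summable f" using sn by (rule summable_norm_cancel)
  define k where "k = suminf f"
  \<comment> \<open>By Vandermonde's identity the Cauchy square has the coefficients of exponent 1/2
    + 1/2 = 1. These vanish beyond n = 1, which leaves \<open>1 - y\<close>.\<close>
  have conv: "(\<Sum>i\<le>n. f i * f (n - i)) = ((-1)^n * ((1::real) gchoose n)) *\<^sub>R y ^ n" for n
  proof -
    have "(\<Sum>i\<le>n. f i * f (n - i)) = (\<Sum>i\<le>n. (b i * b (n - i)) *\<^sub>R y ^ n)"
      by (intro sum.cong refl) (simp add: f_def power_add[symmetric])
    also have "\<dots> = (\<Sum>i\<le>n. b i * b (n - i)) *\<^sub>R y ^ n" by (simp add: scaleR_sum_left)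
    also have "(\<Sum>i\<le>n. b i * b (n - i))
        = (\<Sum>i\<le>n. (-1)^n * (((1/2) gchoose i) * ((1/2) gchoose (n - i))))"
    proof (intro sum.cong refl)
      fix i assume "i \<in> {..n}"
      then have "(-1::real) ^ n = (-1) ^ i * (-1) ^ (n - i)" by (simp add: power_add[symmetric])
      then show "b i * b (n - i) = (-1)^n * (((1/2) gchoose i) * ((1/2) gchoose (n - i)))"
        by (simp add: b_def)
    qed
    also have "\<dots> = (-1)^n * ((1/2 + 1/2) gchoose n)"
      using gbinomial_Vandermonde[of "1/2::real" "1/2" n]
      by (simp add: sum_distrib_left[symmetric] atMost_atLeast0)
    finally show ?thesis by simp
  qed
  have "k * k = (\<Sum>n. ((-1)^n * ((1::real) gchoose n)) *\<^sub>R y ^ n)"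
    unfolding k_def using Cauchy_product[OF sn sn] by (simp add: conv)
  also have "\<dots> = (\<Sum>n\<in>{0,1}. ((-1)^n * ((1::real) gchoose n)) *\<^sub>R y ^ n)"
  proof (rule suminf_finite)
    fix n :: nat assume "n \<notin> {0,1}"
    then have "1 < n" by auto
    then have "(1::real) gchoose n = 0"
      by (metis binomial_eq_0 binomial_gbinomial of_nat_0 of_nat_1)
    then show "((-1)^n * ((1::real) gchoose n)) *\<^sub>R y ^ n = 0" by simp
  qed simp
  also have "\<dots> = 1 - y" by simp
  finally have kk: "k * k = 1 - y" .
  have sp: "star (y ^ n) = y ^ n" for n
    by (induction n) (simp_all add: star_mult y power_commutes)
  have "star k = (\<Sum>n. star (f n))"
    unfolding k_def using bounded_linear.suminf[OF bounded_linear_star s] by simp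
  moreover have "star (f n) = f n" for n by (simp add: f_def star_scaleR sp)
  ultimately have sk: "star k = k" by (simp add: k_def)
  have cm: "h * k = k * h" if h: "h * y = y * h" for h
  proof -
    have hp: "h * y ^ n = y ^ n * h" for n
    proof (induction n)
      case (Suc n)
      have "h * y ^ Suc n = y * (h * y ^ n)" by (simp add: mult.assoc[symmetric] h)
      also have "\<dots> = y ^ Suc n * h" by (simp add: Suc mult.assoc)
      finally show ?case .
    qed simp
    have hf: "h * f n = f n * h" for n by (simp only: f_def mult_scaleR_left mult_scaleR_right hp)
    have "h * k = (\<Sum>n. h * f n)" unfolding k_def by (rule suminf_mult[OF s, symmetric])
    also have "\<dots> = (\<Sum>n. f n * h)" by (simp only: hf)
    also have "\<dots> = k * h" unfolding k_def by (rule suminf_mult2[OF s, symmetric])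
    finally show ?thesis .
  qed
  show thesis using that kk sk cm by blast
qed

section \<open>Automorphisms are isometric\<close>

lemma star_automorphismD:
  assumes "star_automorphism (f :: 'a::unital_cstar_algebra \<Rightarrow> 'a)"
  shows "bij f" "f (x + y) = f x + f y" "f (z *\<^sub>\<complex> x) = z *\<^sub>\<complex> f x" "f (x * y) = f x * f y"
    "f (star x) = star (f x)" "f 1 = 1" "f (r *\<^sub>R x) = r *\<^sub>R f x" "f 0 = 0" "f (- x) = - f x"
    "f (x - y) = f x - f y"
proof -
  have *: "bij f" "\<And>x y. f (x + y) = f x + f y" "\<And>z x. f (z *\<^sub>\<complex> x) = z *\<^sub>\<complex> f x"
    "\<And>x y. f (x * y) = f x * f y" "\<And>x. f (star x) = star (f x)" "f 1 = 1"
    using assms by (simp_all add: star_automorphism_def)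
  have sR: "\<And>r x. f (r *\<^sub>R x) = r *\<^sub>R f x"
    using *(3)[of "complex_of_real _"] by (simp add: cscale_of_real)
  have z: "f 0 = 0" using sR[of 0 0] by simp
  have m: "\<And>x. f (- x) = - f x" using sR[of "-1"] by simp
  have "f (x - y) = f x - f y" using *(2)[of x "- y"] m by simp
  then show "bij f" "f (x + y) = f x + f y" "f (z *\<^sub>\<complex> x) = z *\<^sub>\<complex> f x" "f (x * y) = f x * f y"
    "f (star x) = star (f x)" "f 1 = 1" "f (r *\<^sub>R x) = r *\<^sub>R f x" "f 0 = 0" "f (- x) = - f x"
    "f (x - y) = f x - f y"
    by (simp_all only: * sR z m)
qed

text \<open>
  A self-adjoint \<open>h\<close> of norm less than 1 is the real part of the unitary \<open>h + i (1 - h\<^sup>2)\<^sup>1\<^sup>/\<^sup>2\<close>, and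
  unitaries are mapped to unitaries; so contractivity needs no spectral theory.
\<close>

lemma star_automorphism_contraction:
  assumes f: "star_automorphism (f :: 'a::unital_cstar_algebra \<Rightarrow> 'a)"
  shows "norm (f x) \<le> norm x"
proof -
  note F = star_automorphismD[OF f]
  have lt1: "norm (f h) \<le> 1" if h: "star h = h" "norm h < 1" for h
  proof -
    have "norm (h * h) \<le> norm h * norm h" by (rule norm_mult_ineq)
    also have "\<dots> < 1" using h(2) abs_square_less_1[of "norm h"] by (simp add: power2_eq_square)
    finally have "norm (h * h) < 1" .
    then obtain k where k: "k * k = 1 - h * h" "star k = k" "h * k = k * h"
      using exists_sqrt_one_minus[of "h * h"] h by (metis mult.assoc star_mult)
    define v where "v = h + \<i> *\<^sub>\<complex> k"
    have sv: "star v = h - \<i> *\<^sub>\<complex> k" by (simp add: v_def star_add star_cscale k h)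
    have "star v * v = h * h + k * k"
      unfolding sv unfolding v_def
      by (simp add: algebra_simps cscale_mult_left cscale_mult_right cscale_cscale k(3)
          cscale_add_right cscale_diff_right)
    then have "star v * v = 1" by (simp add: k)
    then have "star (f v) * f v = 1" by (metis F(4,5,6))
    then have nv: "norm (f v) = 1"
      using cstar_identity[of "f v"] by (metis norm_ge_zero norm_one power2_eq_1_iff not_one_le_zero le_minus_one_simps(1) le_minus_one_simps(3))
    have "h = (1/2) *\<^sub>R (v + star v)" unfolding sv unfolding v_def by (simp add: scaleR_2[symmetric])
    then have "f h = (1/2) *\<^sub>R (f v + star (f v))" by (metis F(2,5,7))
    then show ?thesis using norm_triangle_ineq[of "f v" "star (f v)"] nv by simp
  qed
  have sa: "norm (f h) \<le> norm h" if h: "star h = h" for h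
  proof (rule field_le_epsilon)
    fix e :: real assume e: "e > 0"
    \<comment> \<open>Dividing by a number slightly larger than \<open>norm h\<close> reaches the
      open unit ball, where the root exists.\<close>
    define t where "t = norm h + e"
    have t: "t > 0" "norm h < t" using e norm_ge_zero[of h] by (auto simp: t_def simp del: norm_ge_zero)
    have "norm (f ((1/t) *\<^sub>R h)) \<le> 1"
      using t by (intro lt1) (simp_all add: star_scaleR h)
    then have "norm (f h) \<le> t" using t by (simp add: F(7) field_simps)
    then show "norm (f h) \<le> norm h + e" by (simp add: t_def)
  qed
  have "(norm (f x))\<^sup>2 = norm (f (star x * x))" by (simp add: F(4,5) cstar_identity)
  also have "\<dots> \<le> norm (star x * x)" by (rule sa) (simp add: star_mult star_star)
  also have "\<dots> = (norm x)\<^sup>2" by (rule cstar_identity)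
  finally show ?thesis by (rule power2_le_imp_le) simp
qed

lemma star_automorphism_inv:
  assumes f: "star_automorphism (f :: 'a::unital_cstar_algebra \<Rightarrow> 'a)"
  shows "star_automorphism (inv f)"
proof -
  note F = star_automorphismD[OF f]
  have i: "f (inv f x) = x" for x using F(1) by (simp add: bij_is_surj surj_f_inv_f)
  have eqI: "inv f x = y" if "f y = x" for x y using F(1) that by (metis bij_is_inj inv_f_f)
  show ?thesis unfolding star_automorphism_def
    by (intro conjI allI bij_imp_bij_inv F(1); rule eqI; simp add: F i)
qed

lemma star_automorphism_isometry:
  assumes f: "star_automorphism (f :: 'a::unital_cstar_algebra \<Rightarrow> 'a)"
  shows "norm (f x) = norm x"
proof (rule antisym)
  show "norm (f x) \<le> norm x" by (rule star_automorphism_contraction[OF f])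
  have "norm (inv f (f x)) \<le> norm (f x)"
    by (rule star_automorphism_contraction[OF star_automorphism_inv[OF f]])
  then show "norm x \<le> norm (f x)" using star_automorphismD(1)[OF f] by (simp add: bij_is_inj)
qed

lemma star_automorphism_bounded_linear:
  assumes f: "star_automorphism (f :: 'a::unital_cstar_algebra \<Rightarrow> 'a)"
  shows "bounded_linear f"
  by (rule bounded_linear_intro[where K=1])
     (simp_all add: star_automorphismD[OF f] star_automorphism_isometry[OF f])

section \<open>Closed subalgebras and generators\<close>

text \<open>Makes automorphisms that agree on generators equal. Closedness rests on their
  continuity, which comes from the isometry property.\<close>

lemma unital_cstar_subalgebra_equalizer:
  assumes f: "star_automorphism (f :: 'a::unital_cstar_algebra \<Rightarrow> 'a)" and g: "star_automorphism g"
  shows "unital_cstar_subalgebra {x. f x = g x}"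
proof -
  have "closed {x. f x = g x}"
    by (intro closed_Collect_eq linear_continuous_on star_automorphism_bounded_linear f g)
  then show ?thesis
    by (auto simp: unital_cstar_subalgebra_def star_automorphismD[OF f] star_automorphismD[OF g])
qed

lemma star_automorphism_comp:
  "star_automorphism f \<Longrightarrow> star_automorphism g \<Longrightarrow> star_automorphism (f \<circ> g)"
  by (auto simp: star_automorphism_def bij_comp)

lemma star_automorphism_id: "star_automorphism id"
  by (auto simp: star_automorphism_def)

lemma unital_cstar_subalgebra_Inter:
  "(\<And>B. B \<in> \<B> \<Longrightarrow> unital_cstar_subalgebra B) \<Longrightarrow> unital_cstar_subalgebra (\<Inter>\<B>)"
  unfolding unital_cstar_subalgebra_def by (auto intro: closed_Inter)

lemma unital_cstar_subalgebra_hull: "unital_cstar_subalgebra (unital_cstar_subalgebra hull S)"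
  by (rule hull_in) (auto intro: unital_cstar_subalgebra_Inter)

section \<open>Clifford relations\<close>

text \<open>Neither closed nor star-invariant, so that polynomials in finitely many operators can be
  handled by algebra alone; star and closure are restored afterwards.\<close>

definition complex_subalgebra :: "'a::unital_cstar_algebra set \<Rightarrow> bool" where
  "complex_subalgebra S \<longleftrightarrow> 1 \<in> S \<and> (\<forall>x\<in>S. \<forall>y\<in>S. x + y \<in> S \<and> x * y \<in> S) \<and>
     (\<forall>z. \<forall>x\<in>S. z *\<^sub>\<complex> x \<in> S)"

lemma complex_subalgebraD:
  assumes "complex_subalgebra S"
  shows "1 \<in> S" "x \<in> S \<Longrightarrow> y \<in> S \<Longrightarrow> x + y \<in> S" "x \<in> S \<Longrightarrow> y \<in> S \<Longrightarrow> x * y \<in> S"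
    "x \<in> S \<Longrightarrow> z *\<^sub>\<complex> x \<in> S" "x \<in> S \<Longrightarrow> r *\<^sub>R x \<in> S" "0 \<in> S" "subspace S"
proof -
  show *: "1 \<in> S" "x \<in> S \<Longrightarrow> y \<in> S \<Longrightarrow> x + y \<in> S" "x \<in> S \<Longrightarrow> y \<in> S \<Longrightarrow> x * y \<in> S"
    "x \<in> S \<Longrightarrow> z *\<^sub>\<complex> x \<in> S" for x y z
    using assms by (auto simp: complex_subalgebra_def)
  show r: "x \<in> S \<Longrightarrow> r *\<^sub>R x \<in> S" for r x using *(4)[of x "of_real r"] by (simp add: cscale_of_real)
  show z: "0 \<in> S" using r[OF *(1), of 0] by simp
  show "subspace S" unfolding subspace_def using z r *(2) by auto
qed

text \<open>Reduces density to algebra: a star-invariant algebra of polynomials that contains the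
  generators has the whole C*-algebra as its closure.\<close>

lemma unital_cstar_subalgebra_closure:
  assumes S: "complex_subalgebra S" and st: "\<And>x. x \<in> S \<Longrightarrow> star x \<in> S"
  shows "unital_cstar_subalgebra (closure S)"
proof -
  note C = complex_subalgebraD[OF S]
  have bin: "x + y \<in> closure S \<and> x * y \<in> closure S" if xy: "x \<in> closure S" "y \<in> closure S" for x y
  proof -
    from xy obtain f g where f: "\<And>n. f n \<in> S" "f \<longlonglongrightarrow> x" and g: "\<And>n. g n \<in> S" "g \<longlonglongrightarrow> y"
      unfolding closure_sequential by blast
    have "(\<lambda>n. f n + g n) \<longlonglongrightarrow> x + y" "(\<lambda>n. f n * g n) \<longlonglongrightarrow> x * y"
      using f g by (auto intro!: tendsto_intros)
    moreover have "\<forall>n. f n + g n \<in> S" "\<forall>n. f n * g n \<in> S" using f g C by auto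
    ultimately show ?thesis unfolding closure_sequential
      by (intro conjI exI[of _ "\<lambda>n. f n + g n"] exI[of _ "\<lambda>n. f n * g n"])
  qed
  have lin: "h x \<in> closure S" if x: "x \<in> closure S" and h: "bounded_linear h" "\<And>x. x \<in> S \<Longrightarrow> h x \<in> S" for h x
  proof -
    from x obtain f where f: "\<And>n. f n \<in> S" "f \<longlonglongrightarrow> x"
      unfolding closure_sequential by blast
    have "(\<lambda>n. h (f n)) \<longlonglongrightarrow> h x" by (rule bounded_linear.tendsto[OF h(1) f(2)])
    then show ?thesis unfolding closure_sequential using f h(2) by (intro exI[of _ "\<lambda>n. h (f n)"]) auto
  qed
  show ?thesis unfolding unital_cstar_subalgebra_def
    using bin lin[OF _ bounded_linear_star st] lin[OF _ bounded_linear_cscale C(4)]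
      closure_subset[of S] C(1) by blast
qed

lemma scaleR_one_eq_iff: "r *\<^sub>R (1::'a::real_normed_algebra_1) = s *\<^sub>R 1 \<longleftrightarrow> r = s"
  by simp

text \<open>
  Real linear spaces spanned by Majorana operators: \<open>v w + w v\<close> is twice the real inner product.
\<close>

definition clifford_space :: "'a::unital_cstar_algebra set \<Rightarrow> bool" where
  "clifford_space V \<longleftrightarrow> subspace V \<and> (\<forall>v\<in>V. star v = v) \<and>
     (\<forall>v\<in>V. \<forall>w\<in>V. \<exists>r. v * w + w * v = r *\<^sub>R 1)"

text \<open>Both relations are real linear in each argument, so they extend one argument at a time.
  Complex multiples would destroy self-adjointness, hence the real span.\<close>

lemma clifford_space_span:
  assumes "\<And>v. v \<in> V \<Longrightarrow> star v = v"
    and "\<And>v w. v \<in> V \<Longrightarrow> w \<in> V \<Longrightarrow> \<exists>r. v * w + w * v = r *\<^sub>R (1::'a::unital_cstar_algebra)"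
  shows "clifford_space (span V)"
proof -
  have st: "star v = v" if "v \<in> span V" for v
    using that by (induction rule: span_induct_alt) (auto simp: star_add star_scaleR assms)
  have 1: "\<exists>r. v * w + w * v = r *\<^sub>R (1::'a)" if v: "v \<in> span V" and w: "w \<in> V" for v w
    using v
  proof (induction rule: span_induct_alt)
    case base
    show ?case by (rule exI[of _ 0]) simp
  next
    case (step c x y)
    obtain r where r: "y * w + w * y = r *\<^sub>R 1" using step by blast
    obtain s where s: "x * w + w * x = s *\<^sub>R 1" using assms(2)[OF step(1) w] by blast
    have "(c *\<^sub>R x + y) * w + w * (c *\<^sub>R x + y) = c *\<^sub>R (x * w + w * x) + (y * w + w * y)"
      by (simp add: algebra_simps)
    also have "\<dots> = (c * s + r) *\<^sub>R 1" by (simp only: r s scaleR_add_left scaleR_scaleR)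
    finally show ?case by blast
  qed
  have 2: "\<exists>r. v * w + w * v = r *\<^sub>R (1::'a)" if v: "v \<in> span V" and w: "w \<in> span V" for v w
    using w
  proof (induction rule: span_induct_alt)
    case base
    show ?case by (rule exI[of _ 0]) simp
  next
    case (step c x y)
    obtain r where r: "v * y + y * v = r *\<^sub>R 1" using step by blast
    obtain s where s: "v * x + x * v = s *\<^sub>R 1" using 1[OF v step(1)] by blast
    have "v * (c *\<^sub>R x + y) + (c *\<^sub>R x + y) * v = c *\<^sub>R (v * x + x * v) + (v * y + y * v)"
      by (simp add: algebra_simps)
    also have "\<dots> = (c * s + r) *\<^sub>R 1" by (simp only: r s scaleR_add_left scaleR_scaleR)
    finally show ?case by blast
  qed
  show ?thesis unfolding clifford_space_def using st 2 by (auto simp: subspace_span)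
qed

text \<open>If \<open>v\<^sup>2 = - s\<^sup>2\<close> then \<open>1 + i v / s\<close> has norm 0, so \<open>v / s = i\<close> is not self-adjoint.\<close>

lemma selfadjoint_square_scalar:
  fixes v :: "'a::unital_cstar_algebra"
  assumes v: "star v = v" "v * v = r *\<^sub>R 1"
  shows "r = (norm v)\<^sup>2"
proof -
  have "r \<ge> 0"
  proof (rule ccontr)
    assume "\<not> r \<ge> 0"
    then have r: "r < 0" by simp
    define s where "s = sqrt (- r)"
    have s: "s > 0" "s * s = - r" using r by (simp_all add: s_def)
    define w where "w = (1/s) *\<^sub>R v"
    have sw: "star w = w" by (simp add: w_def star_scaleR v)
    have "w * w = (1/s * (1/s)) *\<^sub>R (v * v)" by (simp add: w_def)
    also have "\<dots> = - 1" using r s by (simp add: v)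
    finally have ww: "w * w = - 1" .
    have "star (1 + \<i> *\<^sub>\<complex> w) * (1 + \<i> *\<^sub>\<complex> w) = 0"
      by (simp add: star_add star_cscale sw algebra_simps cscale_mult_left cscale_mult_right
          cscale_cscale cscale_add_right ww)
    then have "1 + \<i> *\<^sub>\<complex> w = 0" using cstar_identity[of "1 + \<i> *\<^sub>\<complex> w"] by simp
    then have w: "\<i> *\<^sub>\<complex> w = - 1" by (simp add: eq_neg_iff_add_eq_0 add.commute)
    then have "star (\<i> *\<^sub>\<complex> w) = - 1" by simp
    then have "- (\<i> *\<^sub>\<complex> w) = - 1" by (simp add: star_cscale sw)
    then have "(1::'a) = - 1" using w by simp
    then have "(1::'a) + 1 = 0" by (simp add: eq_neg_iff_add_eq_0)
    then have "(2::real) *\<^sub>R (1::'a) = 0" by (simp add: scaleR_2)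
    then show False by simp
  qed
  moreover have "(norm v)\<^sup>2 = \<bar>r\<bar>" using cstar_identity[of v] by (simp add: v)
  ultimately show ?thesis by simp
qed

text \<open>On a Clifford space the C*-norm is the Euclidean norm of the quadratic form, so norm
  bounds can be read off from squares.\<close>

lemma clifford_square:
  assumes "clifford_space V" "v \<in> V"
  shows "v * v = (norm v)\<^sup>2 *\<^sub>R 1"
proof -
  have st: "star v = v" using assms by (simp add: clifford_space_def)
  obtain r where "v * v + v * v = r *\<^sub>R 1" using assms unfolding clifford_space_def by blast
  then have "(1/2) *\<^sub>R (v * v + v * v) = (r/2) *\<^sub>R 1" by simp
  then have "v * v = (r/2) *\<^sub>R 1" by (simp add: scaleR_2[symmetric])
  then show ?thesis using selfadjoint_square_scalar[OF st] by metis
qed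

section \<open>Bessel's inequality and asymptotic commutation\<close>

text \<open>Subtracting from \<open>x\<close> its projections onto \<open>w 0\<close>, ...,
  \<open>w (n-1)\<close> leaves an element of \<open>V\<close>, whose square is a nonnegative
  scalar. This bounds the sum of the squared coefficients, so the coefficients tend to 0.\<close>

lemma clifford_orthogonal_tendsto_0:
  fixes w :: "nat \<Rightarrow> 'a::unital_cstar_algebra"
  assumes V: "clifford_space V" and x: "x \<in> V" and w: "\<And>k. w k \<in> V"
    and orth: "\<And>j k. j \<noteq> k \<Longrightarrow> w j * w k + w k * w j = 0"
    and nw: "\<And>k. norm (w k) = R"
  shows "(\<lambda>k. w k * x + x * w k) \<longlonglongrightarrow> 0"
proof (cases "R = 0")
  case True
  then have "w k = 0" for k using nw[of k] by simp
  then show ?thesis by simp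
next
  case False
  have "\<forall>k. \<exists>r. w k * x + x * w k = r *\<^sub>R 1"
    using V x w unfolding clifford_space_def by blast
  then obtain b where b: "\<And>k. w k * x + x * w k = b k *\<^sub>R 1" by metis
  have ww: "w k * w k = R\<^sup>2 *\<^sub>R 1" for k using clifford_square[OF V w] nw by metis
  \<comment> \<open>The anticommutator \<open>b k\<close> is twice the inner product and
    \<open>w k\<close> has squared length \<open>R\<^sup>2\<close>, so this is the coefficient of
    the orthogonal projection.\<close>
  define c where "c k = b k / (2 * R\<^sup>2)" for k
  define y where "y n = x - (\<Sum>k<n. c k *\<^sub>R w k)" for n
  have sub: "subspace V" using V by (simp add: clifford_space_def)
  have yV: "y n \<in> V" for n
    unfolding y_def using sub x w by (intro subspace_diff subspace_sum subspace_scale)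
  have yw: "y n * w m + w m * y n = b m *\<^sub>R 1" if "m \<ge> n" for n m
    using that
  proof (induction n)
    case 0
    then show ?case using b[of m] by (simp add: y_def add.commute)
  next
    case (Suc n)
    have "y (Suc n) * w m + w m * y (Suc n) = (y n * w m + w m * y n) - c n *\<^sub>R (w n * w m + w m * w n)"
      by (simp add: y_def algebra_simps)
    then show ?case using Suc orth[of n m] by simp
  qed
  have yy: "y n * y n = ((norm x)\<^sup>2 - (\<Sum>k<n. (b k)\<^sup>2 / (4 * R\<^sup>2))) *\<^sub>R 1" for n
  proof (induction n)
    case 0
    then show ?case using clifford_square[OF V x] by (simp add: y_def)
  next
    case (Suc n)
    have "y (Suc n) * y (Suc n)
        = y n * y n - c n *\<^sub>R (y n * w n + w n * y n) + (c n * c n) *\<^sub>R (w n * w n)"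
      by (simp add: y_def algebra_simps)
    also have "\<dots> = ((norm x)\<^sup>2 - (\<Sum>k<n. (b k)\<^sup>2 / (4 * R\<^sup>2)) - c n * b n + c n * c n * R\<^sup>2) *\<^sub>R 1"
      by (simp only: yw[OF order.refl] Suc ww scaleR_scaleR scaleR_diff_left scaleR_add_left)
    also have "(norm x)\<^sup>2 - (\<Sum>k<n. (b k)\<^sup>2 / (4 * R\<^sup>2)) - c n * b n + c n * c n * R\<^sup>2
       = (norm x)\<^sup>2 - (\<Sum>k<Suc n. (b k)\<^sup>2 / (4 * R\<^sup>2))"
      using False by (simp add: c_def field_simps power2_eq_square)
    finally show ?case .
  qed
  have "(\<Sum>k<n. (b k)\<^sup>2 / (4 * R\<^sup>2)) \<le> (norm x)\<^sup>2" for n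
  proof -
    have "((norm x)\<^sup>2 - (\<Sum>k<n. (b k)\<^sup>2 / (4 * R\<^sup>2))) *\<^sub>R (1::'a) = (norm (y n))\<^sup>2 *\<^sub>R 1"
      using yy clifford_square[OF V yV] by metis
    then have "(norm x)\<^sup>2 - (\<Sum>k<n. (b k)\<^sup>2 / (4 * R\<^sup>2)) = (norm (y n))\<^sup>2"
      by (simp only: scaleR_one_eq_iff)
    then show ?thesis using zero_le_power2[of "norm (y n)"] by linarith
  qed
  then have "summable (\<lambda>k. (b k)\<^sup>2 / (4 * R\<^sup>2))"
    by (intro bounded_imp_summable[where B="(norm x)\<^sup>2"]) (simp_all only: lessThan_Suc_atMost[symmetric], simp_all)
  then have "(\<lambda>k. (b k)\<^sup>2 / (4 * R\<^sup>2)) \<longlonglongrightarrow> 0" by (rule summable_LIMSEQ_zero)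
  then have "(\<lambda>k. 4 * R\<^sup>2 * ((b k)\<^sup>2 / (4 * R\<^sup>2))) \<longlonglongrightarrow> 4 * R\<^sup>2 * 0" by (intro tendsto_intros)
  then have "(\<lambda>k. (b k)\<^sup>2) \<longlonglongrightarrow> 0" using False by simp
  then have "(\<lambda>k. sqrt ((b k)\<^sup>2)) \<longlonglongrightarrow> sqrt 0" by (intro tendsto_intros)
  then have "(\<lambda>k. \<bar>b k\<bar>) \<longlonglongrightarrow> 0" by simp
  then have "b \<longlonglongrightarrow> 0" by (rule tendsto_rabs_zero_cancel)
  then have "(\<lambda>k. b k *\<^sub>R (1::'a)) \<longlonglongrightarrow> 0 *\<^sub>R 1" by (intro tendsto_intros)
  then show ?thesis by (simp add: b)
qed

text \<open>
  An orthogonal sequence \<open>w\<close> tends weakly to 0, so it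
  anticommutes in the limit with every Majorana operator.
\<close>

lemma asymptotic_graded_commute:
  fixes w :: "nat \<Rightarrow> 'a::unital_cstar_algebra"
  assumes V: "clifford_space V" and w: "\<And>k. w k \<in> V"
    and orth: "\<And>j k. j \<noteq> k \<Longrightarrow> w j * w k + w k * w j = 0"
    and nw: "\<And>k. norm (w k) = R"
    and g: "star_automorphism \<gamma>" and gV: "\<And>v. v \<in> V \<Longrightarrow> \<gamma> v = - v"
    and gen: "\<And>D. unital_cstar_subalgebra D \<Longrightarrow> V \<subseteq> D \<Longrightarrow> D = UNIV"
  shows "(\<lambda>k. w k * \<gamma> x - x * w k) \<longlonglongrightarrow> 0"
proof -
  note G = star_automorphismD[OF g]
  \<comment> \<open>The adjoint of either relation is the other one for \<open>star x\<close>;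
    carrying both makes \<open>D\<close> star-invariant.\<close>
  define D where "D = {x. (\<lambda>k. w k * \<gamma> x - x * w k) \<longlonglongrightarrow> 0 \<and> (\<lambda>k. \<gamma> x * w k - w k * x) \<longlonglongrightarrow> 0}"
  have sw: "star (w k) = w k" for k using V w by (simp add: clifford_space_def)
  have bil: "(\<lambda>k. y * f k * z) \<longlonglongrightarrow> 0" if "f \<longlonglongrightarrow> 0" for f and y z :: 'a
    using tendsto_mult[OF tendsto_mult[OF tendsto_const that, of y] tendsto_const[of z]] by simp
  have mult: "x * y \<in> D" if xy: "x \<in> D" "y \<in> D" for x y
  proof -
    \<comment> \<open>A graded Leibniz rule: the defect of \<open>x * y\<close> is the defect of
      \<open>x\<close> times \<open>\<gamma> y\<close> plus \<open>x\<close> times the defect of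
      \<open>y\<close>. The factors 1 only give both summands the shape of
      \<open>bil\<close>.\<close>
    have "(\<lambda>k. 1 * (w k * \<gamma> x - x * w k) * \<gamma> y + x * (w k * \<gamma> y - y * w k) * 1) \<longlonglongrightarrow> 0 + 0"
      using xy by (intro tendsto_add bil) (auto simp: D_def)
    moreover have "(\<lambda>k. \<gamma> x * (\<gamma> y * w k - w k * y) * 1 + 1 * (\<gamma> x * w k - w k * x) * y) \<longlonglongrightarrow> 0 + 0"
      using xy by (intro tendsto_add bil) (auto simp: D_def)
    ultimately show ?thesis unfolding D_def by (simp add: algebra_simps G)
  qed
  have add: "x + y \<in> D" if xy: "x \<in> D" "y \<in> D" for x y
  proof -
    have "(\<lambda>k. (w k * \<gamma> x - x * w k) + (w k * \<gamma> y - y * w k)) \<longlonglongrightarrow> 0 + 0"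
      using xy by (intro tendsto_add) (auto simp: D_def)
    moreover have "(\<lambda>k. (\<gamma> x * w k - w k * x) + (\<gamma> y * w k - w k * y)) \<longlonglongrightarrow> 0 + 0"
      using xy by (intro tendsto_add) (auto simp: D_def)
    ultimately show ?thesis unfolding D_def by (simp add: algebra_simps G)
  qed
  have csc: "z *\<^sub>\<complex> x \<in> D" if x: "x \<in> D" for x z
  proof -
    note T = bounded_linear.tendsto[OF bounded_linear_cscale[of z]]
    have "(\<lambda>k. z *\<^sub>\<complex> (w k * \<gamma> x - x * w k)) \<longlonglongrightarrow> z *\<^sub>\<complex> 0"
      using x by (intro T) (auto simp: D_def)
    moreover have "(\<lambda>k. z *\<^sub>\<complex> (\<gamma> x * w k - w k * x)) \<longlonglongrightarrow> z *\<^sub>\<complex> 0"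
      using x by (intro T) (auto simp: D_def)
    ultimately show ?thesis unfolding D_def
      by (simp add: cscale_diff_right cscale_mult_left cscale_mult_right G)
  qed
  have st: "star x \<in> D" if x: "x \<in> D" for x
  proof -
    note T = bounded_linear.tendsto[OF bounded_linear_star]
    have "(\<lambda>k. star (w k * \<gamma> x - x * w k)) \<longlonglongrightarrow> star 0"
      using x by (intro T) (auto simp: D_def)
    moreover have "(\<lambda>k. star (\<gamma> x * w k - w k * x)) \<longlonglongrightarrow> star 0"
      using x by (intro T) (auto simp: D_def)
    ultimately show ?thesis unfolding D_def
      by (simp add: star_diff star_mult sw G)
  qed
  have one: "1 \<in> D" by (simp add: D_def G)
  have VD: "V \<subseteq> D"
  proof
    fix x assume x: "x \<in> V"
    have "(\<lambda>k. w k * x + x * w k) \<longlonglongrightarrow> 0"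
      by (rule clifford_orthogonal_tendsto_0[OF V x w orth nw])
    then have "(\<lambda>k. - (w k * x + x * w k)) \<longlonglongrightarrow> - 0" by (rule tendsto_minus)
    moreover have "(\<lambda>k. w k * \<gamma> x - x * w k) = (\<lambda>k. - (w k * x + x * w k))"
      "(\<lambda>k. \<gamma> x * w k - w k * x) = (\<lambda>k. - (w k * x + x * w k))"
      by (simp_all add: gV[OF x] fun_eq_iff)
    ultimately show "x \<in> D" unfolding D_def by (simp only: mem_Collect_eq minus_zero)
  qed
  have "complex_subalgebra D" unfolding complex_subalgebra_def using one add mult csc by blast
  from unital_cstar_subalgebra_closure[OF this st] have "unital_cstar_subalgebra (closure D)" .
  moreover have "V \<subseteq> closure D" using VD closure_subset by blast
  ultimately have "closure D = UNIV" by (rule gen)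
  then have "x \<in> closure D" by simp
  show ?thesis
  proof (rule LIMSEQ_I)
    fix e :: real assume e: "e > 0"
    \<comment> \<open>Passing from \<open>x\<close> to a nearby \<open>y\<close> in the dense set
      \<open>D\<close> costs two terms of at most \<open>d * R\<close>, each at most
      \<open>e / 4\<close>, because the \<open>w k\<close> have common norm \<open>R\<close>. The
      added 1 covers \<open>R = 0\<close>.\<close>
    define d where "d = e / (4 * (\<bar>R\<bar> + 1))"
    have d: "d > 0" using e by (simp add: d_def)
    obtain y where y: "y \<in> D" "dist y x < d"
      using \<open>x \<in> closure D\<close> d unfolding closure_approachable by blast
    have "(\<lambda>k. w k * \<gamma> y - y * w k) \<longlonglongrightarrow> 0" using y by (simp add: D_def)
    then obtain N where N: "\<And>k. k \<ge> N \<Longrightarrow> norm (w k * \<gamma> y - y * w k) < e / 2"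
      using LIMSEQ_D[of _ 0 "e/2"] e by force
    have "norm (w k * \<gamma> x - x * w k - 0) < e" if k: "k \<ge> N" for k
    proof -
      have "w k * \<gamma> x - x * w k = (w k * \<gamma> y - y * w k) + (w k * \<gamma> (x - y) - (x - y) * w k)"
        by (simp add: algebra_simps G)
      also have "norm \<dots> \<le> norm (w k * \<gamma> y - y * w k) + (norm (w k * \<gamma> (x - y)) + norm ((x - y) * w k))"
        by (intro order_trans[OF norm_triangle_ineq] add_left_mono norm_triangle_ineq4)
      also have "\<dots> \<le> norm (w k * \<gamma> y - y * w k) + (R * norm (x - y) + norm (x - y) * R)"
        using norm_mult_ineq[of "w k" "\<gamma> (x - y)"] norm_mult_ineq[of "x - y" "w k"]
        by (intro add_left_mono add_mono) (simp_all add: nw star_automorphism_isometry[OF g])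
      also have "\<dots> < e / 2 + e / 2"
      proof (rule add_less_le_mono)
        have R: "R \<ge> 0" using nw[of 0] by (metis norm_ge_zero)
        have "norm (x - y) * R \<le> d * R"
          using y R by (intro mult_right_mono) (auto simp: dist_norm norm_minus_commute)
        also have "\<dots> \<le> e / 4" using e R by (simp add: d_def field_simps)
        finally show "R * norm (x - y) + norm (x - y) * R \<le> e / 2" by (simp add: mult.commute)
      qed (use N k in auto)
      finally show ?thesis by simp
    qed
    then show "\<exists>no. \<forall>n\<ge>no. norm (w n * \<gamma> x - x * w n - 0) < e" by blast
  qed
qed

section \<open>Orthogonalization and averaging over reflections\<close>

text \<open>Gram-Schmidt for the form given by the anticommutator. A remainder that is zero is
  dropped, since the reflections later divide by the squared norm.\<close>

lemma clifford_orthogonalize: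
  fixes L :: "'a::unital_cstar_algebra set"
  assumes V: "clifford_space V" and L: "finite L" "L \<subseteq> V"
  obtains N where "finite N" "N \<subseteq> V" "0 \<notin> N" "L \<subseteq> span N"
    "pairwise (\<lambda>n m. n * m + m * n = 0) N"
proof -
  have "\<exists>N. finite N \<and> N \<subseteq> V \<and> 0 \<notin> N \<and> L \<subseteq> span N \<and>
      pairwise (\<lambda>n m. n * m + m * n = 0) N"
    using L
  proof (induction L rule: finite_induct)
    case empty
    show ?case by (rule exI[of _ "{}"]) simp
  next
    case (insert g L)
    then obtain N where N: "finite N" "N \<subseteq> V" "0 \<notin> N" "L \<subseteq> span N"
      and orth: "pairwise (\<lambda>n m. n * m + m * n = 0) N" by auto
    have sub: "subspace V" using V by (simp add: clifford_space_def)
    have g: "g \<in> V" using insert by simp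
    have "\<forall>n\<in>N. \<exists>r. n * g + g * n = r *\<^sub>R 1"
      using V N g unfolding clifford_space_def by blast
    then obtain b where b: "\<And>n. n \<in> N \<Longrightarrow> n * g + g * n = b n *\<^sub>R 1" by metis
    define s where "s = (\<Sum>m\<in>N. (b m / (2 * (norm m)\<^sup>2)) *\<^sub>R m)"
    define g' where "g' = g - s"
    have sN: "s \<in> span N" unfolding s_def by (intro span_sum span_scale span_base)
    have g'V: "g' \<in> V" unfolding g'_def s_def
      using sub g N by (intro subspace_diff subspace_sum subspace_scale) auto
    have orth': "n * g' + g' * n = 0" if n: "n \<in> N" for n
    proof -
      have "n * s + s * n = (\<Sum>m\<in>N. (b m / (2 * (norm m)\<^sup>2)) *\<^sub>R (n * m + m * n))"
        by (simp add: s_def sum_distrib_left sum_distrib_right sum.distrib scaleR_add_right)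
      also have "\<dots> = (\<Sum>m\<in>{n}. (b m / (2 * (norm m)\<^sup>2)) *\<^sub>R (n * m + m * n))"
        using N n orth by (intro sum.mono_neutral_right) (auto simp: pairwise_def)
      also have "\<dots> = b n *\<^sub>R 1"
      proof -
        have "n \<noteq> 0" using N n by auto
        moreover have "n * n = (norm n)\<^sup>2 *\<^sub>R 1" using clifford_square[OF V] N n by auto
        ultimately show ?thesis by (simp add: scaleR_2[symmetric])
      qed
      finally show ?thesis using b[OF n] by (simp add: g'_def algebra_simps)
    qed
    show ?case
    proof (cases "g' = 0")
      case True
      then have "g \<in> span N" using sN by (simp add: g'_def)
      then show ?thesis using N orth by (intro exI[of _ N]) auto
    next
      case False
      have "g = g' + s" by (simp add: g'_def)
      moreover have "g' + s \<in> span (insert g' N)"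
        using sN span_mono[of N "insert g' N"] by (intro span_add) (auto intro: span_base)
      ultimately have "g \<in> span (insert g' N)" by simp
      moreover have "L \<subseteq> span (insert g' N)" using N(4) span_mono[of N "insert g' N"] by auto
      ultimately show ?thesis
        using N orth orth' False g'V
        by (intro exI[of _ "insert g' N"]) (auto simp: add.commute pairwise_insert)
    qed
  qed
  then show thesis using that by blast
qed

text \<open>
  Each Majorana operator outside \<open>B\<close> is removed by averaging over the reflection
  \<open>x \<mapsto> v \<gamma>(x) v / \<parallel>v\<parallel>\<^sup>2\<close>, which fixes \<open>B\<close> and \<open>A\<close> and maps \<open>v\<close> to \<open>- v\<close>.
\<close>

lemma clifford_average:
  fixes N :: "'a::unital_cstar_algebra set"
  assumes B: "complex_subalgebra B" and g: "star_automorphism \<gamma>" and gg: "\<forall>x. \<gamma> (\<gamma> x) = x"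
    and gB: "\<forall>b\<in>B. \<gamma> b \<in> B" and V: "clifford_space V" and gV: "\<forall>v\<in>V. \<gamma> v = - v"
    and comm: "\<forall>v\<in>V. \<forall>b\<in>B. v * b = \<gamma> b * v"
    and A: "\<forall>v\<in>V. v * \<gamma> A = A * v"
    and N: "finite N" "N \<subseteq> V" "0 \<notin> N" "pairwise (\<lambda>n m. n * m + m * n = 0) N"
  obtains S T where "complex_subalgebra S" "B \<union> N \<subseteq> S" "\<forall>s\<in>S. T s \<in> B"
    "\<forall>x. norm (T x - A) \<le> norm (x - A)"
proof -
  note G = star_automorphismD[OF g]
  \<comment> \<open>The induction also carries \<gamma>-invariance of \<open>S\<close> and its
    graded commutation with every vector orthogonal to \<open>N\<close>: these are what the next
    reflection uses.\<close>
  have "\<exists>S T. complex_subalgebra S \<and> B \<union> N \<subseteq> S \<and> \<gamma> ` S \<subseteq> S \<and>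
      (\<forall>v\<in>V. (\<forall>n\<in>N. v * n + n * v = 0) \<longrightarrow> (\<forall>s\<in>S. v * s = \<gamma> s * v)) \<and>
      (\<forall>s\<in>S. T s \<in> B) \<and> (\<forall>x. norm (T x - A) \<le> norm (x - A))"
    using N
  proof (induction N rule: finite_induct)
    case empty
    show ?case by (rule exI[of _ B], rule exI[of _ "\<lambda>x. x"]) (auto simp: B gB comm)
  next
    case (insert v N)
    have "N \<subseteq> V" "0 \<notin> N" "pairwise (\<lambda>n m. n * m + m * n = 0) N"
      using insert.prems by (auto simp: pairwise_insert)
    from insert.IH[OF this] obtain S T
      where S: "complex_subalgebra S" "B \<union> N \<subseteq> S" and gS: "\<gamma> ` S \<subseteq> S"
      and comS': "\<forall>v\<in>V. (\<forall>n\<in>N. v * n + n * v = 0) \<longrightarrow> (\<forall>s\<in>S. v * s = \<gamma> s * v)"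
      and T': "\<forall>s\<in>S. T s \<in> B" "\<forall>x. norm (T x - A) \<le> norm (x - A)"
      by (elim exE conjE) blast
    have S3: "\<And>s. s \<in> S \<Longrightarrow> \<gamma> s \<in> S" using gS by auto
    have comS: "\<And>v s. v \<in> V \<Longrightarrow> (\<forall>n\<in>N. v * n + n * v = 0) \<Longrightarrow> s \<in> S \<Longrightarrow> v * s = \<gamma> s * v"
      using comS' by blast
    have T: "\<And>s. s \<in> S \<Longrightarrow> T s \<in> B" "\<And>x. norm (T x - A) \<le> norm (x - A)"
      using T' by blast+
    note C = complex_subalgebraD[OF S(1)]
    have v: "v \<in> V" "v \<noteq> 0" using insert by auto
    define r where "r = (norm v)\<^sup>2"
    have r: "r > 0" using v by (simp add: r_def)
    have vv: "v * v = r *\<^sub>R 1" unfolding r_def using clifford_square[OF V v(1)] .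
    have vvx: "v * (v * x) = r *\<^sub>R x" for x using vv by (metis mult.assoc mult_scaleR_left mult_1)
    have vorth: "v * n + n * v = 0" if "n \<in> N" for n
      using insert.prems(3) insert.hyps that by (auto simp: pairwise_insert)
    have vs: "v * s = \<gamma> s * v" if "s \<in> S" for s using comS[OF v(1)] vorth that by blast
    have vsx: "v * (s * x) = \<gamma> s * (v * x)" if "s \<in> S" for s x using vs[OF that] by (metis mult.assoc)
    \<comment> \<open>Since \<open>v * v\<close> is a scalar and \<open>v\<close> moves past
      \<open>S\<close> at the cost of \<gamma>, elements of degree at most 1 in \<open>v\<close>
      already form an algebra.\<close>
    define S' where "S' = {s + s' * v |s s'. s \<in> S \<and> s' \<in> S}"
    define T' where "T' x = T ((1/2) *\<^sub>R (x + (1/r) *\<^sub>R (v * \<gamma> x * v)))" for x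
    have S'I: "s + s' * v \<in> S'" if "s \<in> S" "s' \<in> S" for s s'
      unfolding S'_def using that by blast
    have SS': "S \<subseteq> S'" unfolding S'_def using C(6) by force
    have vS': "v \<in> S'" unfolding S'_def using C(1,6) by force
    have sub': "complex_subalgebra S'"
      unfolding complex_subalgebra_def
    proof (intro conjI ballI allI)
      show "1 \<in> S'" using SS' C by blast
      fix x y assume "x \<in> S'" "y \<in> S'"
      then obtain s s' t t' where x: "x = s + s' * v" "s \<in> S" "s' \<in> S" and y: "y = t + t' * v" "t \<in> S" "t' \<in> S"
        unfolding S'_def by blast
      have "x + y = (s + t) + (s' + t') * v" by (simp add: x y algebra_simps)
      moreover have "s + t \<in> S" "s' + t' \<in> S" using x y by (simp_all add: C)
      ultimately show "x + y \<in> S'" by (simp only: S'I)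
      have "x * y = (s * t + r *\<^sub>R (s' * \<gamma> t')) + (s * t' + s' * \<gamma> t) * v"
        by (simp add: x y algebra_simps vs vsx vv)
      moreover have "s * t + r *\<^sub>R (s' * \<gamma> t') \<in> S" "s * t' + s' * \<gamma> t \<in> S"
        using x y by (simp_all add: C S3)
      ultimately show "x * y \<in> S'" by (simp only: S'I)
    next
      fix z x assume "x \<in> S'"
      then obtain s s' where x: "x = s + s' * v" "s \<in> S" "s' \<in> S" unfolding S'_def by blast
      have "z *\<^sub>\<complex> x = z *\<^sub>\<complex> s + (z *\<^sub>\<complex> s') * v" by (simp add: x cscale_add_right cscale_mult_left)
      moreover have "z *\<^sub>\<complex> s \<in> S" "z *\<^sub>\<complex> s' \<in> S" using x by (simp_all add: C)
      ultimately show "z *\<^sub>\<complex> x \<in> S'" by (simp only: S'I)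
    qed
    have gS': "\<gamma> x \<in> S'" if "x \<in> S'" for x
    proof -
      from that obtain s s' where x: "x = s + s' * v" "s \<in> S" "s' \<in> S" unfolding S'_def by blast
      have "\<gamma> x = \<gamma> s + ((-1) *\<^sub>R \<gamma> s') * v" by (simp add: x G gV v)
      moreover have "\<gamma> s \<in> S" "(-1) *\<^sub>R \<gamma> s' \<in> S"
        using x S3 C(5) by blast+
      ultimately show ?thesis by (simp only: S'I)
    qed
    have com': "w * x = \<gamma> x * w" if w: "w \<in> V" "\<forall>n\<in>insert v N. w * n + n * w = 0" and "x \<in> S'" for w x
    proof -
      from that obtain s s' where x: "x = s + s' * v" "s \<in> S" "s' \<in> S" unfolding S'_def by blast
      have ws: "w * s = \<gamma> s * w" "w * s' = \<gamma> s' * w" using comS w x by auto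
      have wv: "w * v = - (v * w)" using w(2) by (simp add: eq_neg_iff_add_eq_0)
      have "w * x = \<gamma> s * w + \<gamma> s' * (w * v)"
        unfolding x(1) distrib_left ws(1) mult.assoc[symmetric] ws(2) by simp
      also have "\<dots> = \<gamma> x * w" by (simp add: wv x(1) G gV v algebra_simps)
      finally show ?thesis .
    qed
    have T'S: "T' x \<in> B" if "x \<in> S'" for x
    proof -
      from that obtain s s' where x: "x = s + s' * v" "s \<in> S" "s' \<in> S" unfolding S'_def by blast
      have vg: "v * \<gamma> t = t * v" if "t \<in> S" for t using vs[OF S3[OF that]] gg by simp
      \<comment> \<open>The reflection sends \<open>s + s' * v\<close> to \<open>s - s' * v\<close>,
        so the average is exactly \<open>s\<close>, on which the earlier map \<open>T\<close> can
        act.\<close>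
      have "v * \<gamma> x * v = v * \<gamma> s * v - v * \<gamma> s' * (v * v)"
        by (simp add: x G gV v algebra_simps)
      also have "\<dots> = s * (v * v) - s' * v * (v * v)"
        using vg x by (simp add: mult.assoc)
      also have "\<dots> = r *\<^sub>R (s - s' * v)" by (simp add: vv algebra_simps)
      finally have "T' x = T ((1/2) *\<^sub>R (s + s))" using r by (simp add: T'_def x)
      also have "(1/2) *\<^sub>R (s + s) = s" by (simp add: scaleR_2[symmetric])
      finally show ?thesis using T(1) x by simp
    qed
    have T'A: "norm (T' x - A) \<le> norm (x - A)" for x
    proof -
      \<comment> \<open>The reflection fixes \<open>A\<close>, so the error \<open>x - A\<close> is
        averaged with its own reflection, whose norm is no larger.\<close>
      have eA: "v * \<gamma> A * v = r *\<^sub>R A" by (simp add: A v mult.assoc vv)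
      let ?y = "(1/2) *\<^sub>R (x + (1/r) *\<^sub>R (v * \<gamma> x * v))"
      have "A = (1/2) *\<^sub>R (A + (1/r) *\<^sub>R (v * \<gamma> A * v))" unfolding eA using r by (simp add: scaleR_2[symmetric])
      then have "?y - A = ?y - (1/2) *\<^sub>R (A + (1/r) *\<^sub>R (v * \<gamma> A * v))" by simp
      also have "\<dots> = (1/2) *\<^sub>R ((x - A) + (1/r) *\<^sub>R (v * \<gamma> (x - A) * v))"
        by (simp add: algebra_simps G)
      also have "norm \<dots> \<le> (1/2) * (norm (x - A) + (1/r) * (norm v * norm (x - A) * norm v))"
      proof -
        have "norm (v * \<gamma> (x - A) * v) \<le> norm (v * \<gamma> (x - A)) * norm v" by (rule norm_mult_ineq)
        also have "\<dots> \<le> norm v * norm (\<gamma> (x - A)) * norm v"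
          by (intro mult_right_mono norm_mult_ineq) auto
        finally have "norm (v * \<gamma> (x - A) * v) \<le> norm v * norm (x - A) * norm v"
          by (simp add: star_automorphism_isometry[OF g])
        then show ?thesis using r
          by (auto intro!: order_trans[OF norm_triangle_ineq] divide_right_mono)
      qed
      also have "\<dots> = norm (x - A)" using v unfolding r_def by (simp add: field_simps power2_eq_square)
      finally have "norm (?y - A) \<le> norm (x - A)" .
      then show ?thesis unfolding T'_def using T(2)[of ?y] by linarith
    qed
    show ?case
    proof (intro exI conjI)
      show "complex_subalgebra S'" by (rule sub')
      show "B \<union> insert v N \<subseteq> S'" using SS' vS' S(2) by auto
      show "\<gamma> ` S' \<subseteq> S'" using gS' by auto
      show "\<forall>w\<in>V. (\<forall>n\<in>insert v N. w * n + n * w = 0) \<longrightarrow> (\<forall>x\<in>S'. w * x = \<gamma> x * w)"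
        using com' by blast
      show "\<forall>s\<in>S'. T' s \<in> B" using T'S by blast
      show "\<forall>x. norm (T' x - A) \<le> norm (x - A)" using T'A by blast
    qed
  qed
  then show thesis using that by blast
qed

text \<open>A converse to \<open>comm\<close>: apart from \<open>B\<close> nothing graded-commutes
  with all of \<open>V\<close>. Polynomials in \<open>B\<close> and finitely many vectors of
  \<open>V\<close> are dense, and averaging turns each into an element of \<open>B\<close> at least
  as close to \<open>A\<close>; closedness of \<open>B\<close> finishes.\<close>

theorem clifford_slice:
  fixes B V :: "'a::unital_cstar_algebra set"
  assumes B: "unital_cstar_subalgebra B" and g: "star_automorphism \<gamma>" and gg: "\<And>x. \<gamma> (\<gamma> x) = x"
    and gB: "\<And>b. b \<in> B \<Longrightarrow> \<gamma> b \<in> B" and V: "clifford_space V" and gV: "\<And>v. v \<in> V \<Longrightarrow> \<gamma> v = - v"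
    and comm: "\<And>v b. v \<in> V \<Longrightarrow> b \<in> B \<Longrightarrow> v * b = \<gamma> b * v"
    and gen: "\<And>D. unital_cstar_subalgebra D \<Longrightarrow> B \<union> V \<subseteq> D \<Longrightarrow> D = UNIV"
    and A: "\<And>v. v \<in> V \<Longrightarrow> v * \<gamma> A = A * v"
  shows "A \<in> B"
proof -
  have B': "complex_subalgebra B" and clB: "closed B" and starB: "\<And>b. b \<in> B \<Longrightarrow> star b \<in> B"
    using B by (auto simp: unital_cstar_subalgebra_def complex_subalgebra_def)
  have starV: "star v = v" if "v \<in> V" for v using V that by (simp add: clifford_space_def)
  \<comment> \<open>Quantifying over all algebras instead of writing out polynomials places
    \<open>x\<close> directly in whichever algebra the averaging produces.\<close>
  define gens where "gens L x \<longleftrightarrow> (\<forall>S. complex_subalgebra S \<longrightarrow> B \<union> L \<subseteq> S \<longrightarrow> x \<in> S)" for L and x :: 'a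
  define Q where "Q = {x. \<exists>L. finite L \<and> L \<subseteq> V \<and> gens L x}"
  have mono: "gens L x \<Longrightarrow> L \<subseteq> L' \<Longrightarrow> gens L' x" for L L' x
    unfolding gens_def by blast
  have csub: "complex_subalgebra Q"
    unfolding complex_subalgebra_def
  proof (intro conjI ballI allI)
    show "1 \<in> Q" unfolding Q_def gens_def
      by (rule CollectI, rule exI[of _ "{}"]) (auto simp: complex_subalgebraD)
    fix x y assume "x \<in> Q" "y \<in> Q"
    then obtain L L' where "finite L" "L \<subseteq> V" "gens L x" "finite L'" "L' \<subseteq> V" "gens L' y"
      unfolding Q_def by blast
    then have L: "finite (L \<union> L')" "L \<union> L' \<subseteq> V" "gens (L \<union> L') x" "gens (L \<union> L') y"
      using mono by blast+
    then have "gens (L \<union> L') (x + y)" "gens (L \<union> L') (x * y)"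
      unfolding gens_def by (simp_all add: complex_subalgebraD)
    then show "x + y \<in> Q" "x * y \<in> Q" unfolding Q_def using L by blast+
  next
    fix z x assume "x \<in> Q"
    then obtain L where L: "finite L" "L \<subseteq> V" "gens L x" unfolding Q_def by blast
    then have "gens L (z *\<^sub>\<complex> x)" unfolding gens_def by (simp add: complex_subalgebraD)
    then show "z *\<^sub>\<complex> x \<in> Q" unfolding Q_def using L by blast
  qed
  have starQ: "star x \<in> Q" if x: "x \<in> Q" for x
  proof -
    from x obtain L where L: "finite L" "L \<subseteq> V" "gens L x" unfolding Q_def by blast
    have "gens L (star x)" unfolding gens_def
    proof (intro allI impI)
      fix S assume S: "complex_subalgebra S" "B \<union> L \<subseteq> S"
      note C = complex_subalgebraD[OF S(1)]
      have "complex_subalgebra {y. star y \<in> S}"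
        unfolding complex_subalgebra_def by (simp add: C star_add star_mult star_cscale)
      moreover have "B \<union> L \<subseteq> {y. star y \<in> S}" using S(2) starB starV L(2) by (auto simp: subset_iff)
      ultimately show "star x \<in> S" using L(3) unfolding gens_def by blast
    qed
    then show ?thesis unfolding Q_def using L by blast
  qed
  have "B \<subseteq> Q" unfolding Q_def gens_def by blast
  moreover have "V \<subseteq> Q"
  proof
    fix v assume "v \<in> V"
    then show "v \<in> Q" unfolding Q_def gens_def by (intro CollectI exI[of _ "{v}"]) auto
  qed
  ultimately have "B \<union> V \<subseteq> closure Q" using closure_subset[of Q] by auto
  then have "closure Q = UNIV" by (intro gen unital_cstar_subalgebra_closure csub starQ)
  then have AQ: "A \<in> closure Q" by simp
  have "A \<in> closure B" unfolding closure_approachable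
  proof (intro allI impI)
    fix e :: real assume "e > 0"
    then obtain x where x: "x \<in> Q" "dist x A < e" using AQ unfolding closure_approachable by blast
    obtain L where L: "finite L" "L \<subseteq> V" "gens L x" using x unfolding Q_def by blast
    obtain N where N: "finite N" "N \<subseteq> V" "0 \<notin> N" "L \<subseteq> span N"
      and orth: "pairwise (\<lambda>n m. n * m + m * n = 0) N"
      by (rule clifford_orthogonalize[OF V L(1,2)])
    obtain S T where S: "complex_subalgebra S" "B \<union> N \<subseteq> S" "\<forall>s\<in>S. T s \<in> B"
      "\<forall>x. norm (T x - A) \<le> norm (x - A)"
      by (rule clifford_average[where B=B and \<gamma>=\<gamma> and V=V and A=A and N=N])
        (use B' g gg gB V gV comm A N(1,2,3) orth in auto)
    \<comment> \<open>Orthogonalization replaced \<open>L\<close> by \<open>N\<close>; as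
      \<open>L\<close> lies in the real span of \<open>N\<close>, the algebra built from
      \<open>N\<close> still contains \<open>x\<close>.\<close>
    have "span N \<subseteq> S" using S(1,2) by (intro span_minimal complex_subalgebraD) auto
    then have "x \<in> S" using L(3) N(4) S(1,2) unfolding gens_def by blast
    then have "T x \<in> B" using S(3) by blast
    moreover have "dist (T x) A < e" using spec[OF S(4), of x] x(2) by (simp add: dist_norm)
    ultimately show "\<exists>y\<in>B. dist y A < e" by blast
  qed
  then show ?thesis using clB by simp
qed

section \<open>Fixed points in a CAR algebra\<close>

text \<open>These are the self-adjoint field operators. As \<open>a\<close> is antilinear,
  \<open>z\<close> times \<open>a f\<close> is \<open>a\<close> of \<open>cnj z\<close> times
  \<open>f\<close>, so the parameter \<open>z\<close> only spares scalar multiples of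
  vectors.\<close>

definition majorana :: "('h \<Rightarrow> 'a::unital_cstar_algebra) \<Rightarrow> complex \<Rightarrow> 'h \<Rightarrow> 'a" where
  "majorana a z f = z *\<^sub>\<complex> a f + cnj z *\<^sub>\<complex> star (a f)"

lemma star_majorana: "star (majorana a z f) = majorana a z f"
  by (simp add: majorana_def star_add star_cscale star_star add.commute)

lemma is_CARD:
  assumes "is_CAR H a" "f \<in> vecs H" "g \<in> vecs H"
  shows "a (vadd H f g) = a f + a g" "a (vscale H z f) = cnj z *\<^sub>\<complex> a f"
    "a f * star (a g) + star (a g) * a f = vinner H f g *\<^sub>\<complex> 1"
    "a f * a g + a g * a f = 0"
    "star (a f) * star (a g) + star (a g) * star (a f) = 0"
    "star (a f) * a g + a g * star (a f) = cnj (vinner H f g) *\<^sub>\<complex> 1"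
proof -
  show *: "a (vadd H f g) = a f + a g" "a (vscale H z f) = cnj z *\<^sub>\<complex> a f"
    "a f * star (a g) + star (a g) * a f = vinner H f g *\<^sub>\<complex> 1"
    "a f * a g + a g * a f = 0"
    using assms by (simp_all add: is_CAR_def)
  have "star (a f * a g + a g * a f) = 0" by (simp add: *)
  then show "star (a f) * star (a g) + star (a g) * star (a f) = 0"
    by (simp add: star_add star_mult add.commute)
  have "star (a f * star (a g) + star (a g) * a f) = cnj (vinner H f g) *\<^sub>\<complex> 1"
    by (simp add: * star_cscale)
  then show "star (a f) * a g + a g * star (a f) = cnj (vinner H f g) *\<^sub>\<complex> 1"
    by (simp add: star_add star_mult star_star add.commute)
qed

text \<open>Of the four products only the two mixed ones survive, and they contribute conjugate
  scalars. In particular, vectors orthogonal for the complex inner product give anticommuting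
  operators for every choice of phases.\<close>

lemma majorana_anticommutator:
  assumes a: "is_CAR H a" "f \<in> vecs H" "g \<in> vecs H"
  shows "majorana a z f * majorana a w g + majorana a w g * majorana a z f
    = (2 * Re (z * cnj w * vinner H f g)) *\<^sub>R 1"
proof -
  note C = is_CARD[OF a]
  have "majorana a z f * majorana a w g + majorana a w g * majorana a z f
    = (z * w) *\<^sub>\<complex> (a f * a g + a g * a f)
      + (z * cnj w) *\<^sub>\<complex> (a f * star (a g) + star (a g) * a f)
      + (cnj z * w) *\<^sub>\<complex> (star (a f) * a g + a g * star (a f))
      + (cnj z * cnj w) *\<^sub>\<complex> (star (a f) * star (a g) + star (a g) * star (a f))"
    by (simp add: majorana_def cscale_add_right cscale_mult_left cscale_mult_right cscale_cscale
        algebra_simps)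
  also have "\<dots> = (z * cnj w * vinner H f g + cnj (z * cnj w * vinner H f g)) *\<^sub>\<complex> 1"
    by (simp add: C cscale_cscale cscale_add_left)
  also have "z * cnj w * vinner H f g + cnj (z * cnj w * vinner H f g)
      = complex_of_real (2 * Re (z * cnj w * vinner H f g))"
    by (rule complex_add_cnj)
  finally show ?thesis by (simp only: cscale_of_real)
qed

text \<open>The phases 1 and i together separate \<open>a f\<close> from its adjoint, so a complex
  algebra containing all Majorana operators contains the generators.\<close>

lemma annihilator_eq_majorana: "a f = (1/2) *\<^sub>R (majorana a 1 f - \<i> *\<^sub>\<complex> majorana a \<i> f)"
proof -
  have "majorana a 1 f - \<i> *\<^sub>\<complex> majorana a \<i> f = a f + a f"
    by (simp add: majorana_def cscale_add_right cscale_diff_right cscale_cscale)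
  then show ?thesis by (simp add: scaleR_2[symmetric])
qed

text \<open>
  Let \<open>A\<close> be fixed and \<open>v\<close> a Majorana operator of a vector in the range of \<open>Q\<close>.  The images
  \<open>\<alpha> (u k) v\<close> under an orthogonal sequence asymptotically graded-commute with \<open>A\<close>, but the norm of
  their graded commutator with \<open>A\<close> does not depend on \<open>k\<close>, so it vanishes already for \<open>v\<close>.
\<close>

theorem CAR_fixed_points:
  fixes H :: "'h hilbert_structure" and a :: "'h \<Rightarrow> 'a::unital_cstar_algebra"
  assumes a: "is_CAR H a"
    and P: "\<And>f. f \<in> vecs H \<Longrightarrow> P f \<in> vecs H" and Q: "\<And>f. f \<in> vecs H \<Longrightarrow> Q f \<in> vecs H"
    and PQ: "\<And>f. f \<in> vecs H \<Longrightarrow> vadd H (P f) (Q f) = f"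
    and PQ0: "\<And>f g. f \<in> vecs H \<Longrightarrow> g \<in> vecs H \<Longrightarrow> vinner H (P f) (Q g) = 0"
    and \<gamma>: "star_automorphism \<gamma>" and \<gamma>a: "\<And>f. f \<in> vecs H \<Longrightarrow> \<gamma> (a f) = - a f"
    and \<alpha>: "\<And>U. U \<in> \<U> \<Longrightarrow> star_automorphism (\<alpha> U)"
    and U: "\<And>U f. U \<in> \<U> \<Longrightarrow> f \<in> vecs H \<Longrightarrow> U f \<in> vecs H"
    and \<alpha>a: "\<And>U f. U \<in> \<U> \<Longrightarrow> f \<in> vecs H \<Longrightarrow> \<alpha> U (a f) = a (U f)"
    and UP: "\<And>U f. U \<in> \<U> \<Longrightarrow> f \<in> vecs H \<Longrightarrow> U (P f) = P f"
    and orth: "\<And>f. f \<in> vecs H \<Longrightarrow> \<exists>u :: nat \<Rightarrow> 'h \<Rightarrow> 'h. (\<forall>k. u k \<in> \<U>) \<and>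
      (\<forall>j k. j \<noteq> k \<longrightarrow> vinner H (u j (Q f)) (u k (Q f)) = 0)"
  shows "unital_cstar_subalgebra hull (a ` P ` vecs H) = {A. \<forall>U\<in>\<U>. \<alpha> U A = A}"
proof
  let ?B = "unital_cstar_subalgebra hull (a ` P ` vecs H)"
  have B: "unital_cstar_subalgebra ?B" by (rule unital_cstar_subalgebra_hull)
  have aPB: "a (P f) \<in> ?B" if "f \<in> vecs H" for f using that by (intro hull_inc) auto
  show "?B \<subseteq> {A. \<forall>U\<in>\<U>. \<alpha> U A = A}"
  proof
    fix A assume A: "A \<in> ?B"
    have "\<alpha> U A = A" if U': "U \<in> \<U>" for U
    proof -
      have "unital_cstar_subalgebra {x. \<alpha> U x = id x}"
        by (intro unital_cstar_subalgebra_equalizer \<alpha> U' star_automorphism_id)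
      moreover have "a ` P ` vecs H \<subseteq> {x. \<alpha> U x = id x}" using U' P by (auto simp: \<alpha>a UP)
      ultimately have "?B \<subseteq> {x. \<alpha> U x = id x}" by (intro hull_minimal)
      then show ?thesis using A by auto
    qed
    then show "A \<in> {A. \<forall>U\<in>\<U>. \<alpha> U A = A}" by blast
  qed
  show "{A. \<forall>U\<in>\<U>. \<alpha> U A = A} \<subseteq> ?B"
  proof
    fix A assume "A \<in> {A. \<forall>U\<in>\<U>. \<alpha> U A = A}"
    then have A: "\<And>U. U \<in> \<U> \<Longrightarrow> \<alpha> U A = A" by blast
    note G = star_automorphismD[OF \<gamma>]
    have gen: "D = UNIV" if D: "unital_cstar_subalgebra D" "\<And>f. f \<in> vecs H \<Longrightarrow> a f \<in> D" for D
    proof -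
      have "unital_cstar_subalgebra hull (a ` vecs H) \<subseteq> D" using D by (intro hull_minimal) auto
      then show ?thesis using a by (auto simp: is_CAR_def)
    qed
    have agree: "f x = g x" if "star_automorphism f" "star_automorphism g"
      "\<And>h. h \<in> vecs H \<Longrightarrow> f (a h) = g (a h)" for f g x
      using gen[OF unital_cstar_subalgebra_equalizer[OF that(1,2)]] that(3) by blast
    have gg: "\<gamma> (\<gamma> x) = x" for x
      using agree[of "\<gamma> \<circ> \<gamma>" id x] \<gamma> by (simp add: star_automorphism_comp star_automorphism_id \<gamma>a G)
    have g\<alpha>: "\<alpha> U (\<gamma> x) = \<gamma> (\<alpha> U x)" if U': "U \<in> \<U>" for U x
      using agree[of "\<alpha> U \<circ> \<gamma>" "\<gamma> \<circ> \<alpha> U" x] \<gamma> \<alpha>[OF U'] U U'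
      by (simp add: star_automorphism_comp \<gamma>a \<alpha>a star_automorphismD(9))
    define M where "M F = {majorana a z f |z f. f \<in> F}" for F
    have anti: "\<exists>r. v * w + w * v = r *\<^sub>R 1" if "v \<in> M (vecs H)" "w \<in> M (vecs H)" for v w
      using that majorana_anticommutator[OF a] unfolding M_def by blast
    have starM: "star v = v" if "v \<in> M F" for v F using that by (auto simp: M_def star_majorana)
    \<comment> \<open>Two Clifford spaces are in play. The vectors \<open>u k (Q f)\<close> are only
      known to lie in \<open>vecs H\<close>, so the limit is taken in this large space; the smaller
      one below, from the range of \<open>Q\<close>, is the one that is averaged away.\<close>
    have cW: "clifford_space (span (M (vecs H)))" using starM anti by (rule clifford_space_span)
    have QM: "M (Q ` vecs H) \<subseteq> M (vecs H)" unfolding M_def using Q by blast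
    have cV: "clifford_space (span (M (Q ` vecs H)))"
      by (rule clifford_space_span[OF starM anti]) (use QM in auto)
    have gW: "\<gamma> v = - v" if "v \<in> span (M (vecs H))" for v
      using that
    proof (induction rule: span_induct_alt)
      case (step c x y)
      then obtain z f where x: "x = majorana a z f" "f \<in> vecs H" unfolding M_def by blast
      then have "\<gamma> x = - x" by (simp add: majorana_def G \<gamma>a)
      then show ?case using step by (simp add: G)
    qed (simp add: G)
    have gV: "\<gamma> v = - v" if "v \<in> span (M (Q ` vecs H))" for v
      using that gW span_mono[OF QM] by blast
    have aD: "a f \<in> D" if D: "unital_cstar_subalgebra D" and "M {f} \<subseteq> D" for f D
    proof -
      have C: "complex_subalgebra D" using D by (auto simp: unital_cstar_subalgebra_def complex_subalgebra_def)
      note C = complex_subalgebraD[OF C]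
      have "majorana a 1 f \<in> D" "majorana a \<i> f \<in> D" using that(2) by (auto simp: M_def)
      then have "(1/2) *\<^sub>R (majorana a 1 f - \<i> *\<^sub>\<complex> majorana a \<i> f) \<in> D"
        by (intro C subspace_diff[OF C(7)])
      then show ?thesis using annihilator_eq_majorana[of a f] by simp
    qed
    have Acomm0: "v * \<gamma> A = A * v" if "v \<in> M (Q ` vecs H)" for v
    proof -
      from that obtain z f where v: "v = majorana a z (Q f)" "f \<in> vecs H" unfolding M_def by blast
      obtain u :: "nat \<Rightarrow> 'h \<Rightarrow> 'h" where u: "\<And>k. u k \<in> \<U>" and uo: "\<And>j k. j \<noteq> k \<Longrightarrow> vinner H (u j (Q f)) (u k (Q f)) = 0"
        using orth[OF v(2)] by blast
      define w where "w k = majorana a z (u k (Q f))" for k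
      have \<alpha>v: "\<alpha> (u k) v = w k" for k
        unfolding v(1) w_def majorana_def
        by (simp add: star_automorphismD[OF \<alpha>[OF u]] \<alpha>a[OF u] Q v(2))
      have uQ: "u k (Q f) \<in> vecs H" for k using U[OF u] Q v(2) by blast
      have lim: "(\<lambda>k. w k * \<gamma> A - A * w k) \<longlonglongrightarrow> 0"
      proof (rule asymptotic_graded_commute[OF cW _ _ _ \<gamma> gW])
        show "w k \<in> span (M (vecs H))" for k unfolding w_def M_def using uQ by (intro span_base) blast
        show "w j * w k + w k * w j = 0" if "j \<noteq> k" for j k
          unfolding w_def by (simp add: majorana_anticommutator[OF a uQ uQ] uo[OF that])
        show "norm (w k) = norm v" for k
          by (simp add: \<alpha>v[symmetric] star_automorphism_isometry[OF \<alpha>[OF u]])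
        show "D = UNIV" if "unital_cstar_subalgebra D" "span (M (vecs H)) \<subseteq> D" for D
        proof (rule gen[OF that(1)])
          fix f assume "f \<in> vecs H"
          then have "M {f} \<subseteq> M (vecs H)" by (auto simp: M_def)
          also have "\<dots> \<subseteq> D" using that(2) span_superset by blast
          finally show "a f \<in> D" by (rule aD[OF that(1)])
        qed
      qed
      have "norm (w k * \<gamma> A - A * w k) = norm (v * \<gamma> A - A * v)" for k
      proof -
        have "w k * \<gamma> A - A * w k = \<alpha> (u k) (v * \<gamma> A - A * v)"
          by (simp add: star_automorphismD[OF \<alpha>[OF u]] \<alpha>v g\<alpha>[OF u] A[OF u])
        then show ?thesis by (simp add: star_automorphism_isometry[OF \<alpha>[OF u]])
      qed
      then have "(\<lambda>k. norm (v * \<gamma> A - A * v)) \<longlonglongrightarrow> norm (0::'a)"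
        using tendsto_norm[OF lim] by simp
      then have "norm (v * \<gamma> A - A * v) = 0" by (simp add: LIMSEQ_const_iff)
      then show ?thesis by simp
    qed
    have Acomm: "v * \<gamma> A = A * v" if "v \<in> span (M (Q ` vecs H))" for v
      using that by (induction rule: span_induct_alt) (simp_all add: distrib_left distrib_right Acomm0)
    have gB: "\<gamma> b \<in> ?B" if "b \<in> ?B" for b
    proof -
      have cl: "closed {b. \<gamma> b \<in> ?B}"
        using continuous_closed_vimage[of ?B \<gamma>] B star_automorphism_bounded_linear[OF \<gamma>]
        by (auto simp: vimage_def unital_cstar_subalgebra_def intro: linear_continuous_at)
      have "unital_cstar_subalgebra {b. \<gamma> b \<in> ?B}"
        using B cl unfolding unital_cstar_subalgebra_def by (simp add: G)
      moreover have "(-1) *\<^sub>\<complex> a (P f) \<in> ?B" if "f \<in> vecs H" for f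
        using aPB[OF that] B unfolding unital_cstar_subalgebra_def by blast
      then have "a ` P ` vecs H \<subseteq> {b. \<gamma> b \<in> ?B}" using P by (auto simp: \<gamma>a)
      ultimately have "?B \<subseteq> {b. \<gamma> b \<in> ?B}" by (intro hull_minimal)
      then show ?thesis using that by blast
    qed
    have comm0: "v * b = \<gamma> b * v" if "v \<in> M (Q ` vecs H)" "b \<in> ?B" for v b
    proof -
      \<comment> \<open>As in the asymptotic version, the second relation is there because taking
        adjoints exchanges the two.\<close>
      let ?D = "{b. v * b = \<gamma> b * v \<and> b * v = v * \<gamma> b}"
      have sv: "star v = v" using starM that(1) .
      have cont: "continuous_on UNIV \<gamma>"
        by (intro linear_continuous_on star_automorphism_bounded_linear \<gamma>)
      have cl: "closed ?D"
        by (intro closed_Collect_conj closed_Collect_eq continuous_intros cont)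
      have mult: "v * (x * y) = \<gamma> (x * y) * v" "(x * y) * v = v * \<gamma> (x * y)"
        if "x \<in> ?D" "y \<in> ?D" for x y
      proof -
        have "v * (x * y) = v * x * y" by (simp only: mult.assoc)
        also have "\<dots> = \<gamma> x * (v * y)" using that by (simp add: mult.assoc)
        also have "\<dots> = \<gamma> (x * y) * v" using that by (simp add: G mult.assoc)
        finally show "v * (x * y) = \<gamma> (x * y) * v" .
        have "(x * y) * v = x * (v * \<gamma> y)" using that by (simp add: mult.assoc)
        also have "\<dots> = x * v * \<gamma> y" by (simp only: mult.assoc)
        also have "\<dots> = v * \<gamma> (x * y)" using that by (simp add: G mult.assoc)
        finally show "(x * y) * v = v * \<gamma> (x * y)" .
      qed
      have st: "v * star x = \<gamma> (star x) * v" "star x * v = v * \<gamma> (star x)" if "x \<in> ?D" for x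
      proof -
        have "star (v * x) = star (\<gamma> x * v)" "star (x * v) = star (v * \<gamma> x)" using that by simp_all
        then show "v * star x = \<gamma> (star x) * v" "star x * v = v * \<gamma> (star x)"
          by (simp_all add: star_mult sv G)
      qed
      have "unital_cstar_subalgebra ?D"
        unfolding unital_cstar_subalgebra_def
      proof (intro conjI ballI allI cl)
        show "1 \<in> ?D" by (simp add: G)
        fix x y assume "x \<in> ?D" "y \<in> ?D"
        then show "x + y \<in> ?D" "x * y \<in> ?D" using mult by (auto simp: algebra_simps G)
      next
        fix z x assume "x \<in> ?D"
        then show "z *\<^sub>\<complex> x \<in> ?D" by (simp add: G cscale_mult_left cscale_mult_right)
      qed (use st in auto)
      moreover have "a ` P ` vecs H \<subseteq> ?D"
      proof clarify
        fix g assume g: "g \<in> vecs H"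
        from that(1) obtain z f where v: "v = majorana a z (Q f)" "f \<in> vecs H"
          unfolding M_def by blast
        note C = is_CARD[OF a P[OF g] Q[OF v(2)]]
        \<comment> \<open>Both \<open>a (Q f)\<close> and its adjoint anticommute with
          \<open>a (P g)\<close>, the adjoint because the ranges of \<open>P\<close> and
          \<open>Q\<close> are orthogonal. Since \<gamma> changes the sign of
          \<open>a (P g)\<close>, this is graded commutation.\<close>
        have 1: "a (Q f) * a (P g) = - (a (P g) * a (Q f))"
          using C(4) by (simp add: eq_neg_iff_add_eq_0 add.commute)
        have 2: "star (a (Q f)) * a (P g) = - (a (P g) * star (a (Q f)))"
          using C(3) by (simp add: PQ0[OF g v(2)] eq_neg_iff_add_eq_0 add.commute)
        show "v * a (P g) = \<gamma> (a (P g)) * v \<and> a (P g) * v = v * \<gamma> (a (P g))"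
          by (simp add: \<gamma>a[OF P[OF g]] v(1) majorana_def algebra_simps cscale_mult_left
              cscale_mult_right 1 2)
      qed
      ultimately have "?B \<subseteq> ?D" by (intro hull_minimal)
      then show ?thesis using that(2) by blast
    qed
    have comm: "v * b = \<gamma> b * v" if "v \<in> span (M (Q ` vecs H))" "b \<in> ?B" for v b
      using that(1) by (induction rule: span_induct_alt) (simp_all add: distrib_left distrib_right comm0 that(2))
    show "A \<in> ?B"
    proof (rule clifford_slice[OF B \<gamma> gg gB cV gV comm _ Acomm])
      fix D assume D: "unital_cstar_subalgebra D" "?B \<union> span (M (Q ` vecs H)) \<subseteq> D"
      show "D = UNIV"
      proof (rule gen[OF D(1)])
        fix f assume f: "f \<in> vecs H"
        have "M {Q f} \<subseteq> M (Q ` vecs H)" using f by (auto simp: M_def)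
        also have "\<dots> \<subseteq> D" using D(2) span_superset by blast
        finally have "a (Q f) \<in> D" by (rule aD[OF D(1)])
        moreover have "a (P f) \<in> D" using aPB[OF f] D(2) by blast
        moreover have "a f = a (P f) + a (Q f)"
          using is_CARD(1)[OF a P[OF f] Q[OF f]] PQ[OF f] by simp
        ultimately show "a f \<in> D" using D(1) by (simp add: unital_cstar_subalgebra_def)
      qed
    qed
  qed
qed

section \<open>Smooth functions\<close>

lemma Ck_on_cong:
  assumes "open S" "\<And>x. x \<in> S \<Longrightarrow> f x = g x" "Ck_on r S f"
  shows "Ck_on r S g"
  using assms(2,3)
proof (induction r arbitrary: f g)
  case 0
  then show ?case using continuous_on_cong[of S S f g] by simp
next
  case (Suc r)
  have d: "(g has_derivative frechet_derivative f (at x)) (at x)" if x: "x \<in> S" for x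
  proof (rule has_derivative_transform_within_open)
    show "(f has_derivative frechet_derivative f (at x)) (at x)"
      using Suc x by (simp add: frechet_derivative_works[symmetric])
  qed (use assms(1) x Suc in auto)
  have "Ck_on r S (\<lambda>x. frechet_derivative g (at x) b)" if b: "b \<in> Basis" for b
  proof (rule Suc.IH)
    show "frechet_derivative f (at x) b = frechet_derivative g (at x) b" if "x \<in> S" for x
      using frechet_derivative_at[OF d[OF that]] by simp
    show "Ck_on r S (\<lambda>x. frechet_derivative f (at x) b)" using Suc b by simp
  qed
  then show ?case using d by (auto simp: differentiable_def)
qed

text \<open>Allows any explicit derivative in place of the chosen \<open>frechet_derivative\<close>;
  the two agree throughout the open set.\<close>

lemma Ck_on_SucI:
  assumes S: "open S" and d: "\<And>x. x \<in> S \<Longrightarrow> (f has_derivative D x) (at x)"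
    and "\<And>b. b \<in> Basis \<Longrightarrow> Ck_on r S (\<lambda>x. D x b)"
  shows "Ck_on (Suc r) S f"
proof -
  have eq: "D x b = frechet_derivative f (at x) b" if "x \<in> S" for x b
    using frechet_derivative_at[OF d[OF that]] by simp
  have "Ck_on r S (\<lambda>x. frechet_derivative f (at x) b)" if "b \<in> Basis" for b
    by (rule Ck_on_cong[OF S _ assms(3)[OF that]]) (rule eq)
  then show ?thesis using d by (auto simp: differentiable_def)
qed

lemma Ck_on_SucE:
  assumes "Ck_on (Suc r) S f"
  obtains D where "\<And>x. x \<in> S \<Longrightarrow> (f has_derivative D x) (at x)"
    "\<And>b. b \<in> Basis \<Longrightarrow> Ck_on r S (\<lambda>x. D x b)"
  using assms that[of "\<lambda>x. frechet_derivative f (at x)"]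
  by (simp add: frechet_derivative_works[symmetric])

lemma Ck_on_SucD: "Ck_on (Suc r) S f \<Longrightarrow> Ck_on r S f"
proof (induction r arbitrary: f)
  case 0
  then show ?case
    by (simp add: continuous_at_imp_continuous_on differentiable_imp_continuous_within)
next
  case (Suc r)
  then show ?case by (metis Ck_on.simps(2))
qed

lemma Ck_on_subset: "Ck_on r S f \<Longrightarrow> T \<subseteq> S \<Longrightarrow> Ck_on r T f"
  by (induction r arbitrary: f) (auto intro: continuous_on_subset)

lemma Ck_on_Un:
  "open S \<Longrightarrow> open T \<Longrightarrow> Ck_on r S f \<Longrightarrow> Ck_on r T f \<Longrightarrow> Ck_on r (S \<union> T) f"
  by (induction r arbitrary: f) (auto intro: continuous_on_open_Un)

lemma Ck_on_const: "open S \<Longrightarrow> Ck_on r S (\<lambda>x. c)"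
proof (induction r arbitrary: c)
  case (Suc r)
  show ?case by (rule Ck_on_SucI[where D="\<lambda>_ _. 0"]) (use Suc in auto)
qed simp

lemma Ck_on_add: "open S \<Longrightarrow> Ck_on r S f \<Longrightarrow> Ck_on r S g \<Longrightarrow> Ck_on r S (\<lambda>x. f x + g x)"
proof (induction r arbitrary: f g)
  case 0
  then show ?case by (auto intro: continuous_intros)
next
  case (Suc r)
  obtain D where D: "\<And>x. x \<in> S \<Longrightarrow> (f has_derivative D x) (at x)"
    "\<And>b. b \<in> Basis \<Longrightarrow> Ck_on r S (\<lambda>x. D x b)" using Ck_on_SucE[OF Suc.prems(2)] by blast
  obtain D' where D': "\<And>x. x \<in> S \<Longrightarrow> (g has_derivative D' x) (at x)"
    "\<And>b. b \<in> Basis \<Longrightarrow> Ck_on r S (\<lambda>x. D' x b)" using Ck_on_SucE[OF Suc.prems(3)] by blast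
  show ?case
    by (rule Ck_on_SucI[where D="\<lambda>x h. D x h + D' x h"])
       (use D D' Suc in \<open>auto intro!: has_derivative_add\<close>)
qed

text \<open>A single product rule serves real and complex scaling, multiplication and the inner
  product.\<close>

lemma Ck_on_bilinear:
  assumes p: "bounded_bilinear p"
  shows "open S \<Longrightarrow> Ck_on r S f \<Longrightarrow> Ck_on r S g \<Longrightarrow> Ck_on r S (\<lambda>x. p (f x) (g x))"
proof (induction r arbitrary: f g)
  case 0
  then show ?case by (auto intro: bounded_bilinear.continuous_on[OF p])
next
  case (Suc r)
  obtain D where D: "\<And>x. x \<in> S \<Longrightarrow> (f has_derivative D x) (at x)"
    "\<And>b. b \<in> Basis \<Longrightarrow> Ck_on r S (\<lambda>x. D x b)" using Ck_on_SucE[OF Suc.prems(2)] by blast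
  obtain D' where D': "\<And>x. x \<in> S \<Longrightarrow> (g has_derivative D' x) (at x)"
    "\<And>b. b \<in> Basis \<Longrightarrow> Ck_on r S (\<lambda>x. D' x b)" using Ck_on_SucE[OF Suc.prems(3)] by blast
  have fg: "Ck_on r S f" "Ck_on r S g" using Suc.prems(2,3) Ck_on_SucD by blast+
  show ?case
  proof (rule Ck_on_SucI[where D="\<lambda>x h. p (f x) (D' x h) + p (D x h) (g x)"])
    show "((\<lambda>x. p (f x) (g x)) has_derivative (\<lambda>h. p (f x) (D' x h) + p (D x h) (g x))) (at x)"
      if "x \<in> S" for x
      by (rule bounded_bilinear.FDERIV[OF p D(1)[OF that] D'(1)[OF that]])
    show "Ck_on r S (\<lambda>x. p (f x) (D' x b) + p (D x b) (g x))" if "b \<in> Basis" for b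
      using that D D' fg Suc.prems(1) by (intro Ck_on_add Suc.IH) auto
  qed (rule Suc.prems(1))
qed

text \<open>
  For \<open>c > 0\<close> these functions are flat at 0, and the family is closed under differentiation.
\<close>

definition flat :: "real poly \<Rightarrow> real \<Rightarrow> real \<Rightarrow> real" where
  "flat p c t = (if t \<le> 0 then 0 else poly p (1 / t) * exp (- (c / t)))"

text \<open>The extra power \<open>n\<close> absorbs the shift when the induction peels off a
  coefficient. With x = 1/t the case n = 1 is the difference quotient of \<open>flat\<close> at 0
  from the right.\<close>

lemma power_mult_exp_minus_tendsto_0:
  assumes "c > 0"
  shows "((\<lambda>x::real. x ^ n * poly p x * exp (- (c * x))) \<longlongrightarrow> 0) at_top"
proof (induction p arbitrary: n)
  case (pCons a p)
  have "((\<lambda>x::real. (c * x) ^ n / exp (c * x)) \<longlongrightarrow> 0) at_top"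
  proof (rule filterlim_compose[OF tendsto_power_div_exp_0])
    show "filterlim (\<lambda>x. c * x) at_top at_top"
      using assms by (intro filterlim_tendsto_pos_mult_at_top[OF tendsto_const _ filterlim_ident])
  qed
  then have "((\<lambda>x::real. a / c ^ n * ((c * x) ^ n / exp (c * x))) \<longlongrightarrow> a / c ^ n * 0) at_top"
    by (intro tendsto_intros)
  moreover have "a / c ^ n * ((c * x) ^ n / exp (c * x)) = x ^ n * a * exp (- (c * x))" for x
    using assms by (simp add: power_mult_distrib exp_minus field_simps)
  ultimately have "((\<lambda>x::real. x ^ n * a * exp (- (c * x))) \<longlongrightarrow> 0) at_top" by simp
  from tendsto_add[OF this pCons(2)[of "Suc n"]] show ?case
    by (simp add: algebra_simps)
qed simp

text \<open>In the variable x = 1/t, whose derivative is - x^2, the product rule turns the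
  polynomial p into x^2 (c p - p'); \<open>[:0, 0, 1:]\<close> is x^2.\<close>

lemma flat_has_derivative:
  assumes c: "c > 0"
  shows "(flat p c has_real_derivative flat ([:0, 0, 1:] * (smult c p - pderiv p)) c t) (at t)"
proof -
  let ?q = "[:0, 0, 1:] * (smult c p - pderiv p)"
  consider "t < 0" | "t = 0" | "t > 0" by linarith
  then show ?thesis
  proof cases
    case 1
    have "((\<lambda>_. 0) has_real_derivative 0) (at t)" by simp
    then have "(flat p c has_real_derivative 0) (at t)"
      by (rule DERIV_cong_ev[THEN iffD1, rotated 3])
         (use 1 in \<open>auto simp: flat_def eventually_nhds intro!: exI[of _ "{..<0}"]\<close>)
    then show ?thesis using 1 by (simp add: flat_def)
  next
    case 2
    have l: "((\<lambda>y. (flat p c y - flat p c 0) / (y - 0)) \<longlongrightarrow> 0) (at_left 0)"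
      by (rule tendsto_eventually) (auto simp: flat_def eventually_at_filter)
    have "((\<lambda>y. (flat p c y - flat p c 0) / (y - 0)) \<longlongrightarrow> 0) (at_right 0)"
    proof (rule Lim_transform_eventually)
      show "((\<lambda>y::real. inverse y ^ 1 * poly p (inverse y) * exp (- (c * inverse y))) \<longlongrightarrow> 0) (at_right 0)"
        by (rule filterlim_compose[OF power_mult_exp_minus_tendsto_0[OF c] filterlim_inverse_at_top_right])
      show "\<forall>\<^sub>F y in at_right 0. inverse y ^ 1 * poly p (inverse y) * exp (- (c * inverse y))
          = (flat p c y - flat p c 0) / (y - 0)"
        by (auto simp: flat_def eventually_at_filter field_simps)
    qed
    with l have "((\<lambda>y. (flat p c y - flat p c 0) / (y - 0)) \<longlongrightarrow> 0) (at 0)"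
      by (simp add: filterlim_split_at)
    then show ?thesis using 2 by (simp add: has_field_derivative_iff flat_def)
  next
    case 3
    have "((\<lambda>t. poly p (1 / t) * exp (- (c / t))) has_real_derivative
        poly (pderiv p) (1 / t) * (- 1 / t\<^sup>2) * exp (- (c / t))
        + exp (- (c / t)) * (c / t\<^sup>2) * poly p (1 / t)) (at t)"
      using 3 by (auto intro!: derivative_eq_intros DERIV_chain2[OF poly_DERIV]
          simp: power2_eq_square)
    also have "poly (pderiv p) (1 / t) * (- 1 / t\<^sup>2) * exp (- (c / t))
        + exp (- (c / t)) * (c / t\<^sup>2) * poly p (1 / t) = flat ?q c t"
      using 3 by (simp add: flat_def field_simps power2_eq_square)
    finally have "((\<lambda>t. poly p (1 / t) * exp (- (c / t))) has_real_derivative flat ?q c t) (at t)" .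
    then show ?thesis
      by (rule DERIV_cong_ev[THEN iffD1, rotated 3])
         (use 3 in \<open>auto simp: flat_def eventually_nhds intro!: exI[of _ "{0<..}"]\<close>)
  qed
qed

text \<open>The induction varies \<open>p\<close>, since each differentiation replaces the
  polynomial.\<close>

lemma Ck_on_flat:
  assumes c: "c > 0" and S: "open S"
  shows "Ck_on r S t \<Longrightarrow> Ck_on r S (\<lambda>x. flat p c (t x))"
proof (induction r arbitrary: p)
  case 0
  have "continuous_on UNIV (flat p c)"
    using flat_has_derivative[OF c] by (intro continuous_at_imp_continuous_on) (auto intro: DERIV_isCont)
  then show ?case using 0 continuous_on_compose2[of UNIV "flat p c" S t] by simp
next
  case (Suc r)
  let ?q = "[:0, 0, 1:] * (smult c p - pderiv p)"
  obtain D where D: "\<And>x. x \<in> S \<Longrightarrow> (t has_derivative D x) (at x)"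
    "\<And>b. b \<in> Basis \<Longrightarrow> Ck_on r S (\<lambda>x. D x b)" using Ck_on_SucE[OF Suc.prems] by blast
  show ?case
  proof (rule Ck_on_SucI[OF S, where D="\<lambda>x h. flat ?q c (t x) * D x h"])
    fix x assume x: "x \<in> S"
    have "(flat p c has_derivative (\<lambda>h. flat ?q c (t x) * h)) (at (t x))"
      using flat_has_derivative[OF c] by (simp add: has_field_derivative_def mult_commute_abs)
    from has_derivative_compose[OF D(1)[OF x] this]
    show "((\<lambda>x. flat p c (t x)) has_derivative (\<lambda>h. flat ?q c (t x) * D x h)) (at x)" .
  next
    fix b :: 'a assume "b \<in> Basis"
    then show "Ck_on r S (\<lambda>x. flat ?q c (t x) * D x b)"
      using Suc.IH[OF Ck_on_SucD[OF Suc.prems]] D(2)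
      by (intro Ck_on_bilinear[OF bounded_bilinear_mult S]) auto
  qed
qed

section \<open>Bump functions in a chart\<close>

text \<open>With the constant polynomial 1 the profile is exp(-c/t) for t > 0, which tends to 1 as c
  tends to 0. Shrinking \<open>c\<close> therefore gives the indicator of the open coordinate ball.
  The squared distance keeps the function smooth at the centre.\<close>

definition chart_bump ::
  "('m \<Rightarrow> real^'k) \<Rightarrow> 'm set \<Rightarrow> real^'k::finite \<Rightarrow> real \<Rightarrow> real \<Rightarrow> 'm \<Rightarrow> real" where
  "chart_bump \<phi> U p r c x = (if x \<in> U then flat [:1:] c (r\<^sup>2 - (norm (\<phi> x - p))\<^sup>2) else 0)"

lemma flat_1_bounds: "0 < c \<Longrightarrow> 0 \<le> flat [:1:] c t" "0 < c \<Longrightarrow> flat [:1:] c t \<le> 1"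
  by (auto simp: flat_def)

lemma chart_bump_bounds: "0 < c \<Longrightarrow> 0 \<le> chart_bump \<phi> U p r c x"
  "0 < c \<Longrightarrow> chart_bump \<phi> U p r c x \<le> 1"
  using flat_1_bounds by (auto simp: chart_bump_def)

lemma chart_bump_tendsto:
  assumes "r > 0"
  shows "(\<lambda>n. chart_bump \<phi> U p r (1 / real (Suc n)) x) \<longlonglongrightarrow> indicator {x\<in>U. \<phi> x \<in> ball p r} x"
proof (cases "x \<in> U \<and> \<phi> x \<in> ball p r")
  case True
  let ?t = "r\<^sup>2 - (norm (\<phi> x - p))\<^sup>2"
  have "norm (\<phi> x - p) < r" using True by (simp add: dist_norm norm_minus_commute)
  then have t: "?t > 0" by (simp add: power_strict_mono)
  have "(\<lambda>n. exp (- (1 / real (Suc n) / ?t))) \<longlonglongrightarrow> exp (- (0 / ?t))"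
    using t by (intro tendsto_intros) (use LIMSEQ_inverse_real_of_nat in \<open>simp_all add: inverse_eq_divide\<close>)
  then show ?thesis using True t by (simp add: chart_bump_def flat_def)
next
  case False
  have "chart_bump \<phi> U p r c x = 0" for c
  proof (cases "x \<in> U")
    case True
    then have "r \<le> norm (\<phi> x - p)" using False by (auto simp: dist_norm norm_minus_commute)
    then have "r\<^sup>2 \<le> (norm (\<phi> x - p))\<^sup>2" using assms by (intro power_mono) auto
    then show ?thesis by (simp add: chart_bump_def flat_def)
  qed (simp add: chart_bump_def)
  then show ?thesis using False by simp
qed

lemma smooth_atlasD:
  assumes "smooth_atlas \<A>" "(U, \<phi>) \<in> \<A>"
  shows "open U" "open (\<phi> ` U)" "continuous_on U \<phi>" "continuous_on (\<phi> ` U) (inv_into U \<phi>)"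
    "inj_on \<phi> U" "\<And>x. x \<in> U \<Longrightarrow> inv_into U \<phi> (\<phi> x) = x"
proof -
  have h: "open U" "open (\<phi> ` U)" "homeomorphism U (\<phi> ` U) \<phi> (inv_into U \<phi>)"
    using assms by (auto simp: smooth_atlas_def)
  show "open U" "open (\<phi> ` U)" by (fact h)+
  show "continuous_on U \<phi>" "continuous_on (\<phi> ` U) (inv_into U \<phi>)"
    using h(3) by (auto simp: homeomorphism_def)
  show *: "\<And>x. x \<in> U \<Longrightarrow> inv_into U \<phi> (\<phi> x) = x"
    using h(3) by (auto simp: homeomorphism_def)
  show "inj_on \<phi> U" using * by (rule inj_on_inverseI)
qed

lemma open_chart_image:
  assumes "smooth_atlas \<A>" "(U, \<phi>) \<in> \<A>" "open V"
  shows "open (\<phi> ` (U \<inter> V))"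
proof -
  note S = smooth_atlasD[OF assms(1,2)]
  have "\<phi> ` (U \<inter> V) = {y \<in> \<phi> ` U. inv_into U \<phi> y \<in> V}" by (auto simp: S(6))
  also have "open \<dots>" using continuous_open_preimage[OF S(4,2) assms(3)] by (simp add: vimage_def Int_def)
  finally show ?thesis .
qed

text \<open>Extension by zero is smooth because the closed coordinate ball is compact, hence closed
  in the Hausdorff space: the chart domain and the complement of that ball are open sets that cover
  everything, and on the second one the product is 0.\<close>

lemma smooth_on_mfd_bump:
  fixes f :: "'m::t2_space \<Rightarrow> 'b::real_normed_vector" and \<A> :: "('m, 'k::finite) chart set"
  assumes \<A>: "smooth_atlas \<A>" "(U, \<phi>) \<in> \<A>" and cb: "cball p r \<subseteq> \<phi> ` U" and c: "c > 0" and V: "open V"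
    and r: "r > 0" and f: "smooth_on_mfd \<A> V f"
  shows "smooth_on_mfd \<A> V (\<lambda>x. chart_bump \<phi> U p r c x *\<^sub>R f x)"
  unfolding smooth_on_mfd_def
proof clarify
  fix U' \<phi>' assume c': "(U', \<phi>') \<in> \<A>"
  note S = smooth_atlasD[OF \<A>] and S' = smooth_atlasD[OF \<A>(1) c']
  note opn = open_chart_image[OF \<A>(1) c']
  define K where "K = inv_into U \<phi> ` cball p r"
  have "compact K" unfolding K_def
    by (intro compact_continuous_image continuous_on_subset[OF S(4) cb]) auto
  then have clK: "closed K" by (rule compact_imp_closed)
  have zero: "chart_bump \<phi> U p r c x = 0" if "x \<notin> K" for x
  proof (cases "x \<in> U")
    case True
    have "\<phi> x \<notin> cball p r" using that True S(6) unfolding K_def by (metis imageI)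
    then have "r \<le> norm (\<phi> x - p)" by (auto simp: dist_norm norm_minus_commute)
    then have "r\<^sup>2 \<le> (norm (\<phi> x - p))\<^sup>2" using r by (intro power_mono) auto
    then show ?thesis by (simp add: chart_bump_def flat_def)
  qed (simp add: chart_bump_def)
  have KU: "K \<subseteq> U" unfolding K_def using cb by (auto simp: S(6) dest!: subsetD)
  let ?i = "inv_into U' \<phi>'"
  let ?F = "(\<lambda>x. chart_bump \<phi> U p r c x *\<^sub>R f x) \<circ> ?i"
  show "smooth_on (\<phi>' ` (U' \<inter> V)) ?F"
    unfolding smooth_on_def
  proof
    fix n
    have fV: "Ck_on n (\<phi>' ` (U' \<inter> V)) (f \<circ> ?i)"
      using f c' by (auto simp: smooth_on_mfd_def smooth_on_def)
    let ?S = "\<phi>' ` (U' \<inter> (V \<inter> U))" and ?T = "\<phi>' ` (U' \<inter> (V \<inter> - K))"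
    have oS: "open ?S" and oT: "open ?T" using V S(1) clK by (auto intro!: opn open_Int)
    have "Ck_on n ?T (\<lambda>y. 0::'b)" by (rule Ck_on_const[OF oT])
    then have T: "Ck_on n ?T ?F"
      by (rule Ck_on_cong[OF oT, rotated]) (auto simp: S'(6) zero)
    have "Ck_on n (\<phi>' ` (U' \<inter> U)) (\<phi> \<circ> ?i)"
      using \<A> c' unfolding smooth_atlas_def smooth_on_def by blast
    then have "Ck_on n ?S (\<phi> \<circ> ?i)" by (rule Ck_on_subset) auto
    then have "Ck_on n ?S (\<lambda>y. (\<phi> \<circ> ?i) y + - p)"
      by (rule Ck_on_add[OF oS _ Ck_on_const[OF oS]])
    then have \<phi>S: "Ck_on n ?S (\<lambda>y. \<phi> (?i y) + - p)" by (simp only: o_def)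
    have "Ck_on n ?S (\<lambda>y. r\<^sup>2 + (-1) *\<^sub>R inner (\<phi> (?i y) + - p) (\<phi> (?i y) + - p))"
      by (intro Ck_on_add[OF oS] Ck_on_const[OF oS] Ck_on_bilinear[OF bounded_bilinear_scaleR oS]
          Ck_on_bilinear[OF bounded_bilinear_inner oS] \<phi>S)
    from Ck_on_flat[OF c oS this, of "[:1:]"]
    have "Ck_on n ?S (\<lambda>y. flat [:1:] c (r\<^sup>2 - (norm (\<phi> (?i y) - p))\<^sup>2))"
      by (simp add: power2_norm_eq_inner)
    moreover have "Ck_on n ?S (f \<circ> ?i)" by (rule Ck_on_subset[OF fV]) auto
    ultimately have "Ck_on n ?S (\<lambda>y. flat [:1:] c (r\<^sup>2 - (norm (\<phi> (?i y) - p))\<^sup>2) *\<^sub>R (f \<circ> ?i) y)"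
      by (rule Ck_on_bilinear[OF bounded_bilinear_scaleR oS])
    then have S2: "Ck_on n ?S ?F"
      by (rule Ck_on_cong[OF oS, rotated]) (auto simp: S'(6) chart_bump_def)
    have "\<phi>' ` (U' \<inter> V) = ?S \<union> ?T" using KU by auto
    then show "Ck_on n (\<phi>' ` (U' \<inter> V)) ?F" using Ck_on_Un[OF oS oT S2 T] by simp
  qed
qed

section \<open>Borel trivialization of a Hermitian bundle\<close>

definition cinner :: "complex^'n::finite \<Rightarrow> complex^'n \<Rightarrow> complex" where
  "cinner v w = (\<Sum>i\<in>UNIV. cnj (v $ i) * w $ i)"

lemma cinner_self: "cinner v v = of_real ((norm v)\<^sup>2)"
proof -
  have "cinner v v = (\<Sum>i\<in>UNIV. of_real ((norm (v $ i))\<^sup>2))"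
    unfolding cinner_def by (intro sum.cong refl) (simp only: mult.commute[of "cnj _"] complex_norm_square[symmetric] of_real_power)
  also have "\<dots> = of_real ((norm v)\<^sup>2)"
    by (simp add: norm_vec_def L2_set_def sum_nonneg)
  finally show ?thesis .
qed

lemma cinner_unitary:
  assumes "A \<in> unitary_matrices"
  shows "cinner (A *v v) (A *v w) = cinner v w"
proof -
  have AA: "(\<Sum>i\<in>UNIV. cnj (A $ i $ j) * A $ i $ k) = (if j = k then 1 else 0)" for j k
  proof -
    have "(conj_transpose A ** A) $ j $ k = mat 1 $ j $ k" using assms by (simp add: unitary_matrices_def)
    then show ?thesis by (simp add: matrix_matrix_mult_def conj_transpose_def mat_def)
  qed
  have "cinner (A *v v) (A *v w)
      = (\<Sum>i\<in>UNIV. \<Sum>j\<in>UNIV. \<Sum>k\<in>UNIV. cnj (v $ j) * w $ k * (cnj (A $ i $ j) * A $ i $ k))"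
    by (simp add: cinner_def matrix_vector_mult_def sum_product) (simp add: mult_ac)
  also have "\<dots> = (\<Sum>j\<in>UNIV. \<Sum>i\<in>UNIV. \<Sum>k\<in>UNIV. cnj (v $ j) * w $ k * (cnj (A $ i $ j) * A $ i $ k))"
    by (rule sum.swap)
  also have "\<dots> = (\<Sum>j\<in>UNIV. \<Sum>k\<in>UNIV. \<Sum>i\<in>UNIV. cnj (v $ j) * w $ k * (cnj (A $ i $ j) * A $ i $ k))"
    by (rule sum.cong[OF refl], rule sum.swap)
  also have "\<dots> = (\<Sum>j\<in>UNIV. \<Sum>k\<in>UNIV. cnj (v $ j) * w $ k * (if j = k then 1 else 0))"
    by (simp add: sum_distrib_left[symmetric] AA)
  also have "\<dots> = cinner v w" by (simp add: cinner_def if_distrib[of "\<lambda>x. _ * x"] cong: if_cong)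
  finally show ?thesis .
qed

lemma norm_unitary:
  assumes "A \<in> unitary_matrices"
  shows "norm (A *v v) = norm v"
proof -
  have "complex_of_real ((norm (A *v v))\<^sup>2) = complex_of_real ((norm v)\<^sup>2)"
    by (simp only: cinner_self[symmetric] cinner_unitary[OF assms])
  then have "(norm (A *v v))\<^sup>2 = (norm v)\<^sup>2" by (simp only: of_real_eq_iff)
  then show ?thesis by simp
qed

section \<open>Countable covers and Borel pieces\<close>

text \<open>Finitely many members cover each of the countably many compact sets. Here
  \<sigma>-compactness plays the part of second countability.\<close>

lemma sigma_compact_countable_subcover:
  assumes "sigma_compact (UNIV :: 'm::topological_space set)"
    and opn: "\<And>V. V \<in> \<V> \<Longrightarrow> open V" and cov: "\<Union>\<V> = (UNIV :: 'm set)"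
  obtains \<V>' where "countable \<V>'" "\<V>' \<subseteq> \<V>" "\<Union>\<V>' = UNIV"
proof -
  obtain K :: "nat \<Rightarrow> 'm set" where K: "\<And>i. compact (K i)" "(\<Union>i. K i) = UNIV"
    using assms(1) unfolding sigma_compact_def by blast
  have "\<exists>F. finite F \<and> F \<subseteq> \<V> \<and> K i \<subseteq> \<Union>F" for i
    using compactE[OF K(1)[of i], of \<V>] cov opn by (metis top_greatest)
  then obtain F where F: "\<And>i. finite (F i) \<and> F i \<subseteq> \<V> \<and> K i \<subseteq> \<Union>(F i)" by metis
  show thesis
  proof (rule that)
    show "countable (\<Union>i. F i)" using F by (auto intro: countable_finite)
    show "(\<Union>i. F i) \<subseteq> \<V>" using F by auto
    show "\<Union>(\<Union>i. F i) = UNIV"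
    proof -
      have "x \<in> \<Union>(\<Union>i. F i)" for x
      proof -
        obtain i where i: "x \<in> K i" using K(2) by blast
        have "K i \<subseteq> \<Union>(F i)" using F by blast
        with i obtain U where "U \<in> F i" "x \<in> U" by auto
        then show ?thesis by auto
      qed
      then show ?thesis by blast
    qed
  qed
qed

text \<open>The least index turns an open cover into a Borel partition with pieces
  \<open>V i - (\<Union>j<i. V j)\<close>, on which local choices can be glued measurably.\<close>

lemma borel_least_index:
  fixes V :: "nat \<Rightarrow> 'm::topological_space set"
  assumes "\<And>i. open (V i)" "(\<Union>i. V i) = UNIV"
  shows "{x. (LEAST i. x \<in> V i) = i} \<in> sets borel"
proof -
  let ?idx = "\<lambda>x. LEAST i. x \<in> V i"
  have idx: "x \<in> V (?idx x)" for x
  proof -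
    have "\<exists>i. x \<in> V i" using assms(2) by auto
    then show ?thesis by (rule LeastI_ex)
  qed
  have idx_le: "?idx x \<le> j" if "x \<in> V j" for x j using that by (rule Least_le)
  have "{x. ?idx x = i} = V i - (\<Union>j<i. V j)"
  proof (intro set_eqI iffI)
    fix x assume "x \<in> {x. ?idx x = i}"
    then have i: "?idx x = i" by simp
    have "x \<notin> V j" if "j < i" for j using idx_le[of x j] that i by linarith
    then show "x \<in> V i - (\<Union>j<i. V j)" using idx[of x] i by blast
  next
    fix x assume x: "x \<in> V i - (\<Union>j<i. V j)"
    then have "?idx x \<le> i" by (intro idx_le) simp
    moreover have "\<not> ?idx x < i" using x idx[of x] by blast
    ultimately show "x \<in> {x. ?idx x = i}" by simp
  qed
  also have "\<dots> \<in> sets borel" using assms(1) by auto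
  finally show ?thesis .
qed

text \<open>A countable basis of the second factor is enough: to each basic set belongs the largest
  open set in the first factor whose product with it stays inside \<open>Q\<close>.\<close>

lemma countable_open_times_basis:
  fixes Q :: "('a::topological_space \<times> 'b::second_countable_topology) set"
  assumes "open Q"
  obtains A :: "nat \<Rightarrow> 'a set" and B :: "nat \<Rightarrow> 'b set"
  where "\<And>n. open (A n)" "\<And>n. open (B n)" "Q = (\<Union>n. A n \<times> B n)"
proof -
  obtain \<B> :: "'b set set" where \<B>: "countable \<B>" "topological_basis \<B>"
    using ex_countable_basis by blast
  have oB: "open b" if "b \<in> \<B>" for b using \<B>(2) that by (rule topological_basis_open)
  \<comment> \<open>The empty set is added so that the set to be enumerated is nonempty.\<close>
  define B where "B = from_nat_into (insert {} \<B>)"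
  define A where "A n = \<Union>{U. open U \<and> U \<times> B n \<subseteq> Q}" for n
  have rB: "range B = insert {} \<B>" unfolding B_def using \<B>(1) by (intro range_from_nat_into) auto
  have "Q \<subseteq> (\<Union>n. A n \<times> B n)"
  proof
    fix z assume "z \<in> Q"
    then obtain U V where UV: "open U" "open V" "z \<in> U \<times> V" "U \<times> V \<subseteq> Q"
      using open_prod_elim[OF assms] by metis
    have "snd z \<in> V" using UV(3) by auto
    then obtain b where b: "b \<in> \<B>" "snd z \<in> b" "b \<subseteq> V"
      by (rule topological_basisE[OF \<B>(2) UV(2)])
    obtain n where n: "B n = b" using rB b(1) by (metis insertCI rangeE)
    have "U \<times> B n \<subseteq> Q" using UV(4) b(3) n by auto
    then have "fst z \<in> A n" unfolding A_def using UV(1,3) by auto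
    then have "z \<in> A n \<times> B n" using b(2) n by (simp add: mem_Times_iff)
    then show "z \<in> (\<Union>n. A n \<times> B n)" by blast
  qed
  moreover have "(\<Union>n. A n \<times> B n) \<subseteq> Q" unfolding A_def by blast
  ultimately have "Q = (\<Union>n. A n \<times> B n)" by blast
  moreover have "open (A n)" for n unfolding A_def by auto
  moreover have "open (B n)" for n
  proof -
    have "B n \<in> insert {} \<B>" using rB by blast
    then show ?thesis using oB by auto
  qed
  ultimately show thesis using that by blast
qed

section \<open>The global Borel trivialization\<close>

locale hermitian_bundle =
  fixes \<A> :: "('m::t2_space, 'k::finite) chart set"
    and \<mu> :: "'m measure"
    and G :: "(complex^'n::finite^'n) set"
    and E :: "('e::topological_space, 'm, 'n) vector_bundle"
  assumes sigma: "sigma_compact (UNIV :: 'm set)"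
    and atlas: "smooth_atlas \<A>"
    and ll: "locally_lebesgue \<A> \<mu>"
    and G: "closed_unitary_subgroup G"
    and gbun: "G_bundle \<A> G E"
begin

lemma sets_mu [simp, measurable_cong]: "sets \<mu> = sets borel"
  using ll by (simp add: locally_lebesgue_def)

lemma space_mu [simp]: "space \<mu> = UNIV"
  using sets_eq_imp_space_eq[OF sets_mu] by simp

lemmas gbun_conjuncts = gbun[unfolded G_bundle_def, THEN conjunct1]
  gbun[unfolded G_bundle_def, THEN conjunct2, THEN conjunct1]
  gbun[unfolded G_bundle_def, THEN conjunct2, THEN conjunct2, THEN conjunct1]
  gbun[unfolded G_bundle_def, THEN conjunct2, THEN conjunct2, THEN conjunct2, THEN conjunct1]
  gbun[unfolded G_bundle_def, THEN conjunct2, THEN conjunct2, THEN conjunct2, THEN conjunct2, THEN conjunct1]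
  gbun[unfolded G_bundle_def, THEN conjunct2, THEN conjunct2, THEN conjunct2, THEN conjunct2, THEN conjunct2]

lemma triv_add:
  assumes "(V, \<psi>) \<in> trivs E" "proj E e \<in> V" "proj E e = proj E e'"
  shows "\<psi> (fibre_add E e e') = \<psi> e + \<psi> e'"
  using gbun_conjuncts(5) assms by blast

lemma triv_scale:
  assumes "(V, \<psi>) \<in> trivs E" "proj E e \<in> V"
  shows "\<psi> (fibre_scale E z e) = z *s \<psi> e"
  using gbun_conjuncts(5) assms by blast

lemma triv_open: "(V, \<psi>) \<in> trivs E \<Longrightarrow> open V"
  using gbun_conjuncts(5) by blast

lemma triv_homeomorphism:
  assumes "(V, \<psi>) \<in> trivs E"
  obtains g where "homeomorphism (proj E -` V) (V \<times> UNIV) (\<lambda>e. (proj E e, \<psi> e)) g"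
proof -
  have "\<exists>g. homeomorphism (proj E -` V) (V \<times> UNIV) (\<lambda>e. (proj E e, \<psi> e)) g"
    using bspec[OF gbun_conjuncts(5) assms] by simp
  then show thesis using that by blast
qed

lemma proj_add: "proj E e = proj E e' \<Longrightarrow> proj E (fibre_add E e e') = proj E e"
  using gbun_conjuncts(3) by blast

lemma proj_scale: "proj E (fibre_scale E z e) = proj E e"
  using gbun_conjuncts(4) by blast

lemma proj_continuous: "continuous_on UNIV (proj E)"
  by (rule gbun_conjuncts(2))

lemma triv_transition:
  assumes "(V, \<psi>) \<in> trivs E" "(V', \<psi>') \<in> trivs E" "x \<in> V" "x \<in> V'"
  obtains A where "A \<in> unitary_matrices" "\<And>e. proj E e = x \<Longrightarrow> \<psi>' e = A *v \<psi> e"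
proof -
  obtain g where "\<forall>x\<in>V \<inter> V'. g x \<in> G" "\<forall>e. proj E e \<in> V \<inter> V' \<longrightarrow> \<psi>' e = g (proj E e) *v \<psi> e"
    using bspec[OF bspec[OF gbun_conjuncts(6) assms(1), simplified] assms(2)] by auto
  moreover have "G \<subseteq> unitary_matrices" using G by (simp add: closed_unitary_subgroup_def)
  ultimately show thesis using that[of "g x"] assms(3,4) by blast
qed

lemma triv_at_mem: "\<exists>V. (V, triv_at E x) \<in> trivs E \<and> x \<in> V"
proof -
  have "x \<in> (\<Union>(V, \<psi>)\<in>trivs E. V)" using gbun_conjuncts(1) by blast
  then have "\<exists>\<psi> V. (V, \<psi>) \<in> trivs E \<and> x \<in> V" by auto
  then show ?thesis unfolding triv_at_def by (rule someI_ex)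
qed

text \<open>
  A countable trivializing cover, made disjoint, gives a trivialization of the whole bundle that is
  only Borel; it turns \<open>L2_sections\<close> into a space of functions with values in \<open>complex^'n\<close>.
\<close>

definition cover :: "nat \<Rightarrow> 'm set \<times> ('e \<Rightarrow> complex^'n)" where
  "cover = (SOME c. range c \<subseteq> trivs E \<and> (\<Union>i. fst (c i)) = UNIV)"

lemma cover: "cover i \<in> trivs E" "(\<Union>i. fst (cover i)) = UNIV"
proof -
  have opn: "open V" if "V \<in> fst ` trivs E" for V using that triv_open by auto
  have cov: "\<Union>(fst ` trivs E) = UNIV"
    using gbun_conjuncts(1) by (auto simp: case_prod_beta)
  obtain \<V> where \<V>: "countable \<V>" "\<V> \<subseteq> fst ` trivs E" "\<Union>\<V> = UNIV"
    using sigma_compact_countable_subcover[OF sigma opn cov] by blast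
  then have "\<V> \<noteq> {}" by auto
  have ran: "range (from_nat_into \<V>) = \<V>" using \<V>(1) \<open>\<V> \<noteq> {}\<close> by (rule range_from_nat_into[rotated])
  have "\<forall>i. \<exists>t. t \<in> trivs E \<and> fst t = from_nat_into \<V> i"
  proof
    fix i
    have "from_nat_into \<V> i \<in> fst ` trivs E" using ran \<V>(2) by blast
    then show "\<exists>t. t \<in> trivs E \<and> fst t = from_nat_into \<V> i" by auto
  qed
  then obtain c where c: "\<And>i. c i \<in> trivs E \<and> fst (c i) = from_nat_into \<V> i" by metis
  then have "range c \<subseteq> trivs E \<and> (\<Union>i. fst (c i)) = UNIV" using ran \<V>(3) by auto
  then have "range cover \<subseteq> trivs E \<and> (\<Union>i. fst (cover i)) = UNIV"
    using someI[of "\<lambda>c. range c \<subseteq> trivs E \<and> (\<Union>i. fst (c i)) = UNIV" c]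
    unfolding cover_def by blast
  then show "cover i \<in> trivs E" "(\<Union>i. fst (cover i)) = UNIV" by auto
qed

definition idx :: "'m \<Rightarrow> nat" where "idx x = (LEAST i. x \<in> fst (cover i))"

lemma idx: "x \<in> fst (cover (idx x))"
proof -
  have "\<exists>i. x \<in> fst (cover i)" using cover(2) by auto
  then show ?thesis unfolding idx_def by (rule LeastI_ex)
qed

lemma cover_homeomorphism:
  obtains g where "homeomorphism (proj E -` fst (cover i)) (fst (cover i) \<times> UNIV)
    (\<lambda>e. (proj E e, snd (cover i) e)) g"
proof (rule triv_homeomorphism)
  show "(fst (cover i), snd (cover i)) \<in> trivs E" using cover(1) by simp
qed

lemma open_cover: "open (fst (cover i))"
  using triv_open[of "fst (cover i)" "snd (cover i)"] cover(1)[of i] by simp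

lemma idx_measurable [measurable]: "{x. idx x = i} \<in> sets borel"
  unfolding idx_def by (rule borel_least_index[OF open_cover cover(2)])

definition coord :: "'e \<Rightarrow> complex^'n" where
  "coord e = snd (cover (idx (proj E e))) e"

text \<open>Every local trivialization differs from \<open>coord\<close> by a unitary matrix at each
  point, so fibre norms and inner products may be computed in \<open>coord\<close>.\<close>

lemma triv_coord: 
  assumes "(V, \<psi>) \<in> trivs E" "x \<in> V"
  obtains A where "A \<in> unitary_matrices" "\<And>e. proj E e = x \<Longrightarrow> \<psi> e = A *v coord e"
proof -
  obtain A where "A \<in> unitary_matrices" "\<And>e. proj E e = x \<Longrightarrow> \<psi> e = A *v snd (cover (idx x)) e"
    using triv_transition[of "fst (cover (idx x))" "snd (cover (idx x))" V \<psi> x] assms idx cover(1)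
    by (metis prod.collapse)
  then show thesis using that[of A] by (simp add: coord_def)
qed

lemma coord_add: "proj E e = proj E e' \<Longrightarrow> coord (fibre_add E e e') = coord e + coord e'"
  unfolding coord_def using idx cover(1) by (metis prod.collapse proj_add triv_add)

lemma coord_scale: "coord (fibre_scale E z e) = z *s coord e"
  unfolding coord_def proj_scale using idx cover(1) by (metis prod.collapse triv_scale)

lemma fibre_norm_coord: "fibre_norm E e = norm (coord e)"
proof -
  obtain V where V: "(V, triv_at E (proj E e)) \<in> trivs E" "proj E e \<in> V" using triv_at_mem by blast
  obtain A where "A \<in> unitary_matrices" "triv_at E (proj E e) e = A *v coord e"
    using triv_coord[OF V] by metis
  then show ?thesis by (simp add: fibre_norm_def norm_unitary)
qed

lemma fibre_inner_coord:
  assumes "proj E e = proj E e'"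
  shows "fibre_inner E e e' = cinner (coord e) (coord e')"
proof -
  obtain V where V: "(V, triv_at E (proj E e)) \<in> trivs E" "proj E e \<in> V" using triv_at_mem by blast
  obtain A where "A \<in> unitary_matrices" "triv_at E (proj E e) e = A *v coord e"
    "triv_at E (proj E e) e' = A *v coord e'"
    using triv_coord[OF V] assms by metis
  then show ?thesis
    using cinner_unitary[of A "coord e" "coord e'"] by (simp add: fibre_inner_def cinner_def)
qed

lemma coord_inj:
  assumes "proj E e = proj E e'" "coord e = coord e'"
  shows "e = e'"
proof -
  let ?x = "proj E e"
  obtain g where h: "homeomorphism (proj E -` fst (cover (idx ?x))) (fst (cover (idx ?x)) \<times> UNIV)
      (\<lambda>e. (proj E e, snd (cover (idx ?x)) e)) g"
    by (rule cover_homeomorphism)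
  have g: "g (proj E d, snd (cover (idx ?x)) d) = d" if "proj E d = ?x" for d
    using homeomorphism_apply1[OF h, of d] that idx[of ?x] by simp
  have "g (proj E e, coord e) = e" using g[of e] by (simp add: coord_def)
  moreover have "g (proj E e', coord e') = e'" using g[of e'] by (simp add: coord_def assms(1))
  ultimately show ?thesis using assms by metis
qed

lemma coord_measurable:
  assumes c: "c \<in> sections E" "c \<in> borel_measurable \<mu>"
  shows "(\<lambda>x. coord (c x)) \<in> borel_measurable \<mu>"
proof (rule borel_measurableI)
  fix S :: "(complex^'n) set" assume S: "open S"
  have pc: "proj E (c x) = x" for x using c(1) by (simp add: sections_def)
  define O' where "O' i = {e \<in> proj E -` fst (cover i). snd (cover i) e \<in> S}" for i
  have oO: "open (O' i)" for i
  proof -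
    let ?V = "fst (cover i)" and ?\<psi> = "snd (cover i)"
    obtain g where "homeomorphism (proj E -` ?V) (?V \<times> UNIV) (\<lambda>e. (proj E e, ?\<psi> e)) g"
      by (rule cover_homeomorphism)
    then have "continuous_on (proj E -` ?V) (\<lambda>e. (proj E e, ?\<psi> e))" by (simp add: homeomorphism_def)
    then have "continuous_on (proj E -` ?V) (\<lambda>e. snd (proj E e, ?\<psi> e))" by (rule continuous_on_snd)
    moreover have "open (proj E -` ?V)"
      using proj_continuous open_cover by (auto simp: continuous_on_open_vimage)
    ultimately have "open (proj E -` ?V \<inter> ?\<psi> -` S)"
      using S by (intro continuous_open_preimage) auto
    then show ?thesis by (simp add: O'_def vimage_def Int_def)
  qed
  have "(\<lambda>x. coord (c x)) -` S \<inter> space \<mu> = (\<Union>i. {x. idx x = i} \<inter> (c -` O' i \<inter> space \<mu>))"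
    using idx by (auto simp: coord_def pc O'_def)
  also have "\<dots> \<in> sets \<mu>"
  proof -
    have "c -` O' i \<inter> space \<mu> \<in> sets \<mu>" for i using measurable_sets[OF c(2) borel_open[OF oO]] .
    then show ?thesis using idx_measurable by auto
  qed
  finally show "(\<lambda>x. coord (c x)) -` S \<inter> space \<mu> \<in> sets \<mu>" .
qed

text \<open>Over one piece of the partition an open set of the total space corresponds to an open
  subset of V \<times> \<complex>^n, hence to countably many rectangles; its preimage needs only
  open sets of the base and measurable coordinates.\<close>

lemma section_measurable:
  assumes c: "c \<in> sections E" "(\<lambda>x. coord (c x)) \<in> borel_measurable \<mu>"
  shows "c \<in> borel_measurable \<mu>"
proof (rule borel_measurableI)
  fix S :: "'e set" assume S: "open S"
  have pc: "proj E (c x) = x" for x using c(1) by (simp add: sections_def)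
  have piece: "{x. idx x = i} \<inter> c -` S \<in> sets \<mu>" for i
  proof -
    let ?V = "fst (cover i)" and ?\<psi> = "snd (cover i)"
    obtain g where g: "homeomorphism (proj E -` ?V) (?V \<times> UNIV) (\<lambda>e. (proj E e, ?\<psi> e)) g"
      by (rule cover_homeomorphism)
    have "open ((?V \<times> UNIV) \<inter> g -` S)"
      using g S open_cover[of i] by (intro continuous_open_preimage) (auto simp: homeomorphism_def open_Times)
    then obtain A B where AB: "\<And>n::nat. open (A n)" "\<And>n. open (B n)"
      and Q: "(?V \<times> UNIV) \<inter> g -` S = (\<Union>n. A n \<times> B n)"
      by (rule countable_open_times_basis) blast
    have "c x \<in> S \<longleftrightarrow> (x, coord (c x)) \<in> (?V \<times> UNIV) \<inter> g -` S" if "idx x = i" for x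
    proof -
      have x: "x \<in> ?V" using idx[of x] that by simp
      then have "g (proj E (c x), ?\<psi> (c x)) = c x"
        using homeomorphism_apply1[OF g, of "c x"] by (simp add: pc)
      then have "g (x, coord (c x)) = c x" using that by (simp add: pc coord_def)
      then show ?thesis using x by simp
    qed
    then have "{x. idx x = i} \<inter> c -` S
        = {x. idx x = i} \<inter> (\<Union>n. A n \<inter> ((\<lambda>x. coord (c x)) -` B n \<inter> space \<mu>))"
      unfolding Q by auto
    also have "\<dots> \<in> sets \<mu>"
    proof -
      have "(\<lambda>x. coord (c x)) -` B n \<inter> space \<mu> \<in> sets \<mu>" for n
        using measurable_sets[OF c(2) borel_open[OF AB(2)]] .
      moreover have "A n \<in> sets \<mu>" for n using AB by simp
      ultimately show ?thesis using idx_measurable by (intro sets.Int sets.countable_UN) auto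
    qed
    finally show ?thesis .
  qed
  have "c -` S \<inter> space \<mu> = (\<Union>i. {x. idx x = i} \<inter> c -` S)" by auto
  also have "\<dots> \<in> sets \<mu>" using piece by blast
  finally show "c -` S \<inter> space \<mu> \<in> sets \<mu>" .
qed

end

section \<open>Multiplication operators on square-integrable sections\<close>

lemma norm_vector_scalar_mult: "norm (z *s v) = cmod z * norm (v :: complex^'n::finite)"
proof -
  have "cinner (z *s v) (z *s v) = of_real ((cmod z)\<^sup>2) * cinner v v"
    by (simp add: cinner_def sum_distrib_left complex_norm_square mult_ac flip: of_real_power)
  then have "complex_of_real ((norm (z *s v))\<^sup>2) = complex_of_real ((cmod z * norm v)\<^sup>2)"
    by (simp only: cinner_self of_real_mult[symmetric] power_mult_distrib)
  then have "(norm (z *s v))\<^sup>2 = (cmod z * norm v)\<^sup>2" by (simp only: of_real_eq_iff)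
  then show ?thesis by simp
qed

lemma bounded_bilinear_vector_scalar_mult:
  "bounded_bilinear (\<lambda>(z::complex) (v::complex^'n::finite). z *s v)"
proof
  show "\<exists>K. \<forall>(a::complex) (b::complex^'n). norm (a *s b) \<le> norm a * norm b * K"
    by (rule exI[of _ 1]) (simp add: norm_vector_scalar_mult)
qed (simp_all add: vec_eq_iff algebra_simps)

lemma measurable_vector_scalar_mult [measurable (raw)]:
  assumes "u \<in> borel_measurable M" "v \<in> borel_measurable M"
  shows "(\<lambda>x. u x *s (v x :: complex^'n::finite)) \<in> borel_measurable M"
  using assms
  by (rule borel_measurable_continuous_Pair)
     (intro bounded_bilinear.continuous_on[OF bounded_bilinear_vector_scalar_mult] continuous_intros)

lemma smooth_on_mfd_cong:
  assumes "smooth_atlas \<A>" "open V" "\<And>x. x \<in> V \<Longrightarrow> f x = g x" "smooth_on_mfd \<A> V f"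
  shows "smooth_on_mfd \<A> V g"
  unfolding smooth_on_mfd_def smooth_on_def
proof clarify
  fix U \<phi> r assume c: "(U, \<phi>) \<in> \<A>"
  have "Ck_on r (\<phi> ` (U \<inter> V)) (f \<circ> inv_into U \<phi>)"
    using assms(4) c by (auto simp: smooth_on_mfd_def smooth_on_def)
  then show "Ck_on r (\<phi> ` (U \<inter> V)) (g \<circ> inv_into U \<phi>)"
    by (rule Ck_on_cong[OF open_chart_image[OF assms(1) c assms(2)], rotated])
       (auto simp: smooth_atlasD(6)[OF assms(1) c] assms(3))
qed

lemma smooth_on_mfdD:
  assumes "smooth_on_mfd \<A> V f" "(U, \<phi>) \<in> \<A>"
  shows "Ck_on r (\<phi> ` (U \<inter> V)) (\<lambda>y. f (inv_into U \<phi> y))"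
proof -
  have "Ck_on r (\<phi> ` (U \<inter> V)) (f \<circ> inv_into U \<phi>)"
    using assms unfolding smooth_on_mfd_def smooth_on_def by blast
  then show ?thesis by (simp only: o_def)
qed

lemma smooth_on_mfd_add:
  assumes "smooth_atlas \<A>" "open V" "smooth_on_mfd \<A> V f" "smooth_on_mfd \<A> V g"
  shows "smooth_on_mfd \<A> V (\<lambda>x. f x + g x)"
  unfolding smooth_on_mfd_def smooth_on_def
proof clarify
  fix U \<phi> r assume c: "(U, \<phi>) \<in> \<A>"
  have "Ck_on r (\<phi> ` (U \<inter> V)) (\<lambda>y. f (inv_into U \<phi> y) + g (inv_into U \<phi> y))"
    by (intro Ck_on_add open_chart_image[OF assms(1) c assms(2)] smooth_on_mfdD[OF _ c] assms)
  then show "Ck_on r (\<phi> ` (U \<inter> V)) ((\<lambda>x. f x + g x) \<circ> inv_into U \<phi>)" by (simp add: o_def)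
qed

lemma smooth_on_mfd_cmult:
  fixes f :: "'m::t2_space \<Rightarrow> complex^'n::finite"
  assumes "smooth_atlas \<A>" "open V" "smooth_on_mfd \<A> V f"
  shows "smooth_on_mfd \<A> V (\<lambda>x. z *s f x)"
  unfolding smooth_on_mfd_def smooth_on_def
proof clarify
  fix U \<phi> r assume c: "(U, \<phi>) \<in> \<A>"
  note o = open_chart_image[OF assms(1) c assms(2)]
  have "Ck_on r (\<phi> ` (U \<inter> V)) (\<lambda>y. z *s f (inv_into U \<phi> y))"
    by (intro Ck_on_bilinear[OF bounded_bilinear_vector_scalar_mult] o Ck_on_const
        smooth_on_mfdD[OF assms(3) c])
  then show "Ck_on r (\<phi> ` (U \<inter> V)) ((\<lambda>x. z *s f x) \<circ> inv_into U \<phi>)" by (simp add: o_def)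
qed

lemma smooth_on_mfd_continuous:
  assumes "smooth_atlas \<A>" "open V" "smooth_on_mfd \<A> V f"
  shows "continuous_on V f"
proof (rule continuous_at_imp_continuous_on, rule ballI)
  fix x assume x: "x \<in> V"
  have "x \<in> (\<Union>(U, \<phi>)\<in>\<A>. U)" using assms(1) by (simp add: smooth_atlas_def)
  then obtain U \<phi> where c: "(U, \<phi>) \<in> \<A>" "x \<in> U" by auto
  note S = smooth_atlasD[OF assms(1) c(1)]
  have "continuous_on (\<phi> ` (U \<inter> V)) (\<lambda>y. f (inv_into U \<phi> y))"
    using smooth_on_mfdD[OF assms(3) c(1), of 0] by simp
  from continuous_on_compose[OF continuous_on_subset[OF S(3) Int_lower1] this]
  have "continuous_on (U \<inter> V) (\<lambda>x. f (inv_into U \<phi> (\<phi> x)))" by (simp only: o_def)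
  then have "continuous_on (U \<inter> V) f"
    by (rule continuous_on_eq) (auto simp: S(6))
  moreover have "open (U \<inter> V)" "x \<in> U \<inter> V" using S(1) assms(2) x c by auto
  ultimately show "isCont f x" using continuous_on_eq_continuous_at by blast
qed

section \<open>The closure of smooth sections, in coordinates\<close>

context hermitian_bundle
begin

abbreviation "L2S \<equiv> L2_sections \<A> \<mu> E"
abbreviation "Sm \<equiv> smooth_sections \<A> E"
abbreviation "N2 \<equiv> norm2_sq \<mu> E"

text \<open>The squared distance, which avoids roots of extended reals; the price is a factor 2 in
  the triangle inequality.\<close>

definition dist2 :: "('m \<Rightarrow> 'e) \<Rightarrow> ('m \<Rightarrow> 'e) \<Rightarrow> ennreal" where
  "dist2 c d = (\<integral>\<^sup>+x. ennreal ((norm (coord (c x) - coord (d x)))\<^sup>2) \<partial>\<mu>)"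

lemma proj_section: "c \<in> sections E \<Longrightarrow> proj E (c x) = x"
  by (simp add: sections_def)

lemma sec_add_sections: "c \<in> sections E \<Longrightarrow> d \<in> sections E \<Longrightarrow> sec_add E c d \<in> sections E"
  by (simp add: sections_def sec_add_def proj_add)

lemma sec_mult_sections: "c \<in> sections E \<Longrightarrow> sec_mult E u c \<in> sections E"
  by (simp add: sections_def sec_mult_def proj_scale)

lemma coord_sec_add:
  "c \<in> sections E \<Longrightarrow> d \<in> sections E \<Longrightarrow> coord (sec_add E c d x) = coord (c x) + coord (d x)"
  by (simp add: sec_add_def coord_add proj_section)

lemma coord_sec_mult: "coord (sec_mult E u c x) = u x *s coord (c x)"
  by (simp add: sec_mult_def coord_scale)

lemma section_eqI:
  "c \<in> sections E \<Longrightarrow> d \<in> sections E \<Longrightarrow> coord (c x) = coord (d x) \<Longrightarrow> c x = d x"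
  by (rule coord_inj) (simp_all add: proj_section)

lemma N2_coord: "N2 c = (\<integral>\<^sup>+x. ennreal ((norm (coord (c x)))\<^sup>2) \<partial>\<mu>)"
  by (simp add: norm2_sq_def fibre_norm_coord)

lemma N2_diff:
  assumes "c \<in> sections E" "s \<in> sections E"
  shows "N2 (sec_add E c (sec_mult E (\<lambda>_. - 1) s)) = dist2 c s"
proof -
  have "coord (sec_add E c (sec_mult E (\<lambda>_. - 1) s) x) = coord (c x) - coord (s x)" for x
    by (simp add: coord_sec_add assms sec_mult_sections coord_sec_mult vec_eq_iff)
  then show ?thesis by (simp add: N2_coord dist2_def)
qed

lemma Sm_sections: "s \<in> Sm \<Longrightarrow> s \<in> sections E"
  by (simp add: smooth_sections_def)

lemma Sm_smooth:
  assumes "s \<in> Sm" "(V, \<psi>) \<in> trivs E"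
  shows "smooth_on_mfd \<A> V (\<lambda>x. \<psi> (s x))"
proof -
  have "smooth_on_mfd \<A> V (\<psi> \<circ> s)" using assms unfolding smooth_sections_def by blast
  then show ?thesis by (simp only: o_def)
qed

text \<open>A smooth section is continuous in each local trivialization, but \<open>coord\<close>
  jumps between trivializations, so continuity holds only piecewise on a Borel partition.\<close>

lemma Sm_measurable:
  assumes s: "s \<in> Sm"
  shows "(\<lambda>x. coord (s x)) \<in> borel_measurable \<mu>"
proof (rule borel_measurableI)
  fix S :: "(complex^'n) set" assume S: "open S"
  have piece: "open (fst (cover i) \<inter> (\<lambda>x. snd (cover i) (s x)) -` S)" for i
  proof -
    have "smooth_on_mfd \<A> (fst (cover i)) (snd (cover i) \<circ> s)"
      using s cover(1)[of i] by (auto simp: smooth_sections_def case_prod_beta)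
    from smooth_on_mfd_continuous[OF atlas open_cover this]
    have "continuous_on (fst (cover i)) (\<lambda>x. snd (cover i) (s x))" by (simp add: o_def)
    then show ?thesis using S open_cover by (intro continuous_open_preimage)
  qed
  have "(\<lambda>x. coord (s x)) -` S \<inter> space \<mu>
      = (\<Union>i. {x. idx x = i} \<inter> (fst (cover i) \<inter> (\<lambda>x. snd (cover i) (s x)) -` S))"
    using idx by (auto simp: coord_def proj_section[OF Sm_sections[OF s]])
  also have "\<dots> \<in> sets \<mu>"
    using idx_measurable borel_open[OF piece] by auto
  finally show "(\<lambda>x. coord (s x)) -` S \<inter> space \<mu> \<in> sets \<mu>" .
qed

lemma ennreal_pos_ge_real:
  assumes "(\<epsilon>::ennreal) > 0"
  obtains e :: real where "e > 0" "ennreal e \<le> \<epsilon>"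
proof (cases \<epsilon>)
  case (real r)
  then show thesis using assms that[of r] by (simp add: ennreal_less_zero_iff)
next
  case top
  then show thesis using that[of 1] by simp
qed

text \<open>Trades values in the total space for coordinates and extended-real tolerances for real
  ones.\<close>

lemma L2S_iff:
  "c \<in> L2S \<longleftrightarrow> c \<in> sections E \<and> (\<lambda>x. coord (c x)) \<in> borel_measurable \<mu> \<and> N2 c < \<infinity> \<and>
    (\<forall>e>0. \<exists>s\<in>Sm. N2 s < \<infinity> \<and> dist2 c s < ennreal e)"
proof -
  have "(\<forall>\<epsilon>>0. \<exists>s\<in>Sm. N2 s < \<infinity> \<and> N2 (sec_add E c (sec_mult E (\<lambda>_. - 1) s)) < \<epsilon>)
    \<longleftrightarrow> (\<forall>e>0. \<exists>s\<in>Sm. N2 s < \<infinity> \<and> dist2 c s < ennreal e)" (is "?l \<longleftrightarrow> ?r") if c: "c \<in> sections E"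
  proof
    assume l: ?l
    show ?r
    proof (intro allI impI)
      fix e :: real assume "e > 0"
      then have "ennreal e > 0" by simp
      with l obtain s where "s \<in> Sm" "N2 s < \<infinity>" "N2 (sec_add E c (sec_mult E (\<lambda>_. - 1) s)) < ennreal e"
        by blast
      then show "\<exists>s\<in>Sm. N2 s < \<infinity> \<and> dist2 c s < ennreal e" using N2_diff[OF c Sm_sections] by auto
    qed
  next
    assume r: ?r
    show ?l
    proof (intro allI impI)
      fix \<epsilon> :: ennreal assume "\<epsilon> > 0"
      then obtain e where e: "e > 0" "ennreal e \<le> \<epsilon>" by (rule ennreal_pos_ge_real)
      then obtain s where "s \<in> Sm" "N2 s < \<infinity>" "dist2 c s < ennreal e" using r by blast
      then show "\<exists>s\<in>Sm. N2 s < \<infinity> \<and> N2 (sec_add E c (sec_mult E (\<lambda>_. - 1) s)) < \<epsilon>"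
        using N2_diff[OF c Sm_sections] e by (intro bexI[of _ s]) auto
    qed
  qed
  moreover have "c \<in> borel_measurable \<mu> \<longleftrightarrow> (\<lambda>x. coord (c x)) \<in> borel_measurable \<mu>" if "c \<in> sections E"
    using that coord_measurable section_measurable by blast
  ultimately show ?thesis unfolding L2_sections_def by blast
qed

lemma L2SD:
  assumes "c \<in> L2S"
  shows "c \<in> sections E" "(\<lambda>x. coord (c x)) \<in> borel_measurable \<mu>" "N2 c < \<infinity>"
  using assms by (auto simp: L2S_iff)

lemma ennreal_sq_triangle:
  fixes a b c :: "'x::real_normed_vector"
  assumes "norm a \<le> norm b + norm c"
  shows "ennreal ((norm a)\<^sup>2) \<le> 2 * ennreal ((norm b)\<^sup>2) + 2 * ennreal ((norm c)\<^sup>2)"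
proof -
  have "(norm a)\<^sup>2 \<le> (norm b + norm c)\<^sup>2" using assms by (intro power_mono) auto
  also have "\<dots> \<le> 2 * (norm b)\<^sup>2 + 2 * (norm c)\<^sup>2"
    using sum_squares_bound[of "norm b" "norm c"] by (simp add: power2_sum)
  finally have "ennreal ((norm a)\<^sup>2) \<le> ennreal (2 * (norm b)\<^sup>2 + 2 * (norm c)\<^sup>2)"
    by (rule ennreal_leI)
  then show ?thesis by (simp add: ennreal_plus ennreal_mult)
qed

lemma nn_integral_sq_triangle:
  fixes f g h :: "'m \<Rightarrow> 'x::{real_normed_vector, second_countable_topology}"
  assumes [measurable]: "g \<in> borel_measurable \<mu>" "h \<in> borel_measurable \<mu>"
    and "\<And>x. norm (f x) \<le> norm (g x) + norm (h x)"
  shows "(\<integral>\<^sup>+x. ennreal ((norm (f x))\<^sup>2) \<partial>\<mu>)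
    \<le> 2 * (\<integral>\<^sup>+x. ennreal ((norm (g x))\<^sup>2) \<partial>\<mu>) + 2 * (\<integral>\<^sup>+x. ennreal ((norm (h x))\<^sup>2) \<partial>\<mu>)"
proof -
  have "(\<integral>\<^sup>+x. ennreal ((norm (f x))\<^sup>2) \<partial>\<mu>)
      \<le> (\<integral>\<^sup>+x. 2 * ennreal ((norm (g x))\<^sup>2) + 2 * ennreal ((norm (h x))\<^sup>2) \<partial>\<mu>)"
    using assms(3) by (intro nn_integral_mono ennreal_sq_triangle)
  also have "\<dots> = 2 * (\<integral>\<^sup>+x. ennreal ((norm (g x))\<^sup>2) \<partial>\<mu>) + 2 * (\<integral>\<^sup>+x. ennreal ((norm (h x))\<^sup>2) \<partial>\<mu>)"
    by (subst nn_integral_add) (simp_all add: nn_integral_cmult)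
  finally show ?thesis .
qed

text \<open>The quarters absorb the factors 2 of the squared triangle inequality.\<close>

lemma ennreal_combine:
  assumes "x < ennreal (e / 4)" "y < ennreal (e / 4)" "e > 0"
  shows "2 * x + 2 * y < ennreal e"
proof -
  have "2 * x < 2 * ennreal (e / 4)" "2 * y < 2 * ennreal (e / 4)"
    using assms by (auto intro!: ennreal_mult_strict_left_mono)
  then have "2 * x + 2 * y < 2 * ennreal (e / 4) + 2 * ennreal (e / 4)" by (rule add_strict_mono)
  also have "\<dots> = ennreal (2 * (e / 4) + 2 * (e / 4))" using assms
    by (simp only: ennreal_plus ennreal_mult) (simp add: ennreal_mult[symmetric])
  also have "\<dots> = ennreal e" by simp
  finally show ?thesis .
qed

text \<open>A closure is closed: approximants can themselves be approximated by smooth sections.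
  Finiteness of the norm is inherited from one approximant at squared distance below 1.\<close>

lemma L2S_approx:
  assumes c: "c \<in> sections E" "(\<lambda>x. coord (c x)) \<in> borel_measurable \<mu>"
    and app: "\<And>e. e > 0 \<Longrightarrow> \<exists>d\<in>L2S. dist2 c d < ennreal e"
  shows "c \<in> L2S"
  unfolding L2S_iff
proof (intro conjI c allI impI)
  note [measurable] = c(2)
  obtain d where d: "d \<in> L2S" "dist2 c d < ennreal 1" using app[of 1] by auto
  note [measurable] = L2SD(2)[OF d(1)]
  have "N2 c \<le> 2 * dist2 c d + 2 * N2 d"
    unfolding N2_coord dist2_def by (rule nn_integral_sq_triangle) (auto simp: norm_triangle_sub add.commute)
  also have "\<dots> < \<infinity>" using d L2SD(3)[OF d(1)]
    by (simp add: ennreal_mult_less_top less_top[symmetric]) (use order.strict_trans[OF d(2) ennreal_less_top] in \<open>auto simp: ennreal_mult_eq_top_iff\<close>)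
  finally show "N2 c < \<infinity>" .
next
  fix e :: real assume e: "e > 0"
  note [measurable] = c(2)
  obtain d where d: "d \<in> L2S" "dist2 c d < ennreal (e / 4)" using app[of "e / 4"] e by auto
  obtain s where s: "s \<in> Sm" "N2 s < \<infinity>" "dist2 d s < ennreal (e / 4)"
    using d(1) e unfolding L2S_iff by (metis divide_pos_pos zero_less_numeral)
  note [measurable] = L2SD(2)[OF d(1)] Sm_measurable[OF s(1)]
  have "norm (coord (c x) - coord (s x)) \<le> norm (coord (c x) - coord (d x)) + norm (coord (d x) - coord (s x))" for x
    using norm_triangle_ineq[of "coord (c x) - coord (d x)" "coord (d x) - coord (s x)"] by simp
  then have "dist2 c s \<le> 2 * dist2 c d + 2 * dist2 d s"
    unfolding dist2_def by (intro nn_integral_sq_triangle) auto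
  also have "\<dots> < ennreal e" using d s e by (intro ennreal_combine)
  finally show "\<exists>s\<in>Sm. N2 s < \<infinity> \<and> dist2 c s < ennreal e" using s by blast
qed

lemma L2S_limit:
  assumes c: "c \<in> sections E" "(\<lambda>x. coord (c x)) \<in> borel_measurable \<mu>"
    and d: "\<And>n. d n \<in> L2S" and lim: "(\<lambda>n. dist2 c (d n)) \<longlonglongrightarrow> 0"
  shows "c \<in> L2S"
proof (rule L2S_approx[OF c])
  fix e :: real assume "e > 0"
  then have "0 < ennreal e" by simp
  from order_tendstoD(2)[OF lim this] obtain n where "dist2 c (d n) < ennreal e"
    by (auto simp: eventually_sequentially)
  then show "\<exists>d\<in>L2S. dist2 c d < ennreal e" using d by blast
qed

lemma Sm_L2S: "s \<in> Sm \<Longrightarrow> N2 s < \<infinity> \<Longrightarrow> s \<in> L2S"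
  unfolding L2S_iff using Sm_sections Sm_measurable
  by (auto intro!: bexI[of _ s] simp: dist2_def)

lemma L2S_AE_eq:
  assumes c: "c \<in> L2S" and d: "d \<in> sections E" "(\<lambda>x. coord (d x)) \<in> borel_measurable \<mu>"
    and "AE x in \<mu>. c x = d x"
  shows "d \<in> L2S"
proof (rule L2S_limit[OF d c])
  have "dist2 d c = (\<integral>\<^sup>+x. 0 \<partial>\<mu>)"
    unfolding dist2_def using assms(4) by (intro nn_integral_cong_AE) auto
  then show "(\<lambda>n::nat. dist2 d c) \<longlonglongrightarrow> 0" by simp
qed

lemma Sm_add:
  assumes "s \<in> Sm" "t \<in> Sm"
  shows "sec_add E s t \<in> Sm"
proof -
  have sec: "s \<in> sections E" "t \<in> sections E" using assms Sm_sections by auto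
  have "smooth_on_mfd \<A> V (\<psi> \<circ> sec_add E s t)" if t: "(V, \<psi>) \<in> trivs E" for V \<psi>
  proof (rule smooth_on_mfd_cong[OF atlas triv_open[OF t]])
    show "smooth_on_mfd \<A> V (\<lambda>x. (\<psi> \<circ> s) x + (\<psi> \<circ> t) x)"
      unfolding o_def by (intro smooth_on_mfd_add[OF atlas triv_open[OF t]] Sm_smooth assms t)
    show "(\<psi> \<circ> s) x + (\<psi> \<circ> t) x = (\<psi> \<circ> sec_add E s t) x" if "x \<in> V" for x
      using triv_add[OF t, of "s x" "t x"] that sec by (simp add: sec_add_def proj_section)
  qed
  then show ?thesis using sec_add_sections[OF sec] by (auto simp: smooth_sections_def)
qed

lemma Sm_cmult:
  assumes "s \<in> Sm"
  shows "sec_mult E (\<lambda>_. z) s \<in> Sm"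
proof -
  have sec: "s \<in> sections E" using assms Sm_sections by auto
  have "smooth_on_mfd \<A> V (\<psi> \<circ> sec_mult E (\<lambda>_. z) s)" if t: "(V, \<psi>) \<in> trivs E" for V \<psi>
  proof (rule smooth_on_mfd_cong[OF atlas triv_open[OF t]])
    show "smooth_on_mfd \<A> V (\<lambda>x. z *s (\<psi> \<circ> s) x)"
      unfolding o_def by (intro smooth_on_mfd_cmult[OF atlas triv_open[OF t]] Sm_smooth assms t)
    show "z *s (\<psi> \<circ> s) x = (\<psi> \<circ> sec_mult E (\<lambda>_. z) s) x" if "x \<in> V" for x
      using triv_scale[OF t, of "s x" z] that sec by (simp add: sec_mult_def proj_section)
  qed
  then show ?thesis using sec_mult_sections[OF sec] by (auto simp: smooth_sections_def)
qed

lemma Sm_bump: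
  assumes "s \<in> Sm" and c: "(U, \<phi>) \<in> \<A>" "cball p r \<subseteq> \<phi> ` U" "\<kappa> > 0" "r > 0"
  shows "sec_mult E (\<lambda>x. of_real (chart_bump \<phi> U p r \<kappa> x)) s \<in> Sm"
proof -
  have sec: "s \<in> sections E" using assms Sm_sections by auto
  have "smooth_on_mfd \<A> V (\<psi> \<circ> sec_mult E (\<lambda>x. of_real (chart_bump \<phi> U p r \<kappa> x)) s)"
    if t: "(V, \<psi>) \<in> trivs E" for V \<psi>
  proof (rule smooth_on_mfd_cong[OF atlas triv_open[OF t]])
    show "smooth_on_mfd \<A> V (\<lambda>x. chart_bump \<phi> U p r \<kappa> x *\<^sub>R (\<psi> \<circ> s) x)"
      unfolding o_def
      by (intro smooth_on_mfd_bump[OF atlas c(1,2,3) triv_open[OF t] c(4)] Sm_smooth assms t)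
    show "chart_bump \<phi> U p r \<kappa> x *\<^sub>R (\<psi> \<circ> s) x
        = (\<psi> \<circ> sec_mult E (\<lambda>x. of_real (chart_bump \<phi> U p r \<kappa> x)) s) x" if "x \<in> V" for x
      using triv_scale[OF t, of "s x"] that sec
      by (simp add: sec_mult_def proj_section vec_eq_iff) (simp add: scaleR_conv_of_real)
  qed
  then show ?thesis using sec_mult_sections[OF sec] by (auto simp: smooth_sections_def)
qed

lemma N2_mult_le:
  assumes "\<And>x. cmod (u x) \<le> 1"
  shows "N2 (sec_mult E u c) \<le> N2 c"
  unfolding N2_coord coord_sec_mult norm_vector_scalar_mult
  by (intro nn_integral_mono ennreal_leI power_mono mult_left_le_one_le assms) auto

lemma L2S_add:
  assumes c: "c \<in> L2S" and d: "d \<in> L2S"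
  shows "sec_add E c d \<in> L2S"
proof (rule L2S_approx)
  note C = L2SD[OF c] L2SD[OF d]
  note [measurable] = C(2,5)
  show "sec_add E c d \<in> sections E" using C by (simp add: sec_add_sections)
  show "(\<lambda>x. coord (sec_add E c d x)) \<in> borel_measurable \<mu>" by (simp add: coord_sec_add C)
  fix e :: real assume e: "e > 0"
  then have "e / 4 > 0" by simp
  obtain s where s: "s \<in> Sm" "N2 s < \<infinity>" "dist2 c s < ennreal (e / 4)"
    using c \<open>e / 4 > 0\<close> unfolding L2S_iff by blast
  obtain t where t: "t \<in> Sm" "N2 t < \<infinity>" "dist2 d t < ennreal (e / 4)"
    using d \<open>e / 4 > 0\<close> unfolding L2S_iff by blast
  note [measurable] = Sm_measurable[OF s(1)] Sm_measurable[OF t(1)]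
  note sec = Sm_sections[OF s(1)] Sm_sections[OF t(1)]
  have "N2 (sec_add E s t) \<le> 2 * N2 s + 2 * N2 t"
    unfolding N2_coord by (intro nn_integral_sq_triangle) (auto simp: coord_sec_add sec norm_triangle_ineq)
  also have "\<dots> < \<infinity>" using s t by (simp add: ennreal_mult_less_top)
  finally have "sec_add E s t \<in> L2S" using Sm_L2S Sm_add s t by blast
  moreover have "dist2 (sec_add E c d) (sec_add E s t) \<le> 2 * dist2 c s + 2 * dist2 d t"
    unfolding dist2_def
    by (intro nn_integral_sq_triangle) (auto simp: coord_sec_add sec C add_diff_add norm_triangle_ineq)
  ultimately show "\<exists>d'\<in>L2S. dist2 (sec_add E c d) d' < ennreal e"
    using ennreal_combine[OF s(3) t(3) e] by (meson order.strict_trans1)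
qed

text \<open>Dominated convergence: the multipliers differ by at most \<open>2 * C\<close>, so
  \<open>(2 * C)\<^sup>2\<close> times the squared norm of \<open>c\<close> is an integrable
  majorant.\<close>

lemma L2S_mult_limit:
  assumes c: "c \<in> L2S" and [measurable]: "\<And>n. u n \<in> borel_measurable borel"
    and lim: "\<And>x. (\<lambda>n. u n x) \<longlonglongrightarrow> v x" and bd: "\<And>n x. cmod (u n x) \<le> C"
    and mem: "\<And>n. sec_mult E (u n) c \<in> L2S"
  shows "sec_mult E v c \<in> L2S"
proof (rule L2S_limit[OF _ _ mem])
  note [measurable] = L2SD(2)[OF c]
  have [measurable]: "v \<in> borel_measurable borel"
    by (rule borel_measurable_LIMSEQ_metric[OF assms(2) lim])
  show "sec_mult E v c \<in> sections E" using L2SD[OF c] by (simp add: sec_mult_sections)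
  show "(\<lambda>x. coord (sec_mult E v c x)) \<in> borel_measurable \<mu>"
    unfolding coord_sec_mult by measurable
  have bdv: "cmod (v x) \<le> C" for x
    using bd by (intro LIMSEQ_le_const2[OF tendsto_norm[OF lim[of x]]]) auto
  have "(\<lambda>n. \<integral>\<^sup>+x. ennreal ((norm (v x *s coord (c x) - u n x *s coord (c x)))\<^sup>2) \<partial>\<mu>)
      \<longlonglongrightarrow> (\<integral>\<^sup>+x. 0 \<partial>\<mu>)"
  proof (rule nn_integral_dominated_convergence[where w="\<lambda>x. ennreal ((2 * C)\<^sup>2) * ennreal ((norm (coord (c x)))\<^sup>2)"])
    have "(\<integral>\<^sup>+x. ennreal ((2 * C)\<^sup>2) * ennreal ((norm (coord (c x)))\<^sup>2) \<partial>\<mu>) = ennreal ((2 * C)\<^sup>2) * N2 c"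
      unfolding N2_coord by (rule nn_integral_cmult) measurable
    also have "\<dots> < \<infinity>" using L2SD(3)[OF c] by (simp add: ennreal_mult_less_top)
    finally show "(\<integral>\<^sup>+x. ennreal ((2 * C)\<^sup>2) * ennreal ((norm (coord (c x)))\<^sup>2) \<partial>\<mu>) < \<infinity>" .
    fix n
    have "ennreal ((norm (v x *s coord (c x) - u n x *s coord (c x)))\<^sup>2)
        \<le> ennreal ((2 * C)\<^sup>2) * ennreal ((norm (coord (c x)))\<^sup>2)" for x
    proof -
      have "norm (v x *s coord (c x) - u n x *s coord (c x)) = cmod (v x - u n x) * norm (coord (c x))"
        by (simp add: norm_vector_scalar_mult[symmetric] vector_sub_rdistrib)
      also have "\<dots> \<le> (2 * C) * norm (coord (c x))"
        using norm_triangle_ineq4[of "v x" "u n x"] bd[of n x] bdv[of x] by (intro mult_right_mono) auto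
      finally have "(norm (v x *s coord (c x) - u n x *s coord (c x)))\<^sup>2 \<le> ((2 * C) * norm (coord (c x)))\<^sup>2"
        by (intro power_mono) auto
      then show ?thesis by (simp add: ennreal_mult[symmetric] power_mult_distrib ennreal_leI)
    qed
    then show "AE x in \<mu>. ennreal ((norm (v x *s coord (c x) - u n x *s coord (c x)))\<^sup>2)
        \<le> ennreal ((2 * C)\<^sup>2) * ennreal ((norm (coord (c x)))\<^sup>2)" by simp
  next
    have "(\<lambda>n. ennreal ((norm (v x *s coord (c x) - u n x *s coord (c x)))\<^sup>2)) \<longlonglongrightarrow> 0" for x
    proof -
      have "(\<lambda>n. u n x *s coord (c x)) \<longlonglongrightarrow> v x *s coord (c x)"
        by (rule bounded_bilinear.tendsto[OF bounded_bilinear_vector_scalar_mult lim tendsto_const])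
      then have "(\<lambda>n. ennreal ((norm (v x *s coord (c x) - u n x *s coord (c x)))\<^sup>2))
          \<longlonglongrightarrow> ennreal ((norm (v x *s coord (c x) - v x *s coord (c x)))\<^sup>2)"
        by (intro tendsto_intros)
      then show ?thesis by simp
    qed
    then show "AE x in \<mu>. (\<lambda>n. ennreal ((norm (v x *s coord (c x) - u n x *s coord (c x)))\<^sup>2)) \<longlonglongrightarrow> 0"
      by simp
  qed measurable
  then show "(\<lambda>n. dist2 (sec_mult E v c) (sec_mult E (u n) c)) \<longlonglongrightarrow> 0"
    by (simp add: dist2_def coord_sec_mult)
qed

text \<open>Multiplication by a bounded function is Lipschitz, so by density it need only be checked
  on smooth sections.\<close>

lemma L2S_mult_approx:
  assumes c: "c \<in> L2S" and [measurable]: "u \<in> borel_measurable borel" and bd: "\<And>x. cmod (u x) \<le> C"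
    and mem: "\<And>s. s \<in> Sm \<Longrightarrow> N2 s < \<infinity> \<Longrightarrow> sec_mult E u s \<in> L2S"
  shows "sec_mult E u c \<in> L2S"
proof (rule L2S_approx)
  note [measurable] = L2SD(2)[OF c]
  show "sec_mult E u c \<in> sections E" using L2SD[OF c] by (simp add: sec_mult_sections)
  show "(\<lambda>x. coord (sec_mult E u c x)) \<in> borel_measurable \<mu>"
    unfolding coord_sec_mult by measurable
  fix e :: real assume e: "e > 0"
  have C: "C \<ge> 0" using bd norm_ge_zero order_trans by blast
  \<comment> \<open>The operator costs a factor \<open>C\<^sup>2\<close>; adding 1 keeps the
    quotient defined for \<open>C = 0\<close> and the final inequality strict.\<close>
  define e' where "e' = e / (C\<^sup>2 + 1)"
  have "e' > 0" using e by (simp add: e'_def add_nonneg_pos)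
  then obtain s where s: "s \<in> Sm" "N2 s < \<infinity>" "dist2 c s < ennreal e'"
    using c unfolding L2S_iff by blast
  note [measurable] = Sm_measurable[OF s(1)]
  have "ennreal ((norm (u x *s coord (c x) - u x *s coord (s x)))\<^sup>2)
      \<le> ennreal (C\<^sup>2) * ennreal ((norm (coord (c x) - coord (s x)))\<^sup>2)" for x
  proof -
    have "norm (u x *s coord (c x) - u x *s coord (s x)) = cmod (u x) * norm (coord (c x) - coord (s x))"
      by (simp add: norm_vector_scalar_mult[symmetric] vector_ssub_ldistrib)
    also have "\<dots> \<le> C * norm (coord (c x) - coord (s x))" using bd by (intro mult_right_mono) auto
    finally have "(norm (u x *s coord (c x) - u x *s coord (s x)))\<^sup>2 \<le> (C * norm (coord (c x) - coord (s x)))\<^sup>2"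
      by (intro power_mono) auto
    then show ?thesis by (simp add: ennreal_mult[symmetric] power_mult_distrib ennreal_leI)
  qed
  then have "dist2 (sec_mult E u c) (sec_mult E u s)
      \<le> (\<integral>\<^sup>+x. ennreal (C\<^sup>2) * ennreal ((norm (coord (c x) - coord (s x)))\<^sup>2) \<partial>\<mu>)"
    unfolding dist2_def coord_sec_mult by (intro nn_integral_mono)
  also have "\<dots> = ennreal (C\<^sup>2) * dist2 c s"
    unfolding dist2_def by (rule nn_integral_cmult) measurable
  also have "\<dots> \<le> ennreal (C\<^sup>2) * ennreal e'" using s(3) by (intro mult_left_mono) auto
  also have "\<dots> = ennreal (C\<^sup>2 * e')" using \<open>e' > 0\<close> by (simp add: ennreal_mult)
  also have "\<dots> < ennreal e"
  proof (rule ennreal_lessI[OF e])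
    have "C\<^sup>2 * e < (C\<^sup>2 + 1) * e" using e by simp
    then show "C\<^sup>2 * e' < e" unfolding e'_def
      by (simp add: pos_divide_less_eq add_nonneg_pos mult.commute)
  qed
  finally show "\<exists>d\<in>L2S. dist2 (sec_mult E u c) d < ennreal e" using mem s by blast
qed

lemma L2S_cmult: "c \<in> L2S \<Longrightarrow> sec_mult E (\<lambda>_. z) c \<in> L2S"
proof (rule L2S_mult_approx[where C="cmod z"])
  fix s assume s: "s \<in> Sm" "N2 s < \<infinity>"
  note [measurable] = Sm_measurable[OF s(1)]
  have "N2 (sec_mult E (\<lambda>_. z) s) = ennreal ((cmod z)\<^sup>2) * N2 s"
    unfolding N2_coord coord_sec_mult norm_vector_scalar_mult power_mult_distrib
    by (simp add: ennreal_mult nn_integral_cmult)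
  also have "\<dots> < \<infinity>" using s by (simp add: ennreal_mult_less_top)
  finally show "sec_mult E (\<lambda>_. z) s \<in> L2S" by (intro Sm_L2S Sm_cmult s(1))
qed auto

section \<open>Sets whose indicators act as multipliers\<close>

definition mult_sets :: "'m set set" where
  "mult_sets = {B \<in> sets borel. \<forall>c\<in>L2S. sec_mult E (indicator B) c \<in> L2S}"

lemma sec_mult_cong: "(\<And>x. u x = v x) \<Longrightarrow> sec_mult E u c = sec_mult E v c"
  by (simp add: sec_mult_def)

lemma mult_sets_Int:
  assumes "A \<in> mult_sets" "B \<in> mult_sets"
  shows "A \<inter> B \<in> mult_sets"
proof -
  have "sec_mult E (indicator (A \<inter> B)) c = sec_mult E (indicator A) (sec_mult E (indicator B) c)"
    if "c \<in> L2S" for c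
  proof
    fix x show "sec_mult E (indicator (A \<inter> B)) c x = sec_mult E (indicator A) (sec_mult E (indicator B) c) x"
      using L2SD(1)[OF that]
      by (intro section_eqI sec_mult_sections)
         (auto simp: coord_sec_mult indicator_def vec_eq_iff)
  qed
  then show ?thesis using assms by (auto simp: mult_sets_def)
qed

lemma mult_sets_compl:
  assumes "A \<in> mult_sets"
  shows "- A \<in> mult_sets"
proof -
  have "sec_mult E (indicator (- A)) c
      = sec_add E c (sec_mult E (\<lambda>_. - 1) (sec_mult E (indicator A) c))" if "c \<in> L2S" for c
  proof
    fix x show "sec_mult E (indicator (- A)) c x
      = sec_add E c (sec_mult E (\<lambda>_. - 1) (sec_mult E (indicator A) c)) x"
      using L2SD(1)[OF that]
      by (intro section_eqI sec_mult_sections sec_add_sections)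
         (auto simp: coord_sec_mult coord_sec_add sec_mult_sections indicator_def vec_eq_iff)
  qed
  then show ?thesis using assms by (auto simp: mult_sets_def intro!: L2S_add L2S_cmult)
qed

lemma mult_sets_empty: "{} \<in> mult_sets"
proof -
  have "sec_mult E (indicator {}) c = sec_mult E (\<lambda>_. 0) c" for c by (rule sec_mult_cong) simp
  then show ?thesis by (auto simp: mult_sets_def L2S_cmult)
qed

lemma mult_sets_Un: "A \<in> mult_sets \<Longrightarrow> B \<in> mult_sets \<Longrightarrow> A \<union> B \<in> mult_sets"
  using mult_sets_compl[OF mult_sets_Int[OF mult_sets_compl mult_sets_compl, of A B]] by simp

lemma mult_sets_UN:
  fixes A :: "nat \<Rightarrow> 'm set"
  assumes A: "\<And>i. A i \<in> mult_sets"
  shows "(\<Union>i. A i) \<in> mult_sets"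
proof -
  have fin: "(\<Union>i<n. A i) \<in> mult_sets" for n
    by (induction n) (simp_all add: mult_sets_empty lessThan_Suc mult_sets_Un A)
  have "sec_mult E (indicator (\<Union>i. A i)) c \<in> L2S" if c: "c \<in> L2S" for c
  proof (rule L2S_mult_limit[OF c, where C=1 and u="\<lambda>n. indicator (\<Union>i<n. A i)"])
    show "(\<lambda>n. indicator (\<Union>i<n. A i) x :: complex) \<longlonglongrightarrow> indicator (\<Union>i. A i) x" for x
      by (rule LIMSEQ_indicator_UN)
    show "indicator (\<Union>i<n. A i) \<in> borel_measurable borel" for n
      using fin[of n] by (intro borel_measurable_indicator) (simp add: mult_sets_def)
    show "cmod (indicator (\<Union>i<n. A i) x) \<le> 1" for n x by (simp add: indicator_def)
    show "sec_mult E (indicator (\<Union>i<n. A i)) c \<in> L2S" for n using fin c by (simp add: mult_sets_def)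
  qed
  moreover have "(\<Union>i. A i) \<in> sets borel" using A by (auto simp: mult_sets_def)
  ultimately show ?thesis by (simp add: mult_sets_def)
qed

lemma mult_sets_countable_Union:
  assumes "countable \<D>" "\<D> \<subseteq> mult_sets"
  shows "\<Union>\<D> \<in> mult_sets"
proof (cases "\<D> = {}")
  case False
  then have "\<Union>\<D> = (\<Union>i. from_nat_into \<D> i)" using assms(1) by (metis range_from_nat_into)
  moreover have "(\<Union>i. from_nat_into \<D> i) \<in> mult_sets"
    by (rule mult_sets_UN) (use from_nat_into[OF False] assms(2) in blast)
  ultimately show ?thesis by simp
qed (simp add: mult_sets_empty)

lemma chart_ball_open:
  assumes "(U, \<phi>) \<in> \<A>" "open S"
  shows "open {x \<in> U. \<phi> x \<in> S}"
  using continuous_open_preimage[OF smooth_atlasD(3,1)[OF atlas assms(1)] assms(2)]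
  by (simp add: vimage_def Int_def)

text \<open>Two limits, in this order: on smooth sections, where multiplication by a bump stays
  smooth, the bumps tend to the indicator; density then extends the result to all of
  \<open>L2S\<close>.\<close>

lemma mult_sets_chart_ball:
  assumes c: "(U, \<phi>) \<in> \<A>" "cball p r \<subseteq> \<phi> ` U" "r > 0"
  shows "{x \<in> U. \<phi> x \<in> ball p r} \<in> mult_sets"
proof -
  let ?B = "{x \<in> U. \<phi> x \<in> ball p r}"
  have B[measurable]: "?B \<in> sets borel" using borel_open[OF chart_ball_open[OF c(1) open_ball]] .
  define b where "b n x = chart_bump \<phi> U p r (1 / real (Suc n)) x" for n x
  have b01: "0 \<le> b n x" "b n x \<le> 1" for n x unfolding b_def by (intro chart_bump_bounds, simp)+
  have [measurable]: "b n \<in> borel_measurable borel" for n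
  proof -
    \<comment> \<open>Multiplying the constant 1 by the bump yields its continuity, and so its
      measurability, from the smoothness lemma.\<close>
    have "smooth_on_mfd \<A> UNIV (\<lambda>x. chart_bump \<phi> U p r (1 / real (Suc n)) x *\<^sub>R (1::real))"
    proof (rule smooth_on_mfd_bump[OF atlas c(1,2) _ _ c(3)])
      show "smooth_on_mfd \<A> UNIV (\<lambda>x. 1::real)"
        unfolding smooth_on_mfd_def smooth_on_def o_def
        by (auto intro!: Ck_on_const smooth_atlasD(2)[OF atlas])
    qed auto
    from smooth_on_mfd_continuous[OF atlas open_UNIV this]
    show ?thesis unfolding b_def by (auto intro: borel_measurable_continuous_onI)
  qed
  have sm: "sec_mult E (indicator ?B) s \<in> L2S" if s: "s \<in> Sm" "N2 s < \<infinity>" for s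
  proof (rule L2S_mult_limit[where u="\<lambda>n x. of_real (b n x)" and C=1])
    show "s \<in> L2S" using s by (rule Sm_L2S)
    show "(\<lambda>n. complex_of_real (b n x)) \<longlonglongrightarrow> indicator ?B x" for x
    proof -
      have "complex_of_real (indicator ?B x) = indicator ?B x" by (simp add: indicator_def)
      then show ?thesis
        using tendsto_of_real[OF chart_bump_tendsto[OF c(3), of \<phi> U p x], where 'a=complex]
        by (simp only: b_def)
    qed
    show "cmod (complex_of_real (b n x)) \<le> 1" for n x using b01 by simp
    show "sec_mult E (\<lambda>x. complex_of_real (b n x)) s \<in> L2S" for n
    proof (rule Sm_L2S)
      show "sec_mult E (\<lambda>x. complex_of_real (b n x)) s \<in> Sm"
        unfolding b_def by (rule Sm_bump[OF s(1) c(1,2) _ c(3)]) simp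
      have "N2 (sec_mult E (\<lambda>x. complex_of_real (b n x)) s) \<le> N2 s"
        by (rule N2_mult_le) (use b01 in simp)
      also have "\<dots> < \<infinity>" by (rule s)
      finally show "N2 (sec_mult E (\<lambda>x. complex_of_real (b n x)) s) < \<infinity>" .
    qed
  qed simp
  have "sec_mult E (indicator ?B) c \<in> L2S" if "c \<in> L2S" for c
    by (rule L2S_mult_approx[OF that borel_measurable_indicator[OF B] _ sm, where C=1])
       (simp add: indicator_def)
  then show ?thesis using B by (simp add: mult_sets_def)
qed

text \<open>Inside a chart, an open set is a countable union of coordinate balls by the Lindelof
  property of Euclidean space; \<sigma>-compactness leaves only countably many charts.\<close>

lemma mult_sets_open:
  assumes "open S"
  shows "S \<in> mult_sets"
proof -
  have piece: "U \<inter> S \<in> mult_sets" if c: "(U, \<phi>) \<in> \<A>" for U \<phi>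
  proof -
    note C = smooth_atlasD[OF atlas c]
    let ?O = "\<phi> ` (U \<inter> S)"
    have O: "open ?O" by (rule open_chart_image[OF atlas c assms])
    define \<F> where "\<F> = {ball p r |p r. r > 0 \<and> cball p r \<subseteq> ?O}"
    have "\<Union>\<F> = ?O"
    proof
      show "\<Union>\<F> \<subseteq> ?O" unfolding \<F>_def using ball_subset_cball by blast
      show "?O \<subseteq> \<Union>\<F>"
      proof
        fix y assume "y \<in> ?O"
        then obtain r where "r > 0" "cball y r \<subseteq> ?O" using O open_contains_cball by blast
        then have "ball y r \<in> \<F>" unfolding \<F>_def by blast
        then show "y \<in> \<Union>\<F>" using \<open>r > 0\<close> by (auto intro!: bexI[of _ "ball y r"])
      qed
    qed
    moreover obtain \<F>' where \<F>': "\<F>' \<subseteq> \<F>" "countable \<F>'" "\<Union>\<F>' = \<Union>\<F>"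
      by (rule Lindelof[of \<F>]) (auto simp: \<F>_def)
    ultimately have eq: "?O = \<Union>\<F>'" by simp
    have "U \<inter> S = {x \<in> U. \<phi> x \<in> ?O}" using C(5) by (auto simp: inj_on_def)
    also have "\<dots> = \<Union>((\<lambda>b. {x \<in> U. \<phi> x \<in> b}) ` \<F>')" unfolding eq by auto
    also have "\<dots> \<in> mult_sets"
    proof (rule mult_sets_countable_Union)
      show "(\<lambda>b. {x \<in> U. \<phi> x \<in> b}) ` \<F>' \<subseteq> mult_sets"
      proof clarify
        fix b assume "b \<in> \<F>'"
        then obtain p r where b: "b = ball p r" "r > 0" "cball p r \<subseteq> ?O"
          using \<F>' unfolding \<F>_def by blast
        then have "cball p r \<subseteq> \<phi> ` U" by auto
        then show "{x \<in> U. \<phi> x \<in> b} \<in> mult_sets" using mult_sets_chart_ball[OF c _ b(2)] b(1) by blast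
      qed
    qed (use \<F>' in auto)
    finally show ?thesis .
  qed
  have opn: "open V" if "V \<in> fst ` \<A>" for V using that smooth_atlasD(1)[OF atlas] by auto
  have cov: "\<Union>(fst ` \<A>) = UNIV" using atlas by (auto simp: smooth_atlas_def case_prod_beta)
  obtain \<V> where \<V>: "countable \<V>" "\<V> \<subseteq> fst ` \<A>" "\<Union>\<V> = UNIV"
    using sigma_compact_countable_subcover[OF sigma opn cov] by blast
  have "S = \<Union>((\<lambda>U. U \<inter> S) ` \<V>)" using \<V>(3) by auto
  also have "\<dots> \<in> mult_sets"
    using \<V>(1,2) piece by (intro mult_sets_countable_Union) auto
  finally show ?thesis .
qed

lemma mult_sets_borel: "B \<in> sets borel \<Longrightarrow> B \<in> mult_sets"
proof -
  have "B \<in> mult_sets" if "B \<in> sigma_sets UNIV {S. open S}" for B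
    using that
  proof induction
    case (Compl a)
    then show ?case using mult_sets_compl by (simp add: Compl_eq_Diff_UNIV[symmetric])
  qed (auto intro: mult_sets_open mult_sets_empty mult_sets_UN)
  then show "B \<in> sets borel \<Longrightarrow> B \<in> mult_sets" by (simp add: borel_def)
qed

lemma L2S_indicator: "B \<in> sets borel \<Longrightarrow> c \<in> L2S \<Longrightarrow> sec_mult E (indicator B) c \<in> L2S"
  using mult_sets_borel by (auto simp: mult_sets_def)

lemma sec_mult_sec_mult:
  assumes "c \<in> sections E"
  shows "sec_mult E u (sec_mult E v c) = sec_mult E (\<lambda>x. u x * v x) c"
proof
  fix x show "sec_mult E u (sec_mult E v c) x = sec_mult E (\<lambda>x. u x * v x) c x"
    using assms by (intro section_eqI sec_mult_sections) (simp_all add: coord_sec_mult vec_eq_iff)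
qed

lemma sec_mult_add:
  assumes "c \<in> sections E"
  shows "sec_add E (sec_mult E u c) (sec_mult E v c) = sec_mult E (\<lambda>x. u x + v x) c"
proof
  fix x show "sec_add E (sec_mult E u c) (sec_mult E v c) x = sec_mult E (\<lambda>x. u x + v x) c x"
    using assms by (intro section_eqI sec_mult_sections sec_add_sections)
      (simp_all add: coord_sec_mult coord_sec_add sec_mult_sections vec_eq_iff algebra_simps)
qed

section \<open>Bounded Borel multipliers\<close>

lemma L2S_simple:
  assumes F: "simple_function borel (F :: 'm \<Rightarrow> complex)" and c: "c \<in> L2S"
  shows "sec_mult E F c \<in> L2S"
proof -
  have fin: "finite (range F)" using simple_functionD(1)[OF F] by simp
  have ms: "F -` {y} \<in> sets borel" for y using simple_functionD(2)[OF F, of "{y}"] by simp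
  have "sec_mult E (\<lambda>x. \<Sum>y\<in>Y. y * indicator (F -` {y}) x) c \<in> L2S" if "finite Y" for Y
    using that
  proof induction
    case empty
    show ?case using L2S_cmult[OF c, of 0] by simp
  next
    case (insert y Y)
    have eq: "sec_mult E (\<lambda>x. \<Sum>y\<in>insert y Y. y * indicator (F -` {y}) x) c
        = sec_add E (sec_mult E (\<lambda>_. y) (sec_mult E (indicator (F -` {y})) c))
            (sec_mult E (\<lambda>x. \<Sum>y\<in>Y. y * indicator (F -` {y}) x) c)"
      unfolding sum.insert[OF insert.hyps]
      by (simp only: sec_mult_sec_mult[OF L2SD(1)[OF c]] sec_mult_add[OF L2SD(1)[OF c]])
    show ?case unfolding eq by (intro L2S_add L2S_cmult L2S_indicator ms c insert.IH)
  qed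
  from this[OF fin] have "sec_mult E (\<lambda>x. \<Sum>y\<in>range F. y * indicator (F -` {y}) x) c \<in> L2S" .
  moreover have "(\<Sum>y\<in>range F. y * indicator (F -` {y}) x) = F x" for x
  proof -
    have "(\<Sum>y\<in>range F. y * indicator (F -` {y}) x) = (\<Sum>y\<in>{F x}. y * indicator (F -` {y}) x)"
      using fin by (intro sum.mono_neutral_right) (auto simp: indicator_def)
    then show ?thesis by simp
  qed
  ultimately show ?thesis by simp
qed

lemma L2S_Linf:
  assumes u: "u \<in> Linf \<mu>" and c: "c \<in> L2S"
  shows "sec_mult E u c \<in> L2S"
proof -
  obtain C where um [measurable]: "u \<in> borel_measurable \<mu>" and C: "AE x in \<mu>. cmod (u x) \<le> C"
    using u by (auto simp: Linf_def)
  note [measurable] = L2SD(2)[OF c]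
  \<comment> \<open>\<open>u\<close> is bounded only almost everywhere, while the limit lemma asks
    for bounds at every point. The truncation changes the product on a null set only.\<close>
  define v where "v x = (if cmod (u x) \<le> C then u x else 0)" for x
  have [measurable]: "v \<in> borel_measurable \<mu>" unfolding v_def by measurable
  have bv: "cmod (v x) \<le> \<bar>C\<bar>" for x by (auto simp: v_def)
  obtain F where F: "\<And>i. simple_function \<mu> (F i)" "\<And>x. (\<lambda>i. F i x) \<longlonglongrightarrow> v x"
    "\<And>i x. dist (F i x) 0 \<le> 2 * dist (v x) 0"
    using borel_measurable_implies_sequence_metric[of v \<mu> 0] by auto
  have F': "simple_function borel (F i)" for i
    using F(1)[of i] by (simp add: simple_function_def)
  have "sec_mult E v c \<in> L2S"
  proof (rule L2S_mult_limit[OF c _ F(2)])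
    show "F i \<in> borel_measurable borel" for i using F'[of i] by (rule borel_measurable_simple_function)
    \<comment> \<open>The simple approximants are controlled only up to twice the limit, hence the
      factor 2.\<close>
    show "cmod (F i x) \<le> 2 * \<bar>C\<bar>" for i x
    proof -
      have "cmod (F i x) \<le> 2 * cmod (v x)" using F(3)[of i x] by simp
      also have "\<dots> \<le> 2 * \<bar>C\<bar>" using bv[of x] by simp
      finally show ?thesis .
    qed
    show "sec_mult E (F i) c \<in> L2S" for i by (rule L2S_simple[OF F' c])
  qed
  then show ?thesis
  proof (rule L2S_AE_eq)
    show "sec_mult E u c \<in> sections E" using L2SD[OF c] by (simp add: sec_mult_sections)
    show "(\<lambda>x. coord (sec_mult E u c x)) \<in> borel_measurable \<mu>" unfolding coord_sec_mult by measurable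
    show "AE x in \<mu>. sec_mult E v c x = sec_mult E u c x"
      using C by eventually_elim (simp add: sec_mult_def v_def)
  qed
qed

end

section \<open>Orthogonal phases\<close>

lemma integral_exp_unit_interval:
  assumes "m \<noteq> (0::int)"
  shows "(\<integral>t. indicator {0..1} t *\<^sub>R exp (2 * pi * \<i> * of_int m * complex_of_real t) \<partial>lborel) = 0"
proof -
  define c where "c = 2 * pi * \<i> * of_int m"
  have c: "c \<noteq> 0" using assms by (simp add: c_def)
  have "(\<integral>t. indicator {0..1} t *\<^sub>R exp (c * complex_of_real t) \<partial>lborel)
      = exp (c * of_real 1) / c - exp (c * of_real 0) / c"
  proof (rule integral_FTC_atLeastAtMost)
    fix x :: real
    have "((\<lambda>x. exp (c * x) / c) has_field_derivative exp (c * of_real x)) (at (of_real x))"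
      using c by (auto intro!: derivative_eq_intros)
    then show "((\<lambda>x. exp (c * complex_of_real x) / c) has_vector_derivative exp (c * complex_of_real x))
        (at x within {0..1})"
      by (rule has_vector_derivative_real_field[THEN has_vector_derivative_at_within])
  qed (auto intro!: continuous_intros)
  also have "exp (c * of_real 1) = 1"
    using exp_integer_2pi[of "of_int m"] by (simp add: c_def mult_ac)
  finally show ?thesis by (simp add: c_def)
qed

text \<open>The probability integral transform. Without atoms the distribution function F is
  continuous, so the largest \<open>s\<close> with \<open>F s \<le> t\<close> satisfies
  \<open>F s = t\<close>, and the event \<open>F (\<theta> x) \<le> t\<close> is the event
  \<open>\<theta> x \<le> s\<close>.\<close>

lemma (in prob_space) cdf_uniform:
  assumes \<theta>[measurable]: "\<theta> \<in> borel_measurable M"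
    and atomless: "\<And>t. prob {x \<in> space M. \<theta> x = t} = 0"
  shows "distributed M lborel (\<lambda>x. cdf (distr M borel \<theta>) (\<theta> x))
    (\<lambda>t. indicator {0..1::real} t / measure lborel {0..1::real})"
proof -
  define D where "D = distr M borel \<theta>"
  interpret D: real_distribution D unfolding D_def by simp
  define F where "F = cdf D"
  have F: "F t = prob {x \<in> space M. \<theta> x \<le> t}" for t
    unfolding F_def cdf_def D_def by (subst measure_distr) (auto intro!: arg_cong[where f=prob])
  have "D.prob {t} = 0" for t
    using atomless[of t] unfolding D_def
    by (subst measure_distr) (auto simp: vimage_def Int_def conj_commute)
  then have cont: "isCont F t" for t unfolding F_def by (subst D.isCont_cdf) auto
  then have contF: "continuous_on S F" for S by (intro continuous_at_imp_continuous_on) auto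
  have mono: "x \<le> y \<Longrightarrow> F x \<le> F y" for x y unfolding F_def by (rule D.cdf_nondecreasing)
  have top: "(F \<longlongrightarrow> 1) at_top" unfolding F_def by (rule D.cdf_lim_at_top_prob)
  have bot: "(F \<longlongrightarrow> 0) at_bot" unfolding F_def by (rule D.cdf_lim_at_bot)
  have F01: "0 \<le> F t" "F t \<le> 1" for t unfolding F_def by (rule D.cdf_nonneg, rule D.cdf_bounded_prob)
  have [measurable]: "F \<in> borel_measurable borel"
    by (rule borel_measurable_continuous_onI) (rule contF)
  have eq: "prob {x \<in> space M. F (\<theta> x) \<le> t} = t" if t: "0 \<le> t" "t < 1" for t
  proof (cases "{s. F s \<le> t} = {}")
    \<comment> \<open>Since F tends to 0 at minus infinity, this occurs only for
      \<open>t = 0\<close>, where both sides vanish.\<close>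
    case True
    then have gt: "F s > t" for s by (auto simp: not_le)
    have "t \<le> 0"
    proof (rule ccontr)
      assume "\<not> t \<le> 0"
      then have "\<forall>\<^sub>F s in at_bot. F s < t" using order_tendstoD(2)[OF bot] by simp
      then obtain s where "F s < t" by (auto simp: eventually_at_bot_linorder)
      then show False using gt[of s] by simp
    qed
    moreover have empty: "{x \<in> space M. F (\<theta> x) \<le> t} = {}" using gt by (auto simp: not_le)
    ultimately show ?thesis using t unfolding empty by simp
  next
    case False
    let ?S = "{s. F s \<le> t}"
    have "\<forall>\<^sub>F s in at_top. t < F s" using order_tendstoD(1)[OF top t(2)] .
    then obtain b where b: "\<And>s. s \<ge> b \<Longrightarrow> t < F s" by (auto simp: eventually_at_top_linorder)
    have bd: "bdd_above ?S"
    proof (rule bdd_aboveI[of _ b])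
      fix x assume "x \<in> ?S"
      then show "x \<le> b" using b[of x] by fastforce
    qed
    define s where "s = Sup ?S"
    have "closed ?S" by (intro closed_Collect_le contF continuous_on_const)
    then have sS: "F s \<le> t" using closed_contains_Sup[OF False bd] by (simp add: s_def)
    have above: "t < F x" if "x > s" for x
    proof (rule ccontr)
      assume "\<not> t < F x"
      then have "x \<le> s" unfolding s_def by (intro cSup_upper bd) simp
      then show False using that by simp
    qed
    have "t \<le> F s"
    proof (rule tendsto_lowerbound)
      show "(F \<longlongrightarrow> F s) (at_right s)"
        using cont[of s] by (simp add: isCont_def filterlim_at_split)
      show "\<forall>\<^sub>F x in at_right s. t \<le> F x"
        using above by (auto simp: eventually_at_right_less eventually_at_filter intro!: always_eventually less_imp_le)
    qed simp
    then have Fs: "F s = t" using sS by simp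
    have "F x \<le> t \<longleftrightarrow> x \<le> s" for x
      using mono[of x s] above[of x] Fs by (meson not_le)
    then show ?thesis using F[of s] Fs by simp
  qed
  \<comment> \<open>At \<open>t = 1\<close> the sublevel set is the whole line and has no supremum;
    there the claim is just that F is at most 1.\<close>
  have eq1: "prob {x \<in> space M. F (\<theta> x) \<le> t} = t" if t: "0 \<le> t" "t \<le> 1" for t
  proof (cases "t = 1")
    case True
    then show ?thesis using F01 prob_space by simp
  qed (use eq t in auto)
  have "distributed M lborel (\<lambda>x. F (\<theta> x)) (\<lambda>t. indicator {0..1::real} t / measure lborel {0..1::real})"
    unfolding uniform_distributed_iff using eq1 by simp
  then show ?thesis by (simp only: F_def D_def)
qed

text \<open>With \<rho> normalized to a probability density, \<open>q\<close> is uniform on [0,1],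
  and the integrals become those of nontrivial characters over a full period. If \<rho> has total
  mass 0, constant phases will do.\<close>

lemma orthogonal_phases:
  fixes \<rho> \<theta> :: "'m \<Rightarrow> real"
  assumes [measurable]: "\<rho> \<in> borel_measurable \<mu>" "\<theta> \<in> borel_measurable \<mu>"
    and \<rho>: "\<And>x. 0 \<le> \<rho> x" "(\<integral>\<^sup>+x. ennreal (\<rho> x) \<partial>\<mu>) < \<infinity>"
    and null: "\<And>t. {x \<in> space \<mu>. \<theta> x = t} \<in> null_sets \<mu>"
  obtains w :: "nat \<Rightarrow> 'm \<Rightarrow> complex" where "\<And>k. w k \<in> borel_measurable \<mu>" "\<And>k x. cmod (w k x) = 1"
    "\<And>j k. j \<noteq> k \<Longrightarrow> (\<integral>x. \<rho> x *\<^sub>R (cnj (w j x) * w k x) \<partial>\<mu>) = 0"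
proof (cases "(\<integral>\<^sup>+x. ennreal (\<rho> x) \<partial>\<mu>) = 0")
  case True
  then have "AE x in \<mu>. \<rho> x = 0"
    using \<rho>(1) by (subst (asm) nn_integral_0_iff_AE) (auto simp: ennreal_eq_0_iff antisym)
  then have "(\<integral>x. \<rho> x *\<^sub>R (1::complex) \<partial>\<mu>) = (\<integral>x. 0 \<partial>\<mu>)"
    by (intro integral_cong_AE) auto
  then show thesis using that[of "\<lambda>_ _. 1"] by simp
next
  case False
  define T where "T = enn2real (\<integral>\<^sup>+x. ennreal (\<rho> x) \<partial>\<mu>)"
  have eT: "(\<integral>\<^sup>+x. ennreal (\<rho> x) \<partial>\<mu>) = ennreal T" using \<rho>(2) by (simp add: T_def less_top)
  have T: "T > 0"
  proof (rule ccontr)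
    assume "\<not> T > 0"
    then have "ennreal T = 0" by (simp add: ennreal_eq_0_iff)
    then show False using False eT by simp
  qed
  define N where "N = density \<mu> (\<lambda>x. ennreal (\<rho> x / T))"
  have "emeasure N (space N) = 1"
  proof -
    have "emeasure N (space N) = (\<integral>\<^sup>+x. ennreal (1 / T) * ennreal (\<rho> x) \<partial>\<mu>)"
      unfolding N_def using T \<rho>(1)
      by (auto simp: emeasure_density ennreal_mult[symmetric] intro!: nn_integral_cong)
    also have "\<dots> = ennreal (1 / T) * ennreal T" by (simp add: nn_integral_cmult eT)
    also have "\<dots> = 1" using T by (simp add: ennreal_mult[symmetric])
    finally show ?thesis .
  qed
  then interpret N: prob_space N by (rule prob_spaceI)
  have \<theta>N: "\<theta> \<in> borel_measurable N" by (simp add: N_def)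
  have at: "N.prob {x \<in> space N. \<theta> x = t} = 0" for t
  proof -
    have "{x \<in> space N. \<theta> x = t} \<in> null_sets N"
      using absolutely_continuousI_density[of "\<lambda>x. ennreal (\<rho> x / T)" \<mu>] null[of t]
      by (auto simp: absolutely_continuous_def N_def)
    then show ?thesis by (simp add: N.emeasure_eq_measure null_sets_def)
  qed
  define q where "q x = cdf (distr N borel \<theta>) (\<theta> x)" for x
  have dist: "distributed N lborel q (\<lambda>t. indicator {0..1::real} t / measure lborel {0..1::real})"
    unfolding q_def by (rule N.cdf_uniform[OF \<theta>N at])
  have qN: "q \<in> borel_measurable N" using distributed_measurable[OF dist] by simp
  have q\<mu>[measurable]: "q \<in> borel_measurable \<mu>" using qN by (simp add: N_def)
  define w where "w k x = exp (2 * pi * \<i> * of_int (int k) * complex_of_real (q x))" for k :: nat and x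
  show thesis
  proof (rule that[of w])
    show "w k \<in> borel_measurable \<mu>" for k unfolding w_def by measurable
    show "cmod (w k x) = 1" for k x by (simp add: w_def)
    fix j k :: nat assume "j \<noteq> k"
    define m where "m = int k - int j"
    have m: "m \<noteq> 0" using \<open>j \<noteq> k\<close> by (simp add: m_def)
    let ?g = "\<lambda>t. exp (2 * pi * \<i> * of_int m * complex_of_real t)"
    have wjk: "cnj (w j x) * w k x = ?g (q x)" for x
      by (simp add: w_def exp_cnj exp_add[symmetric] m_def algebra_simps)
    have "(\<integral>x. ?g (q x) \<partial>N) = (\<integral>t. ?g t \<partial>distr N lborel q)"
      by (rule integral_distr[symmetric]) (use qN in auto)
    also have "distr N lborel q = density lborel (\<lambda>t. ennreal (indicator {0..1} t))"
      using distributed_distr_eq_density[OF dist] by simp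
    also have "(\<integral>t. ?g t \<partial>density lborel (\<lambda>t. ennreal (indicator {0..1} t)))
        = (\<integral>t. indicator {0..1} t *\<^sub>R ?g t \<partial>lborel)"
      by (rule integral_density) auto
    also have "\<dots> = 0" by (rule integral_exp_unit_interval[OF m])
    finally have "(\<integral>x. ?g (q x) \<partial>N) = 0" .
    moreover have "(\<integral>x. ?g (q x) \<partial>N) = (\<integral>x. (\<rho> x / T) *\<^sub>R ?g (q x) \<partial>\<mu>)"
      unfolding N_def using T \<rho>(1) by (intro integral_density) auto
    moreover have "\<dots> = (1 / T) *\<^sub>R (\<integral>x. \<rho> x *\<^sub>R ?g (q x) \<partial>\<mu>)"
      by (subst integral_scaleR_right[symmetric]) (simp add: field_simps)
    ultimately show "(\<integral>x. \<rho> x *\<^sub>R (cnj (w j x) * w k x) \<partial>\<mu>) = 0" using T by (simp add: wjk)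
  qed
qed

section \<open>Null hyperplanes and an atomless function\<close>

lemma emeasure_lborel_hyperplane:
  fixes i :: "'k::finite"
  shows "{y :: real^'k. y $ i = t} \<in> null_sets lborel"
proof -
  have "negligible {y :: real^'k. y \<bullet> axis i 1 = t}"
    by (rule negligible_standard_hyperplane) simp
  moreover have "{y :: real^'k. y \<bullet> axis i 1 = t} = {y. y $ i = t}" by (simp add: inner_axis)
  moreover have "closed {y :: real^'k. y $ i = t}"
    by (intro closed_Collect_eq continuous_intros)
  then have "{y :: real^'k. y $ i = t} \<in> sets lborel" by simp
  ultimately show ?thesis by (simp add: negligible_iff_null_sets null_sets_completion_iff)
qed

context hermitian_bundle
begin

lemma chart_hyperplane_null:
  assumes c: "(U, \<phi>) \<in> \<A>"
  shows "{x \<in> U. \<phi> x $ i = t} \<in> null_sets \<mu>"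
proof -
  note C = smooth_atlasD[OF atlas c]
  let ?H = "{y. y $ i = t} \<inter> \<phi> ` U"
  have U: "U \<in> sets \<mu>" and \<phi>U: "\<phi> ` U \<in> sets lborel" using C(1,2) by auto
  have "?H \<in> null_sets lborel"
    using null_set_Int1[OF emeasure_lborel_hyperplane \<phi>U] by (simp add: Int_commute)
  then have H: "?H \<in> null_sets (restrict_space lborel (\<phi> ` U))"
    by (subst null_sets_restrict_space[OF \<phi>U]) auto
  let ?D = "distr (restrict_space \<mu> U) (restrict_space borel (\<phi> ` U)) \<phi>"
  have ac: "null_sets (restrict_space lborel (\<phi> ` U)) \<subseteq> null_sets ?D"
    using ll c unfolding locally_lebesgue_def equivalent_measures_def absolutely_continuous_def by blast
  have meas: "\<phi> \<in> measurable (restrict_space \<mu> U) (restrict_space borel (\<phi> ` U))"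
  proof (rule measurable_restrict_space2)
    show "\<phi> \<in> space (restrict_space \<mu> U) \<rightarrow> \<phi> ` U" by (auto simp: space_restrict_space)
    have "\<phi> \<in> borel_measurable (restrict_space borel U)"
      by (rule borel_measurable_continuous_on_restrict[OF C(3)])
    then show "\<phi> \<in> measurable (restrict_space \<mu> U) borel"
      by (simp cong: measurable_cong_sets add: sets_restrict_space_cong[OF sets_mu])
  qed
  have HD: "emeasure ?D ?H = 0" "?H \<in> sets (restrict_space borel (\<phi> ` U))"
    using H ac by (auto simp: null_sets_def)
  have "{x \<in> U. \<phi> x $ i = t} = \<phi> -` ?H \<inter> space (restrict_space \<mu> U)"
    by (auto simp: space_restrict_space)
  then have "emeasure (restrict_space \<mu> U) {x \<in> U. \<phi> x $ i = t} = 0"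
    "{x \<in> U. \<phi> x $ i = t} \<in> sets (restrict_space \<mu> U)"
    using HD emeasure_distr[OF meas HD(2)] measurable_sets[OF meas HD(2)] by auto
  then have "{x \<in> U. \<phi> x $ i = t} \<in> null_sets (restrict_space \<mu> U)" by (simp add: null_sets_def)
  then show ?thesis using null_sets_restrict_space[OF U] by blast
qed

text \<open>A coordinate is glued along the Borel partition given by countably many charts. Each
  level set then lies in a countable union of coordinate hyperplanes, null because \<mu> is
  equivalent to Lebesgue measure in every chart.\<close>

lemma atomless_function:
  "\<exists>\<theta> :: 'm \<Rightarrow> real. \<theta> \<in> borel_measurable \<mu> \<and> (\<forall>t. {x \<in> space \<mu>. \<theta> x = t} \<in> null_sets \<mu>)"
proof -
  have opn: "open V" if "V \<in> fst ` \<A>" for V using that smooth_atlasD(1)[OF atlas] by auto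
  have cov: "\<Union>(fst ` \<A>) = UNIV" using atlas by (auto simp: smooth_atlas_def case_prod_beta)
  obtain \<V> where \<V>: "countable \<V>" "\<V> \<subseteq> fst ` \<A>" "\<Union>\<V> = UNIV"
    using sigma_compact_countable_subcover[OF sigma opn cov] by blast
  then have "\<V> \<noteq> {}" by auto
  define V where "V = from_nat_into \<V>"
  have ran: "range V = \<V>" unfolding V_def using \<V>(1) \<open>\<V> \<noteq> {}\<close> by (rule range_from_nat_into[rotated])
  have "\<forall>i. \<exists>\<phi>. (V i, \<phi>) \<in> \<A>"
  proof
    fix i
    have "V i \<in> fst ` \<A>" using ran \<V>(2) by blast
    then show "\<exists>\<phi>. (V i, \<phi>) \<in> \<A>" by auto
  qed
  then obtain \<phi> where \<phi>: "\<And>i. (V i, \<phi> i) \<in> \<A>" by metis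
  have UV: "(\<Union>i. V i) = UNIV" using ran \<V>(3) by simp
  have oV: "open (V i)" for i using smooth_atlasD(1)[OF atlas \<phi>] .
  define J where "J x = (LEAST i. x \<in> V i)" for x
  have J: "x \<in> V (J x)" for x
  proof -
    have "\<exists>i. x \<in> V i" using UV by auto
    then show ?thesis unfolding J_def by (rule LeastI_ex)
  qed
  have Jm: "{x. J x = i} \<in> sets borel" for i
    unfolding J_def by (rule borel_least_index[OF oV UV])
  \<comment> \<open>Any coordinate direction works; that one exists is the condition k \<ge> 1,
    built into the index type.\<close>
  define \<kappa> :: 'k where "\<kappa> = undefined"
  define \<theta> where "\<theta> x = \<phi> (J x) x $ \<kappa>" for x
  show ?thesis
  proof (intro exI[of _ \<theta>] conjI allI)
    show \<theta>m: "\<theta> \<in> borel_measurable \<mu>"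
    proof (rule borel_measurableI)
      fix S :: "real set" assume S: "open S"
      have o: "open {x \<in> V i. \<phi> i x \<in> (\<lambda>y. y $ \<kappa>) -` S}" for i
        by (intro chart_ball_open[OF \<phi>] open_vimage S continuous_intros)
      have "\<theta> -` S \<inter> space \<mu> = (\<Union>i. {x. J x = i} \<inter> {x \<in> V i. \<phi> i x \<in> (\<lambda>y. y $ \<kappa>) -` S})"
        using J by (auto simp: \<theta>_def)
      also have "\<dots> \<in> sets \<mu>" using Jm borel_open[OF o] by auto
      finally show "\<theta> -` S \<inter> space \<mu> \<in> sets \<mu>" .
    qed
    fix t
    have m: "{x \<in> space \<mu>. \<theta> x = t} \<in> sets \<mu>" using \<theta>m by measurable
    show "{x \<in> space \<mu>. \<theta> x = t} \<in> null_sets \<mu>"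
    proof (rule null_sets_subset[OF _ m])
      show "(\<Union>i. {x \<in> V i. \<phi> i x $ \<kappa> = t}) \<in> null_sets \<mu>"
        using chart_hyperplane_null[OF \<phi>] by auto
      show "{x \<in> space \<mu>. \<theta> x = t} \<subseteq> (\<Union>i. {x \<in> V i. \<phi> i x $ \<kappa> = t})"
        using J by (auto simp: \<theta>_def)
    qed
  qed
qed

section \<open>Classes modulo null sets\<close>

abbreviation "H2 \<equiv> L2 \<A> \<mu> E"
abbreviation "cls c \<equiv> ae_rel \<A> \<mu> E `` {c}"

lemma equiv_ae_rel: "equiv L2S (ae_rel \<A> \<mu> E)"
proof (rule equivI)
  show "ae_rel \<A> \<mu> E \<subseteq> L2S \<times> L2S" by (auto simp: ae_rel_def)
  show "refl_on L2S (ae_rel \<A> \<mu> E)" by (auto simp: refl_on_def ae_rel_def)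
  show "sym (ae_rel \<A> \<mu> E)" by (auto simp: sym_def ae_rel_def elim: AE_mp)
  show "trans (ae_rel \<A> \<mu> E)" unfolding trans_def ae_rel_def by auto
qed

lemma cls_eqI:
  assumes "c \<in> L2S" "d \<in> L2S" "AE x in \<mu>. c x = d x"
  shows "cls c = cls d"
  by (rule equiv_class_eq[OF equiv_ae_rel]) (use assms in \<open>simp add: ae_rel_def\<close>)

lemma cls_vecs: "c \<in> L2S \<Longrightarrow> cls c \<in> vecs H2"
  by (simp add: L2_def quotientI)

lemma rep_cls:
  assumes "c \<in> L2S"
  shows "rep (cls c) \<in> L2S" "AE x in \<mu>. c x = rep (cls c) x"
proof -
  have "c \<in> cls c" using assms by (simp add: ae_rel_def)
  then have "rep (cls c) \<in> cls c" unfolding rep_def by (rule someI[where P="\<lambda>d. d \<in> cls c"])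
  then show "rep (cls c) \<in> L2S" "AE x in \<mu>. c x = rep (cls c) x" by (auto simp: ae_rel_def)
qed

lemma vecs_cls:
  assumes "X \<in> vecs H2"
  shows "rep X \<in> L2S" "cls (rep X) = X"
proof -
  obtain c where c: "c \<in> L2S" "X = cls c" using assms by (auto simp: L2_def elim: quotientE)
  show "rep X \<in> L2S" using rep_cls(1)[OF c(1)] c(2) by simp
  then show "cls (rep X) = X" using cls_eqI[OF c(1) _ rep_cls(2)[OF c(1)]] c(2) by simp
qed

text \<open>Operations on classes are defined through chosen representatives; this and the analogous
  facts below allow any representative to be used.\<close>

lemma vadd_cls:
  assumes c: "c \<in> L2S" and d: "d \<in> L2S"
  shows "vadd H2 (cls c) (cls d) = cls (sec_add E c d)"
proof -
  have "AE x in \<mu>. sec_add E (rep (cls c)) (rep (cls d)) x = sec_add E c d x"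
    using rep_cls(2)[OF c] rep_cls(2)[OF d] by eventually_elim (simp add: sec_add_def)
  then show ?thesis unfolding L2_def
    by (simp add: cls_eqI[OF L2S_add[OF rep_cls(1)[OF c] rep_cls(1)[OF d]] L2S_add[OF c d]])
qed

lemma mult_op_cls:
  assumes u: "u \<in> Linf \<mu>" and c: "c \<in> L2S"
  shows "mult_op \<A> \<mu> E u (cls c) = cls (sec_mult E u c)"
proof -
  have "AE x in \<mu>. sec_mult E u (rep (cls c)) x = sec_mult E u c x"
    using rep_cls(2)[OF c] by eventually_elim (simp add: sec_mult_def)
  then show ?thesis unfolding mult_op_def
    by (simp add: cls_vecs c cls_eqI[OF L2S_Linf[OF u rep_cls(1)[OF c]] L2S_Linf[OF u c]])
qed

lemma mult_op_vecs:
  assumes "u \<in> Linf \<mu>" "X \<in> vecs H2"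
  shows "mult_op \<A> \<mu> E u X \<in> vecs H2"
  using mult_op_cls[OF assms(1) vecs_cls(1)[OF assms(2)]] vecs_cls[OF assms(2)]
    cls_vecs[OF L2S_Linf[OF assms(1) vecs_cls(1)[OF assms(2)]]] by simp

lemma borel_measurable_cinner [measurable]:
  "f \<in> borel_measurable M \<Longrightarrow> g \<in> borel_measurable M \<Longrightarrow>
    (\<lambda>x. cinner (f x) (g x :: complex^'n)) \<in> borel_measurable M"
  unfolding cinner_def
  by (rule borel_measurable_continuous_Pair) (auto intro!: continuous_intros)

lemma vinner_cls:
  assumes c: "c \<in> L2S" and d: "d \<in> L2S"
  shows "vinner H2 (cls c) (cls d) = (\<integral>x. cinner (coord (c x)) (coord (d x)) \<partial>\<mu>)"
proof -
  note R = L2SD[OF rep_cls(1)[OF c]] L2SD[OF rep_cls(1)[OF d]] L2SD[OF c] L2SD[OF d]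
  note [measurable] = R(2,5,8,11)
  have "vinner H2 (cls c) (cls d)
      = (\<integral>x. cinner (coord (rep (cls c) x)) (coord (rep (cls d) x)) \<partial>\<mu>)"
    unfolding L2_def by (simp add: fibre_inner_coord proj_section R)
  also have "\<dots> = (\<integral>x. cinner (coord (c x)) (coord (d x)) \<partial>\<mu>)"
  proof (rule integral_cong_AE)
    show "AE x in \<mu>. cinner (coord (rep (cls c) x)) (coord (rep (cls d) x)) = cinner (coord (c x)) (coord (d x))"
      using rep_cls(2)[OF c] rep_cls(2)[OF d] by eventually_elim simp
  qed measurable
  finally show ?thesis .
qed

lemma cinner_scale: "cinner (z *s v) (w *s v') = cnj z * w * cinner v v'"
  by (simp add: cinner_def sum_distrib_left mult_ac)

lemma indicator_Linf: "B \<in> sets borel \<Longrightarrow> indicator B \<in> Linf \<mu>"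
  unfolding Linf_def by (auto intro!: exI[of _ 1] simp: indicator_def)

lemma U_Linf_functions_Linf: "u \<in> U_Linf_functions \<mu> \<Longrightarrow> u \<in> Linf \<mu>"
  by (simp add: U_Linf_functions_def)

lemma unimodular_U_Linf:
  assumes "u \<in> borel_measurable \<mu>" "\<And>x. cmod (u x) = 1"
  shows "u \<in> U_Linf_functions \<mu>"
proof -
  have "cnj (u x) * u x = 1" for x
    using complex_norm_square[of "u x"] assms(2)[of x] by (simp add: mult.commute)
  then show ?thesis unfolding U_Linf_functions_def Linf_def using assms by (auto intro!: exI[of _ 1])
qed

section \<open>The fixed point algebra\<close>

theorem fixed_point_algebra:
  fixes a :: "('m \<Rightarrow> 'e) set \<Rightarrow> 'a::unital_cstar_algebra"
  assumes a: "is_CAR H2 a" and \<alpha>: "CAR_action H2 a (U_Linf \<A> \<mu> E) \<alpha>" and W: "W \<in> sets borel"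
  shows "local_algebra \<A> \<mu> E a W = {A. \<forall>U\<in>U_Linf_on \<A> \<mu> E (- W). \<alpha> U A = A}"
proof -
  define M where "M = mult_op \<A> \<mu> E"
  define P where "P = M (indicator W)"
  define Q where "Q = M (indicator (- W))"
  have W': "- W \<in> sets borel" using W by auto
  note iW = indicator_Linf[OF W] and iW' = indicator_Linf[OF W']
  note [measurable] = W W'
  \<comment> \<open>The action is given on the full group, so it provides the parity automorphism
    even when -1 is not in the subgroup.\<close>
  have m1: "(\<lambda>_. - 1) \<in> U_Linf_functions \<mu>" by (rule unimodular_U_Linf) auto
  have act: "star_automorphism (\<alpha> U)" "f \<in> vecs H2 \<Longrightarrow> \<alpha> U (a f) = a (U f)"
    if "U \<in> U_Linf \<A> \<mu> E" for U f
    using \<alpha> that unfolding CAR_action_def by blast+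
  have sub: "U_Linf_on \<A> \<mu> E (- W) \<subseteq> U_Linf \<A> \<mu> E"
    unfolding U_Linf_on_def U_Linf_def by blast
  have M1: "M (\<lambda>_. - 1) \<in> U_Linf \<A> \<mu> E" using m1 by (auto simp: U_Linf_def M_def)
  have "local_algebra \<A> \<mu> E a W = unital_cstar_subalgebra hull (a ` P ` vecs H2)"
    by (simp add: local_algebra_def L2_on_def P_def M_def)
  also have "\<dots> = {A. \<forall>U\<in>U_Linf_on \<A> \<mu> E (- W). \<alpha> U A = A}"
  proof (rule CAR_fixed_points[OF a, where Q=Q and \<gamma>="\<alpha> (M (\<lambda>_. - 1))"])
    show "P f \<in> vecs H2" "Q f \<in> vecs H2" if "f \<in> vecs H2" for f
      unfolding P_def Q_def M_def using that iW iW' by (auto intro: mult_op_vecs)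
    show "vadd H2 (P f) (Q f) = f" if f: "f \<in> vecs H2" for f
    proof -
      let ?c = "rep f"
      note c = vecs_cls[OF f]
      have "sec_add E (sec_mult E (indicator W) ?c) (sec_mult E (indicator (- W)) ?c) = ?c"
      proof
        fix x show "sec_add E (sec_mult E (indicator W) ?c) (sec_mult E (indicator (- W)) ?c) x = ?c x"
          using L2SD(1)[OF c(1)]
          by (intro section_eqI sec_add_sections sec_mult_sections)
             (auto simp: coord_sec_add coord_sec_mult sec_mult_sections indicator_def vec_eq_iff)
      qed
      then show ?thesis
        using mult_op_cls[OF iW c(1)] mult_op_cls[OF iW' c(1)]
          vadd_cls[OF L2S_Linf[OF iW c(1)] L2S_Linf[OF iW' c(1)]]
        by (simp add: P_def Q_def M_def c(2))
    qed
    show "vinner H2 (P f) (Q g) = 0" if f: "f \<in> vecs H2" and g: "g \<in> vecs H2" for f g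
    proof -
      note c = vecs_cls[OF f] and d = vecs_cls[OF g]
      have "vinner H2 (P f) (Q g) = (\<integral>x. cinner (coord (sec_mult E (indicator W) (rep f) x))
          (coord (sec_mult E (indicator (- W)) (rep g) x)) \<partial>\<mu>)"
        using mult_op_cls[OF iW c(1)] mult_op_cls[OF iW' d(1)]
          vinner_cls[OF L2S_Linf[OF iW c(1)] L2S_Linf[OF iW' d(1)]]
        by (simp add: P_def Q_def M_def c(2) d(2))
      also have "\<dots> = (\<integral>x. 0 \<partial>\<mu>)"
        by (intro Bochner_Integration.integral_cong) (auto simp: coord_sec_mult cinner_scale indicator_def)
      finally show ?thesis by simp
    qed
    show "star_automorphism (\<alpha> (M (\<lambda>_. - 1)))" by (rule act(1)[OF M1])
    show "\<alpha> (M (\<lambda>_. - 1)) (a f) = - a f" if f: "f \<in> vecs H2" for f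
    proof -
      have "M (\<lambda>_. - 1) f = vscale H2 (- 1) f" using f by (simp add: M_def mult_op_def L2_def)
      then show ?thesis using act(2)[OF M1 f] is_CARD(2)[OF a f f, of "- 1"] by simp
    qed
    show "star_automorphism (\<alpha> U)" if "U \<in> U_Linf_on \<A> \<mu> E (- W)" for U
      using act(1) sub that by blast
    show "U f \<in> vecs H2" if U: "U \<in> U_Linf_on \<A> \<mu> E (- W)" and f: "f \<in> vecs H2" for U f
      using U mult_op_vecs[OF U_Linf_functions_Linf f] by (auto simp: U_Linf_on_def)
    show "\<alpha> U (a f) = a (U f)" if "U \<in> U_Linf_on \<A> \<mu> E (- W)" "f \<in> vecs H2" for U f
      using act(2) sub that by blast
    show "U (P f) = P f" if U: "U \<in> U_Linf_on \<A> \<mu> E (- W)" and f: "f \<in> vecs H2" for U f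
    proof -
      obtain u where u: "u \<in> U_Linf_functions \<mu>" "AE x in \<mu>. x \<in> W \<longrightarrow> u x = 1" "U = mult_op \<A> \<mu> E u"
        using U by (auto simp: U_Linf_on_def)
      note c = vecs_cls[OF f]
      have Pf: "P f = cls (sec_mult E (indicator W) (rep f))"
        using mult_op_cls[OF iW c(1)] by (simp add: P_def M_def c(2))
      note Pc = L2S_Linf[OF iW c(1)]
      have "U (P f) = cls (sec_mult E u (sec_mult E (indicator W) (rep f)))"
        unfolding Pf u(3) by (rule mult_op_cls[OF U_Linf_functions_Linf[OF u(1)] Pc])
      also have "\<dots> = cls (sec_mult E (indicator W) (rep f))"
      proof (rule cls_eqI[OF L2S_Linf[OF U_Linf_functions_Linf[OF u(1)] Pc] Pc])
        show "AE x in \<mu>. sec_mult E u (sec_mult E (indicator W) (rep f)) x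
            = sec_mult E (indicator W) (rep f) x"
          using u(2)
        proof eventually_elim
          case (elim x)
          then show ?case using L2SD(1)[OF c(1)]
            by (intro section_eqI sec_mult_sections)
               (auto simp: coord_sec_mult indicator_def vec_eq_iff)
        qed
      qed
      finally show ?thesis by (simp add: Pf)
    qed
    show "\<exists>u :: nat \<Rightarrow> _. (\<forall>k. u k \<in> U_Linf_on \<A> \<mu> E (- W)) \<and>
        (\<forall>j k. j \<noteq> k \<longrightarrow> vinner H2 (u j (Q f)) (u k (Q f)) = 0)" if f: "f \<in> vecs H2" for f
    proof -
      note c = vecs_cls[OF f]
      define h where "h = sec_mult E (indicator (- W)) (rep f)"
      have h: "h \<in> L2S" unfolding h_def by (rule L2S_Linf[OF iW' c(1)])
      have Qf: "Q f = cls h"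
        using mult_op_cls[OF iW' c(1)] by (simp add: Q_def M_def c(2) h_def)
      have hW: "coord (h x) = 0" if "x \<in> W" for x
        using that by (simp add: h_def coord_sec_mult vec_eq_iff)
      note [measurable] = L2SD(2)[OF h]
      \<comment> \<open>With this weight the inner product of two rotated copies of \<open>h\<close>
        is the integral of \<rho> against the product of their phases.\<close>
      define \<rho> where "\<rho> x = (norm (coord (h x)))\<^sup>2" for x
      have [measurable]: "\<rho> \<in> borel_measurable \<mu>" unfolding \<rho>_def by measurable
      have \<rho>: "0 \<le> \<rho> x" for x by (simp add: \<rho>_def)
      have \<rho>fin: "(\<integral>\<^sup>+x. ennreal (\<rho> x) \<partial>\<mu>) < \<infinity>"
        using L2SD(3)[OF h] by (simp add: N2_coord \<rho>_def)
      obtain \<theta> :: "'m \<Rightarrow> real" where \<theta>: "\<theta> \<in> borel_measurable \<mu>" "\<And>t. {x \<in> space \<mu>. \<theta> x = t} \<in> null_sets \<mu>"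
        using atomless_function by blast
      obtain w :: "nat \<Rightarrow> 'm \<Rightarrow> complex" where w [measurable]: "\<And>k. w k \<in> borel_measurable \<mu>"
        and w1: "\<And>k x. cmod (w k x) = 1"
        and worth: "\<And>j k. j \<noteq> k \<Longrightarrow> (\<integral>x. \<rho> x *\<^sub>R (cnj (w j x) * w k x) \<partial>\<mu>) = 0"
        by (rule orthogonal_phases[OF \<open>\<rho> \<in> borel_measurable \<mu>\<close> \<theta>(1) \<rho> \<rho>fin \<theta>(2)]) blast
      \<comment> \<open>Resetting the phases to 1 on \<open>W\<close> puts them in the subgroup and
        leaves the inner products unchanged, because \<open>h\<close> vanishes there.\<close>
      define u where "u k x = (if x \<in> W then 1 else w k x)" for k x
      have um: "u k \<in> borel_measurable \<mu>" for k unfolding u_def by measurable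
      have uU: "u k \<in> U_Linf_functions \<mu>" for k
        by (rule unimodular_U_Linf[OF um]) (simp add: u_def w1)
      have "vinner H2 (M (u j) (Q f)) (M (u k) (Q f)) = 0" if "j \<noteq> k" for j k
      proof -
        note L = U_Linf_functions_Linf[OF uU]
        have "vinner H2 (M (u j) (Q f)) (M (u k) (Q f))
            = (\<integral>x. cinner (coord (sec_mult E (u j) h x)) (coord (sec_mult E (u k) h x)) \<partial>\<mu>)"
          unfolding Qf M_def mult_op_cls[OF L h] by (rule vinner_cls[OF L2S_Linf[OF L h] L2S_Linf[OF L h]])
        also have "\<dots> = (\<integral>x. \<rho> x *\<^sub>R (cnj (w j x) * w k x) \<partial>\<mu>)"
        proof (rule Bochner_Integration.integral_cong[OF refl])
          fix x
          show "cinner (coord (sec_mult E (u j) h x)) (coord (sec_mult E (u k) h x))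
              = \<rho> x *\<^sub>R (cnj (w j x) * w k x)"
            by (cases "x \<in> W")
               (simp_all add: coord_sec_mult cinner_scale cinner_self \<rho>_def u_def hW scaleR_conv_of_real)
        qed
        also have "\<dots> = 0" by (rule worth[OF that])
        finally show ?thesis .
      qed
      moreover have "M (u k) \<in> U_Linf_on \<A> \<mu> E (- W)" for k
        unfolding U_Linf_on_def M_def using uU by (auto simp: u_def)
      ultimately show ?thesis by (intro exI[of _ "\<lambda>k. M (u k)"]) blast
    qed
  qed
  finally show ?thesis .
qed

end

theorem theorem3p1:
  fixes \<A> :: "('m::t2_space, 'k::finite) chart set"
    and \<mu> :: "'m measure"
    and G :: "(complex^'n::finite^'n) set"
    and E :: "('e::topological_space, 'm, 'n) vector_bundle"
    and a :: "('m \<Rightarrow> 'e) set \<Rightarrow> 'a::unital_cstar_algebra"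
    and \<alpha> :: "(('m \<Rightarrow> 'e) set \<Rightarrow> ('m \<Rightarrow> 'e) set) \<Rightarrow> 'a \<Rightarrow> 'a"
    and W :: "'m set"
  assumes "sigma_compact (UNIV :: 'm set)"
    and "smooth_atlas \<A>"
    and "locally_lebesgue \<A> \<mu>"
    and "closed_unitary_subgroup G"
    and "G_bundle \<A> G E"
    and "is_CAR (L2 \<A> \<mu> E) a"
    and "CAR_action (L2 \<A> \<mu> E) a (U_Linf \<A> \<mu> E) \<alpha>"
    and "W \<in> sets borel"
    and "compact (closure W)"
  shows "local_algebra \<A> \<mu> E a W = {A. \<forall>U\<in>U_Linf_on \<A> \<mu> E (- W). \<alpha> U A = A}"
proof -
  interpret hermitian_bundle \<A> \<mu> G E using assms(1-5) by unfold_locales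
  show ?thesis by (rule fixed_point_algebra[OF assms(6-8)])
qed

end
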